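(* Let $d\ge2$, let $\beta_{ii}>0$ for all $i=1,\dots,d$ and $\beta_{ij}=\beta_{ji}\in\mathbb{R}$ for all $i\ne j$, and let $\mathbf{a}$ be an $m$-decomposition of $d$ for some $2\le m\le d$. If - $\beta_{ij}\ge0$ for all $(i,j)\in\mathcal{K}_1$; - $\beta_{ij}\le0$ for all $(i,j)\in\mathcal{K}_2$, and there exist $h_1\ne h_2$ such that $\beta_{ij}<0$ for every $(i,j)\in I_{h_1}\times I_{h_2}$; then $l:=\inf_{\mathcal{M}}E$ is not achieved, and $l=\sum_{h=1}^ml_h$.
   Context: An $m$-decomposition of $d$ is $\mathbf{a}=(a_0,\dots,a_m)\in\mathbb{N}^{m+1}$ with $0=a_0<a_1<\dots<a_m=d$; set $I_h:=\{i: a_{h-1}<i\le a_h\}$, $\mathcal{K}_1:=\{(i,j)\in I_h^2 \text{ for some } h,\ i\neq j\}$, $\mathcal{K}_2:=\{(i,j)\in I_h\times I_k,\ h\ne k\}$. Define $$E(\mathbf{u})=\frac12\sum_{h=1}^{m}\int_{\mathbb{R}^4}\sum_{i\in I_h}|\nabla u_i|^2-\frac14\sum_{h,k=1}^m\int_{\mathbb{R}^4}\sum_{(i,j)\in I_h\times I_k}\beta_{ij}u_j^2u_i^2,\qquad \mathbf{u}\in\mathcal{D}^{1,2}(\mathbb{R}^4;\mathbb{R}^d),$$ $$\mathcal{M}:=\Big\{\mathbf{u}\in\mathcal{D}^{1,2}(\mathbb{R}^4;\mathbb{R}^d):\ (u_i)_{i\in I_h}\ne\mathbf{0}\ \text{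 and }\ \sum_{i\in I_h}\partial_iE(\mathbf{u})u_i=0\ \text{ for every }h=1,\dots,m\Big\}.$$ For each $h$, $$E_h(\mathbf{v})=\int_{\mathbb{R}^4}\frac12\sum_{i\in I_h}|\nabla v_i|^2-\frac14\sum_{(i,j)\in I_h^2}\beta_{ij}v_j^2v_i^2\,dx,\quad \mathbf{v}\in\mathcal{D}^{1,2}(\mathbb{R}^4)^{|I_h|},$$ and $l_h:=\inf\{E_h(\mathbf{v}):\mathbf{v}\ne\mathbf{0},\ \langle\nabla E_h(\mathbf{v}),\mathbf{v}\rangle=0\}$. *)

theory Defs
  imports "HOL-Analysis.Analysis"
begin

type_synonym R4 = "real ^ 4"

definition partial :: "4 \<Rightarrow> (R4 \<Rightarrow> real) \<Rightarrow> R4 \<Rightarrow> real" where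
  "partial k f x = frechet_derivative f (at x) (axis k 1)"

text \<open>Differentiability is required explicitly because \<^const>\<open>frechet_derivative\<close> is a total function.\<close>

primrec C_k :: "nat \<Rightarrow> (R4 \<Rightarrow> real) \<Rightarrow> bool" where
  "C_k 0 f \<longleftrightarrow> continuous_on UNIV f"
| "C_k (Suc n) f \<longleftrightarrow> (\<forall>x. f differentiable (at x)) \<and> (\<forall>k. C_k n (partial k f))"

definition test_functions :: "(R4 \<Rightarrow> real) set" where
  "test_functions = {\<phi>. (\<forall>n. C_k n \<phi>) \<and> compact (closure {x. \<phi> x \<noteq> 0})}"

definition is_L2_weak_gradient :: "(R4 \<Rightarrow> real) \<Rightarrow> (R4 \<Rightarrow> R4) \<Rightarrow> bool" where
  "is_L2_weak_gradient u g \<longleftrightarrow>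
     g \<in> borel_measurable lborel \<and> integrable lborel (\<lambda>x. (norm (g x))\<^sup>2) \<and>
     (\<forall>\<phi>\<in>test_functions. \<forall>k. (LINT x|lborel. u x * partial k \<phi> x) = - (LINT x|lborel. g x $ k * \<phi> x))"

text \<open>The space of functions in L^4 (4 is the critical Sobolev exponent in dimension 4) with weak
  gradient in L^2. An element is a Borel function; equality in the space is equality almost everywhere,
  and everything below is invariant under changing a function on a null set.\<close>

definition D12 :: "(R4 \<Rightarrow> real) set" where
  "D12 = {u. u \<in> borel_measurable lborel \<and> integrable lborel (\<lambda>x. (u x) ^ 4) \<and>
             (\<exists>g. is_L2_weak_gradient u g)}"

text \<open>For \<open>u\<close> in \<^const>\<open>D12\<close> the weak gradient is unique almost everywhere, so the choice is immaterial.\<close>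

definition weak_grad :: "(R4 \<Rightarrow> real) \<Rightarrow> R4 \<Rightarrow> R4" where
  "weak_grad u = (SOME g. is_L2_weak_gradient u g)"

text \<open>A vector \<open>(u\<^sub>1,\<dots>,u\<^sub>d)\<close> is a family indexed by \<^typ>\<open>nat\<close>; only the components in the relevant index
  set (\<open>{1..d}\<close>, or a single block) are ever used. The condition on \<open>u\<close> to be nonzero is that
  some component with index in \<open>J\<close> is not almost everywhere zero.\<close>

type_synonym fam = "nat \<Rightarrow> R4 \<Rightarrow> real"

definition D12_vec :: "nat set \<Rightarrow> fam set" where
  "D12_vec J = {u. \<forall>i\<in>J. u i \<in> D12}"

definition nonzero_on :: "nat set \<Rightarrow> fam \<Rightarrow> bool" where
  "nonzero_on J u \<longleftrightarrow> (\<exists>i\<in>J. \<not> (AE x in lborel. u i x = 0))"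

text \<open>\<open>dfun F u w\<close> is the derivative of the functional \<open>F\<close> at \<open>u\<close> in the direction \<open>w\<close>, that is the pairing of
  the gradient of \<open>F\<close> at \<open>u\<close> with \<open>w\<close>, and \<open>dfun_comp F i u \<phi>\<close> is the \<open>i\<close>-th partial derivative of \<open>F\<close>
  at \<open>u\<close>, applied to \<open>\<phi>\<close>. The functionals below are polynomials of degree at most 4 along every
  line in the function space, so the derivatives exist.\<close>

definition dfun :: "(fam \<Rightarrow> real) \<Rightarrow> fam \<Rightarrow> fam \<Rightarrow> real" where
  "dfun F u w = deriv (\<lambda>t::real. F (\<lambda>i x. u i x + t * w i x)) 0"

definition dfun_comp :: "(fam \<Rightarrow> real) \<Rightarrow> nat \<Rightarrow> fam \<Rightarrow> (R4 \<Rightarrow> real) \<Rightarrow> real" where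
  "dfun_comp F i u \<phi> = dfun F u (\<lambda>j. if j = i then \<phi> else (\<lambda>x. 0))"

definition decomposition :: "nat \<Rightarrow> nat \<Rightarrow> (nat \<Rightarrow> nat) \<Rightarrow> bool" where
  "decomposition m d a \<longleftrightarrow> a 0 = 0 \<and> a m = d \<and> (\<forall>h<m. a h < a (Suc h))"

definition block :: "(nat \<Rightarrow> nat) \<Rightarrow> nat \<Rightarrow> nat set" where
  "block a h = {i. a (h - 1) < i \<and> i \<le> a h}"

definition K1 :: "nat \<Rightarrow> (nat \<Rightarrow> nat) \<Rightarrow> (nat \<times> nat) set" where
  "K1 m a = {(i, j). (\<exists>h\<in>{1..m}. i \<in> block a h \<and> j \<in> block a h) \<and> i \<noteq> j}"

definition K2 :: "nat \<Rightarrow> (nat \<Rightarrow> nat) \<Rightarrow> (nat \<times> nat) set" where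
  "K2 m a = {(i, j). \<exists>h\<in>{1..m}. \<exists>k\<in>{1..m}. h \<noteq> k \<and> i \<in> block a h \<and> j \<in> block a k}"

definition energy :: "nat \<Rightarrow> (nat \<Rightarrow> nat) \<Rightarrow> (nat \<Rightarrow> nat \<Rightarrow> real) \<Rightarrow> fam \<Rightarrow> real" where
  "energy m a \<beta> u =
     1/2 * (\<Sum>h=1..m. LINT x|lborel. (\<Sum>i\<in>block a h. (norm (weak_grad (u i) x))\<^sup>2))
   - 1/4 * (\<Sum>h=1..m. \<Sum>k=1..m. LINT x|lborel.
        (\<Sum>(i, j)\<in>block a h \<times> block a k. \<beta> i j * (u j x)\<^sup>2 * (u i x)\<^sup>2))"

definition Nehari :: "nat \<Rightarrow> nat \<Rightarrow> (nat \<Rightarrow> nat) \<Rightarrow> (nat \<Rightarrow> nat \<Rightarrow> real) \<Rightarrow> fam set" where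
  "Nehari d m a \<beta> = {u \<in> D12_vec {1..d}. \<forall>h\<in>{1..m}.
      nonzero_on (block a h) u \<and>
      (\<Sum>i\<in>block a h. dfun_comp (energy m a \<beta>) i u (u i)) = 0}"

definition level :: "nat \<Rightarrow> nat \<Rightarrow> (nat \<Rightarrow> nat) \<Rightarrow> (nat \<Rightarrow> nat \<Rightarrow> real) \<Rightarrow> real" where
  "level d m a \<beta> = Inf (energy m a \<beta> ` Nehari d m a \<beta>)"

definition block_energy :: "(nat \<Rightarrow> nat) \<Rightarrow> (nat \<Rightarrow> nat \<Rightarrow> real) \<Rightarrow> nat \<Rightarrow> fam \<Rightarrow> real" where
  "block_energy a \<beta> h v =
     (LINT x|lborel. 1/2 * (\<Sum>i\<in>block a h. (norm (weak_grad (v i) x))\<^sup>2)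
        - 1/4 * (\<Sum>(i, j)\<in>block a h \<times> block a h. \<beta> i j * (v j x)\<^sup>2 * (v i x)\<^sup>2))"

definition block_Nehari :: "(nat \<Rightarrow> nat) \<Rightarrow> (nat \<Rightarrow> nat \<Rightarrow> real) \<Rightarrow> nat \<Rightarrow> fam set" where
  "block_Nehari a \<beta> h = {v \<in> D12_vec (block a h).
      nonzero_on (block a h) v \<and> dfun (block_energy a \<beta> h) v v = 0}"

definition block_level :: "(nat \<Rightarrow> nat) \<Rightarrow> (nat \<Rightarrow> nat \<Rightarrow> real) \<Rightarrow> nat \<Rightarrow> real" where
  "block_level a \<beta> h = Inf (block_energy a \<beta> h ` block_Nehari a \<beta> h)"

end

theory Submission
  imports Defs
begin

text \<open>On the Nehari set the energy is a quarter of the Dirichlet energy, and since the interaction between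
  different blocks is repulsive, every block of an admissible vector can be scaled down onto the Nehari
  set of its own functional. This gives \<open>\<Sum>\<^sub>h l\<^sub>h \<le> l\<close>. Conversely, nearly optimal profiles of the blocks that are
  translated far away from each other hardly interact, and a small correction of their amplitudes puts them on the
  Nehari set, whence equality.

  If \<open>l\<close> were achieved, every block would be a minimizer for \<open>l\<^sub>h\<close> and all interactions would vanish; in
  particular \<open>u\<^sub>i u\<^sub>j = 0\<close> a.e. for \<open>i \<in> I\<^bsub>h1\<^esub>\<close>, \<open>j \<in> I\<^bsub>h2\<^esub>\<close>. But the absolute values of a minimizer form a
  minimizer again, hence they are weakly superharmonic, and by the strong maximum principle each of them
  is either zero a.e. or positive a.e. For the maximum principle the equation is tested with
  \<open>(\<bar>x - y\<bar>\<^sup>2 + \<delta>\<^sup>2)\<^sup>-\<^sup>1\<close>, a regularisation of the fundamental solution of the Laplacian.\<close>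

section \<open>Smooth functions and test functions\<close>

text \<open>Minimality enters only through the homogeneous inequality \<open>4 * block_level a
  \<beta> h * EB \<beta> J J v \<le> (EA J v)\<^sup>2\<close>, where \<open>J\<close> is the block.
  It holds for every nonzero \<open>v\<close>, hence off the constraint set as well. Applied to a
  block of an element of the Nehari set, where competition leaves EA \<le> EB, it gives the lower
  bound for the energy; applied to an upward perturbation of a minimizer, its first-order part is
  the supersolution inequality.

  The main obstacle is the passage from superharmonic to positive. The functions are classes in L4
  without distinguished pointwise values, and the zero set may a priori have positive measure, so
  the maximum principle is proved by integrating over that zero set. It rests on the continuity of
  translations in L1, which also yields, through difference quotients, the weak gradient of an
  absolute value.

  In the upper bound the unknowns are the squared amplitudes: every interaction is quadratic in each
  of two amplitudes, so the constraints become a linear system for these squares.\<close>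

lemma partial_eq: "(f has_derivative D) (at x) \<Longrightarrow> partial k f x = D (axis k 1)"
  unfolding partial_def by (metis frechet_derivative_at)

lemma partial_has_derivative:
  assumes "(f has_derivative D) (at x)"
  shows "D v = (\<Sum>k\<in>UNIV. v $ k * partial k f x)"
proof -
  interpret D: bounded_linear D using assms by (rule has_derivative_bounded_linear)
  have "v = (\<Sum>k\<in>UNIV. (v $ k) *\<^sub>R axis k 1)"
    by (simp add: vec_eq_iff axis_def if_distrib cong: if_cong)
  then have "D v = D (\<Sum>k\<in>UNIV. (v $ k) *\<^sub>R axis k 1)" by simp
  then show ?thesis
    using partial_eq[OF assms] by (simp add: D.sum D.scale)
qed

lemma C_k_Suc_D: "C_k (Suc n) f \<Longrightarrow> C_k n f"
proof (induction n arbitrary: f)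
  case 0
  then show ?case
    by (auto simp: continuous_on_eq_continuous_at intro: differentiable_imp_continuous_within)
next
  case (Suc n)
  then show ?case by (metis C_k.simps(2))
qed

lemma C_k_imp_continuous: "C_k n f \<Longrightarrow> continuous_on UNIV f"
proof (induction n)
  case (Suc n)
  then show ?case using C_k_Suc_D by blast
qed simp

lemma has_derivative_C_k:
  assumes "C_k (Suc n) f"
  shows "(f has_derivative (\<lambda>v. \<Sum>k\<in>UNIV. v $ k * partial k f x)) (at x)"
proof -
  obtain D where D: "(f has_derivative D) (at x)"
    using assms by (auto simp: differentiable_def)
  have "D = (\<lambda>v. \<Sum>k\<in>UNIV. v $ k * partial k f x)"
    using partial_has_derivative[OF D] by blast
  with D show ?thesis by simp
qed

text \<open>An explicit derivative settles differentiability and identifies all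
  \<open>partial k f\<close> at once. The closure lemmas below thus reduce to showing that the chain
  or product rule stays within the class.\<close>

lemma C_k_SucI:
  assumes "\<And>x. (f has_derivative D x) (at x)" "\<And>k. C_k n (\<lambda>x. D x (axis k 1))"
  shows "C_k (Suc n) f"
proof -
  have "partial k f = (\<lambda>x. D x (axis k 1))" for k
    using partial_eq[OF assms(1)] by blast
  then show ?thesis using assms by (auto simp: differentiable_def)
qed

lemma C_k_const: "C_k n (\<lambda>x. c)"
proof (induction n arbitrary: c)
  case (Suc n)
  show ?case by (rule C_k_SucI[where D="\<lambda>_ _. 0"]) (use Suc in auto)
qed auto

lemma C_k_add: "C_k n f \<Longrightarrow> C_k n g \<Longrightarrow> C_k n (\<lambda>x. f x + g x)"
proof (induction n arbitrary: f g)
  case 0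
  then show ?case by (auto intro: continuous_intros)
next
  case (Suc n)
  show ?case
    by (rule C_k_SucI[OF has_derivative_add[OF has_derivative_C_k[OF Suc(2)] has_derivative_C_k[OF Suc(3)]]])
       (use Suc in \<open>auto simp: axis_def if_distrib if_distribR cong: if_cong\<close>)
qed

lemma C_k_mult: "C_k n f \<Longrightarrow> C_k n g \<Longrightarrow> C_k n (\<lambda>x. f x * g x)"
proof (induction n arbitrary: f g)
  case 0
  then show ?case by (auto intro: continuous_intros)
next
  case (Suc n)
  show ?case
  proof (rule C_k_SucI[OF has_derivative_mult[OF has_derivative_C_k[OF Suc(2)] has_derivative_C_k[OF Suc(3)]]])
    fix k :: 4
    have "C_k n (\<lambda>x. f x * partial k g x + partial k f x * g x)"
      using Suc C_k_Suc_D[OF Suc(2)] C_k_Suc_D[OF Suc(3)] by (intro C_k_add Suc.IH) auto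
    then show "C_k n (\<lambda>x. f x * (\<Sum>ka\<in>UNIV. axis k 1 $ ka * partial ka g x) +
        (\<Sum>ka\<in>UNIV. axis k 1 $ ka * partial ka f x) * g x)"
      by (simp add: axis_def if_distrib if_distribR cong: if_cong)
  qed
qed

lemma C_k_cmult: "C_k n f \<Longrightarrow> C_k n (\<lambda>x. c * f x)"
  by (intro C_k_mult C_k_const)

lemma C_k_prod: "(\<And>i. i \<in> I \<Longrightarrow> C_k n (f i)) \<Longrightarrow> C_k n (\<lambda>x. \<Prod>i\<in>I. f i x)"
  by (induction I rule: infinite_finite_induct) (auto intro: C_k_const C_k_mult)

lemma C_k_sum: "(\<And>i. i \<in> I \<Longrightarrow> C_k n (f i)) \<Longrightarrow> C_k n (\<lambda>x. \<Sum>i\<in>I. f i x)"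
  by (induction I rule: infinite_finite_induct) (auto intro: C_k_const C_k_add)

lemma C_k_coord: "C_k n (\<lambda>x. x $ i)"
proof (cases n)
  case (Suc m)
  show ?thesis unfolding Suc
    by (rule C_k_SucI[where D="\<lambda>_ v. v $ i"])
       (auto intro!: bounded_linear_imp_has_derivative bounded_linear_vec_nth C_k_const)
qed (auto intro: continuous_intros)

lemma C_k_inverse: "C_k n f \<Longrightarrow> (\<And>x. f x \<noteq> 0) \<Longrightarrow> C_k n (\<lambda>x. inverse (f x))"
proof (induction n arbitrary: f)
  case 0
  then show ?case by (auto intro: continuous_intros)
next
  case (Suc n)
  have "C_k n (\<lambda>x. inverse (f x))" using Suc C_k_Suc_D by blast
  \<comment> \<open>The factors are arranged as in the derivative rule for \<open>inverse\<close>;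
    the induction hypothesis covers both reciprocals, since they are needed only in
    \<open>C_k n\<close>.\<close>
  then have "C_k n (\<lambda>x. (-1) * (inverse (f x) * partial k f x * inverse (f x)))" for k
    using Suc(2) by (intro C_k_cmult C_k_mult) auto
  then show ?case
    by (intro C_k_SucI[OF Deriv.has_derivative_inverse[OF Suc(3) has_derivative_C_k[OF Suc(2)]]])
       (simp add: axis_def if_distrib if_distribR cong: if_cong)
qed

lemma has_derivative_affine:
  assumes "(f has_derivative D) (at (y + c *\<^sub>R x))"
  shows "((\<lambda>x. f (y + c *\<^sub>R x)) has_derivative (\<lambda>v. D (c *\<^sub>R v))) (at x)"
  by (rule has_derivative_compose[of "\<lambda>x. y + c *\<^sub>R x" "\<lambda>v. c *\<^sub>R v" x UNIV f D])
     (auto intro!: derivative_eq_intros assms)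

lemma partial_affine:
  assumes "f differentiable (at (y + c *\<^sub>R x))"
  shows "partial k (\<lambda>x. f (y + c *\<^sub>R x)) x = c * partial k f (y + c *\<^sub>R x)"
proof -
  obtain D where D: "(f has_derivative D) (at (y + c *\<^sub>R x))" using assms by (auto simp: differentiable_def)
  have "D (c *\<^sub>R axis k 1) = c *\<^sub>R D (axis k 1)"
    using has_derivative_bounded_linear[OF D] by (simp add: linear_simps)
  then show ?thesis using partial_eq[OF D] partial_eq[OF has_derivative_affine[OF D]] by simp
qed

lemma C_k_affine: "C_k n f \<Longrightarrow> C_k n (\<lambda>x. f (y + c *\<^sub>R x))"
proof (induction n arbitrary: f)
  case 0
  then show ?case
    by (auto intro!: continuous_intros continuous_on_compose2[of UNIV f])
next
  case (Suc n)
  show ?case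
    by (rule C_k_SucI[OF has_derivative_affine[OF has_derivative_C_k[OF Suc(2)]]])
       (use Suc in \<open>auto simp: axis_def if_distrib if_distribR cong: if_cong intro!: C_k_cmult\<close>)
qed

text \<open>The family \<open>flat n\<close> is closed under differentiation up to linear combinations, so that
  smoothness of all its members is obtained by a single induction.\<close>

definition flat :: "nat \<Rightarrow> real \<Rightarrow> real" where
  "flat n t = (if 0 < t then inverse t ^ n * exp (- inverse t) else 0)"

lemma flat_tendsto_0: "(flat n \<longlongrightarrow> 0) (at 0)"
proof -
  have "((\<lambda>t::real. inverse t ^ n / exp (inverse t)) \<longlongrightarrow> 0) (at_right 0)"
    by (rule filterlim_compose[OF tendsto_power_div_exp_0 filterlim_inverse_at_top_right])
  then have "(flat n \<longlongrightarrow> 0) (at_right 0)"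
    by (rule Lim_transform_eventually)
       (auto simp: flat_def exp_minus field_simps eventually_at_filter)
  moreover have "(flat n \<longlongrightarrow> 0) (at_left 0)"
    by (rule Lim_transform_eventually[OF tendsto_const]) (auto simp: flat_def eventually_at_filter)
  ultimately show ?thesis by (simp add: filterlim_split_at)
qed

text \<open>For positive \<open>t\<close>, differentiating the exponential raises the power of
  \<open>inverse t\<close> by two, and differentiating the power raises it by one. At the origin the
  difference quotient of \<open>flat n\<close> is \<open>flat (Suc n)\<close> itself, which tends to
  0.\<close>

lemma flat_has_derivative:
  "(flat n has_real_derivative flat (n + 2) t - real n * flat (Suc n) t) (at t)"
proof -
  consider "t < 0" | "t = 0" | "t > 0" by linarith
  then show ?thesis
  proof cases
    case 1
    have "((\<lambda>_. 0) has_real_derivative 0) (at t)" by simp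
    then have "(flat n has_real_derivative 0) (at t)"
      by (rule DERIV_cong_ev[THEN iffD1, rotated 3])
         (use 1 in \<open>auto simp: flat_def intro: eventually_mono[OF eventually_nhds_in_open[of "{..<0}"]]\<close>)
    with 1 show ?thesis by (simp add: flat_def)
  next
    case 2
    have "(\<lambda>h. (flat n (0 + h) - flat n 0) / h) = flat (Suc n)"
      by (auto simp: flat_def field_simps)
    then have "(flat n has_real_derivative 0) (at 0)"
      unfolding DERIV_def using flat_tendsto_0[of "Suc n"] by simp
    with 2 show ?thesis by (simp add: flat_def)
  next
    case 3
    have "real n * inverse t ^ (n - Suc 0) * (- (inverse t * 1 * inverse t)) * exp (- inverse t) +
        exp (- inverse t) * (inverse t * 1 * inverse t) * inverse t ^ n =
       flat (n + 2) t - real n * flat (Suc n) t"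
      using 3 by (cases n) (simp_all add: flat_def algebra_simps)
    moreover have "((\<lambda>t. inverse t ^ n * exp (- inverse t)) has_real_derivative
       real n * inverse t ^ (n - Suc 0) * (- (inverse t * 1 * inverse t)) * exp (- inverse t) +
        exp (- inverse t) * (inverse t * 1 * inverse t) * inverse t ^ n) (at t)"
      using 3 by (auto intro!: derivative_eq_intros)
    ultimately have "((\<lambda>t. inverse t ^ n * exp (- inverse t)) has_real_derivative
       flat (n + 2) t - real n * flat (Suc n) t) (at t)" by simp
    then show ?thesis
      by (rule DERIV_cong_ev[THEN iffD1, rotated 3])
         (use 3 in \<open>auto simp: flat_def intro: eventually_mono[OF eventually_nhds_in_open[of "{0<..}"]]\<close>)
  qed
qed

lemma isCont_flat: "isCont (flat n) t"
  using DERIV_isCont[OF flat_has_derivative] .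

lemma C_k_flat: "C_k n f \<Longrightarrow> C_k n (\<lambda>x. flat m (f x))"
proof (induction n arbitrary: m)
  case 0
  then show ?case
    using continuous_on_compose2[of UNIV "flat m" UNIV f] by (auto simp: continuous_at_imp_continuous_on isCont_flat)
next
  case (Suc n)
  have "((\<lambda>x. flat m (f x)) has_derivative
     (\<lambda>v. (\<Sum>k\<in>UNIV. v $ k * partial k f x) * (flat (m + 2) (f x) - real m * flat (Suc m) (f x)))) (at x)" for x
    using has_derivative_compose[OF has_derivative_C_k[OF Suc(2)]
      flat_has_derivative[of m "f x", unfolded has_field_derivative_def]] by (simp add: mult.commute)
  moreover have "C_k n (\<lambda>x. flat (m + 2) (f x) + (- real m) * flat (Suc m) (f x))"
    using Suc C_k_Suc_D by (intro C_k_add C_k_cmult) blast+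
  then have "C_k n (\<lambda>x. (\<Sum>j\<in>UNIV. axis k 1 $ j * partial j f x) * (flat (m + 2) (f x) - real m * flat (Suc m) (f x)))" for k
    using Suc(2) by (intro C_k_mult C_k_sum) (auto intro: C_k_const)
  ultimately show ?case by (rule C_k_SucI)
qed

lemma flat_bounds: "0 \<le> flat 0 t" "flat 0 t \<le> 1" "flat 0 t \<noteq> 0 \<longleftrightarrow> 0 < t"
  by (auto simp: flat_def)

text \<open>A product of one-dimensional edges built from \<open>flat 0\<close>. The parameter
  \<open>N\<close> only steepens the edges: the set where the function is positive is the open box
  for every \<open>N\<close>, so the indicator of the box is approximated from inside.\<close>

definition boxbump :: "R4 \<Rightarrow> R4 \<Rightarrow> nat \<Rightarrow> R4 \<Rightarrow> real" where
  "boxbump a b N x = (\<Prod>k\<in>UNIV. flat 0 (real (Suc N) * (x $ k - a $ k)) * flat 0 (real (Suc N) * (b $ k - x $ k)))"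

lemma boxbump_bounds: "0 \<le> boxbump a b N x" "boxbump a b N x \<le> 1"
  unfolding boxbump_def by (auto intro!: prod_nonneg prod_le_1 mult_nonneg_nonneg mult_le_one flat_bounds)

lemma boxbump_nonzero: "boxbump a b N x \<noteq> 0 \<longleftrightarrow> x \<in> box a b"
  by (auto simp: boxbump_def mem_box_cart flat_bounds zero_less_mult_iff)

lemma flat_scaled_tendsto: "(\<lambda>N. flat 0 (real (Suc N) * t)) \<longlonglongrightarrow> (if 0 < t then 1 else 0)"
proof (cases "0 < t")
  case True
  have "filterlim (\<lambda>N. real (Suc N) * t) at_top sequentially"
    using True by (intro filterlim_at_top_mult_tendsto_pos[OF tendsto_const] filterlim_compose[OF filterlim_real_sequentially] filterlim_Suc)
  then have "(\<lambda>N. exp (- inverse (real (Suc N) * t))) \<longlonglongrightarrow> exp (- 0)"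
    by (intro tendsto_intros tendsto_inverse_0_at_top)
  with True show ?thesis by (simp add: flat_def zero_less_mult_iff)
next
  case False
  then have "\<not> 0 < real (Suc N) * t" for N by (simp add: zero_less_mult_iff not_less)
  with False show ?thesis by (simp add: flat_def)
qed

lemma boxbump_tendsto: "(\<lambda>N. boxbump a b N x) \<longlonglongrightarrow> indicator (box a b) x"
proof -
  have "(\<lambda>N. boxbump a b N x) \<longlonglongrightarrow>
    (\<Prod>k\<in>UNIV. (if 0 < x $ k - a $ k then 1 else 0 :: real) * (if 0 < b $ k - x $ k then 1 else 0))"
    unfolding boxbump_def by (intro tendsto_prod tendsto_mult flat_scaled_tendsto)
  moreover have "(\<Prod>k\<in>UNIV. (if 0 < x $ k - a $ k then 1 else 0 :: real) * (if 0 < b $ k - x $ k then 1 else 0))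
      = indicator (box a b) x"
    by (auto simp: indicator_def mem_box_cart)
  ultimately show ?thesis by simp
qed

lemma boxbump_test: "boxbump a b N \<in> test_functions"
proof -
  have lin: "C_k n (\<lambda>x. real (Suc N) * (x $ k - a $ k))" "C_k n (\<lambda>x. real (Suc N) * (b $ k - x $ k))" for n k
    using C_k_cmult[OF C_k_add[OF C_k_coord C_k_const], of n "real (Suc N)" k "- a $ k"]
     C_k_cmult[OF C_k_add[OF C_k_const C_k_cmult[OF C_k_coord]], of n "real (Suc N)" "b $ k" "-1" k] by simp_all
  have "C_k n (boxbump a b N)" for n
    unfolding boxbump_def by (intro C_k_prod C_k_mult C_k_flat lin)
  moreover have "compact (closure {x. boxbump a b N x \<noteq> 0})"
    by (simp add: boxbump_nonzero bounded_box)
  ultimately show ?thesis by (simp add: test_functions_def)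
qed

lemma test_smooth: "\<phi> \<in> test_functions \<Longrightarrow> C_k n \<phi>"
  by (simp add: test_functions_def)

lemma test_mult: "\<phi> \<in> test_functions \<Longrightarrow> (\<And>n. C_k n f) \<Longrightarrow> (\<lambda>x. f x * \<phi> x) \<in> test_functions"
  unfolding test_functions_def
  by (auto intro!: C_k_mult elim!: bounded_subset)

lemma test_affine:
  assumes "\<phi> \<in> test_functions" "c \<noteq> 0"
  shows "(\<lambda>x. \<phi> (y + c *\<^sub>R x)) \<in> test_functions"
proof -
  obtain r where r: "\<And>x. \<phi> x \<noteq> 0 \<Longrightarrow> norm x \<le> r"
    using assms(1) by (auto simp: test_functions_def bounded_iff)
  have "norm x \<le> (r + norm y) / \<bar>c\<bar>" if "\<phi> (y + c *\<^sub>R x) \<noteq> 0" for x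
  proof -
    have "\<bar>c\<bar> * norm x = norm (y + c *\<^sub>R x - y)" by simp
    also have "\<dots> \<le> r + norm y" using r[OF that] norm_triangle_ineq4[of "y + c *\<^sub>R x" y] by linarith
    finally show ?thesis using assms(2) by (simp add: field_simps)
  qed
  then have "bounded {x. \<phi> (y + c *\<^sub>R x) \<noteq> 0}" by (auto simp: bounded_iff)
  with assms show ?thesis by (auto simp: test_functions_def intro!: C_k_affine)
qed

section \<open>Local integrability and weak gradients\<close>

lemma integral_translate:
  fixes f :: "'a::euclidean_space \<Rightarrow> 'b::{banach, second_countable_topology}"
  assumes [measurable]: "f \<in> borel_measurable borel"
  shows "(LBINT x. f (h + x)) = (LBINT x. f x)"
    and "integrable lborel (\<lambda>x. f (h + x)) \<longleftrightarrow> integrable lborel f"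
proof -
  show "(LBINT x. f (h + x)) = (LBINT x. f x)"
    by (subst (2) lborel_distr_plus[of h, symmetric]) (simp add: integral_distr)
  show "integrable lborel (\<lambda>x. f (h + x)) \<longleftrightarrow> integrable lborel f"
    by (subst (2) lborel_distr_plus[of h, symmetric]) (simp add: integrable_distr_eq)
qed

lemma integral_affine:
  fixes f :: "'a::euclidean_space \<Rightarrow> real"
  assumes [measurable]: "f \<in> borel_measurable borel" and c: "c \<noteq> 0"
  shows "(LBINT x. f x) = \<bar>c\<bar> ^ DIM('a) * (LBINT x. f (h + c *\<^sub>R x))"
  by (subst lborel_affine[OF c, of h]) (simp add: integral_density integral_distr)

section \<open>Local integrability and the fundamental lemma\<close>

abbreviation cube :: "real \<Rightarrow> R4 set" where
  "cube r \<equiv> cbox (- (\<chi> i. r)) (\<chi> i. r)"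

lemma mem_cube: "x \<in> cube r \<longleftrightarrow> (\<forall>i. \<bar>x $ i\<bar> \<le> r)"
  by (auto simp: mem_box_cart abs_le_iff minus_le_iff)

lemma bounded_subset_cube: "bounded S \<Longrightarrow> \<exists>r>0. S \<subseteq> cube r"
proof -
  assume "bounded S"
  then obtain r where "r > 0" "\<And>x. x \<in> S \<Longrightarrow> norm x \<le> r" by (auto simp: bounded_pos)
  then show ?thesis
    by (intro exI[of _ r]) (auto simp: mem_cube intro!: order_trans[OF component_le_norm_cart])
qed

lemma cube_mono: "r \<le> s \<Longrightarrow> cube r \<subseteq> cube s"
  by (auto simp: subset_iff mem_cube intro: order_trans)

lemma norm_le_cube: "norm x \<le> r \<Longrightarrow> x \<in> cube r"
  by (auto simp: mem_cube intro!: order_trans[OF component_le_norm_cart])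

text \<open>The common class of elements of \<open>D12\<close>, components of their weak gradients
  and continuous functions. Weak identities pair such functions with compactly supported ones, so
  the fundamental lemma and the translation estimates are proved once, for this class.\<close>

definition loc_int :: "(R4 \<Rightarrow> real) \<Rightarrow> bool" where
  "loc_int u \<longleftrightarrow> u \<in> borel_measurable borel \<and> (\<forall>r. integrable lborel (\<lambda>x. indicator (cube r) x * u x))"

lemma integrable_indicator_cube: "integrable lborel (indicator (cube r) :: R4 \<Rightarrow> real)"
  by (rule integrable_real_indicator) (auto simp: emeasure_lborel_cbox_eq)

text \<open>The constant 1 is integrable over cubes only. The form \<open>1 + f\<close> covers
  functions whose square or fourth power is integrable, in place of a Hoelder inequality on
  cubes.\<close>

lemma loc_int_bound:
  assumes "u \<in> borel_measurable borel" "integrable lborel f" "\<And>x. \<bar>u x\<bar> \<le> 1 + f x"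
  shows "loc_int u"
  unfolding loc_int_def
proof (intro conjI allI)
  fix r
  have [measurable]: "u \<in> borel_measurable borel" by fact
  show "integrable lborel (\<lambda>x. indicator (cube r) x * u x)"
  proof (rule Bochner_Integration.integrable_bound[of _ "\<lambda>x. indicator (cube r) x + \<bar>f x\<bar>"])
    show "AE x in lborel. norm (indicator (cube r) x * u x) \<le> norm (indicator (cube r) x + \<bar>f x\<bar>)"
      using assms(3) by (intro AE_I2) (auto simp: indicator_def intro: order_trans[OF assms(3)])
  qed (use assms(2) in \<open>auto intro!: integrable_indicator_cube\<close>)
qed (fact assms)

lemma loc_int_continuous: "continuous_on UNIV u \<Longrightarrow> loc_int u"
  unfolding loc_int_def
proof (intro conjI allI)
  assume c: "continuous_on UNIV u"
  then show "u \<in> borel_measurable borel" by (rule borel_measurable_continuous_onI)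
  fix r
  show "integrable lborel (\<lambda>x. indicator (cube r) x * u x)"
    using borel_integrable_compact[OF compact_cbox continuous_on_subset[OF c subset_UNIV], of "- (\<chi> i. r)" "\<chi> i. r"]
    by (simp add: indicator_def if_distrib if_distribR cong: if_cong)
qed

lemma integrable_loc_int_mult:
  assumes u: "loc_int u" and f: "f \<in> borel_measurable borel" "\<And>x. \<bar>f x\<bar> \<le> M" "bounded {x. f x \<noteq> 0}"
  shows "integrable lborel (\<lambda>x. u x * f x)"
proof -
  obtain r where r: "{x. f x \<noteq> 0} \<subseteq> cube r" using bounded_subset_cube[OF f(3)] by blast
  have [measurable]: "u \<in> borel_measurable borel" "f \<in> borel_measurable borel" using u f by (auto simp: loc_int_def)
  show ?thesis
  proof (rule Bochner_Integration.integrable_bound[of _ "\<lambda>x. M * (indicator (cube r) x * u x)"])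
    show "AE x in lborel. norm (u x * f x) \<le> norm (M * (indicator (cube r) x * u x))"
    proof (intro AE_I2)
      fix x
      have "\<bar>u x\<bar> * \<bar>f x\<bar> \<le> \<bar>u x\<bar> * \<bar>M\<bar>" using f(2)[of x] by (intro mult_left_mono) auto
      then show "norm (u x * f x) \<le> norm (M * (indicator (cube r) x * u x))"
        using r by (cases "f x = 0") (auto simp: abs_mult mult.commute)
    qed
  qed (use u in \<open>auto simp: loc_int_def\<close>)
qed

lemma continuous_bounded_support_bounded:
  fixes f :: "R4 \<Rightarrow> real"
  assumes "continuous_on UNIV f" "bounded {x. f x \<noteq> 0}"
  obtains M where "M > 0" "\<And>x. \<bar>f x\<bar> \<le> M"
proof -
  obtain r where r: "{x. f x \<noteq> 0} \<subseteq> cube r" using bounded_subset_cube[OF assms(2)] by blast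
  have "bounded (f ` cube r)"
    by (intro compact_imp_bounded compact_continuous_image continuous_on_subset[OF assms(1)] compact_cbox subset_UNIV)
  then obtain M where M: "M > 0" "\<And>x. x \<in> cube r \<Longrightarrow> \<bar>f x\<bar> \<le> M" by (auto simp: bounded_pos)
  have "\<bar>f x\<bar> \<le> M" for x using M r by (cases "f x = 0") auto
  with M(1) show ?thesis using that by blast
qed

lemma integrable_loc_int_continuous:
  assumes "loc_int u" "continuous_on UNIV f" "bounded {x. f x \<noteq> 0}"
  shows "integrable lborel (\<lambda>x. u x * f x)"
  using continuous_bounded_support_bounded[OF assms(2,3)] integrable_loc_int_mult[OF assms(1) _ _ assms(3)]
    borel_measurable_continuous_onI[OF assms(2)] by metis

lemma test_continuous: "\<phi> \<in> test_functions \<Longrightarrow> continuous_on UNIV \<phi>"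
  using test_smooth C_k_imp_continuous by blast

lemma test_bounded: "\<phi> \<in> test_functions \<Longrightarrow> bounded {x. \<phi> x \<noteq> 0}"
  by (simp add: test_functions_def)

lemma test_measurable: "\<phi> \<in> test_functions \<Longrightarrow> \<phi> \<in> borel_measurable borel"
  using test_continuous borel_measurable_continuous_onI by blast

lemma integrable_loc_int_test: "loc_int u \<Longrightarrow> \<phi> \<in> test_functions \<Longrightarrow> integrable lborel (\<lambda>x. u x * \<phi> x)"
  using integrable_loc_int_continuous test_continuous test_bounded by blast

lemma partial_bounded_support:
  assumes "bounded {x. f x \<noteq> 0}"
  shows "bounded {x. partial k f x \<noteq> 0}"
proof -
  have "partial k f x = 0" if "x \<notin> closure {x. f x \<noteq> 0}" for x
  proof -
    have "((\<lambda>_. 0) has_derivative (\<lambda>_. 0)) (at x)" by simp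
    then have "(f has_derivative (\<lambda>_. 0)) (at x)"
      by (rule has_derivative_transform_within_open[where s="- closure {x. f x \<noteq> 0}"])
         (use that closure_subset[of "{x. f x \<noteq> 0}"] in auto)
    from partial_eq[OF this] show ?thesis .
  qed
  then show ?thesis by (intro bounded_subset[OF bounded_closure[OF assms]]) auto
qed

lemma test_partial:
  assumes "\<phi> \<in> test_functions" shows "partial k \<phi> \<in> test_functions"
proof -
  have "C_k n (partial k \<phi>)" for n using test_smooth[OF assms, of "Suc n"] by simp
  with partial_bounded_support[OF test_bounded[OF assms]] show ?thesis by (simp add: test_functions_def)
qed

text \<open>Bumps converging to the indicator of a box give integral 0 over every open box. Boxes
  form an intersection-stable generator of the Borel sets, so an induction over disjoint unions and
  complements gives integral 0 over all Borel sets, for \<open>u\<close> cut off to a bounded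
  box.\<close>

lemma fundamental_lemma:
  assumes u: "loc_int u" and orth: "\<And>\<phi>. \<phi> \<in> test_functions \<Longrightarrow> (LBINT x. u x * \<phi> x) = 0"
  shows "AE x in lborel. u x = 0"
proof -
  have [measurable]: "u \<in> borel_measurable borel" using u by (simp add: loc_int_def)
  have box: "integrable lborel (\<lambda>x. u x * indicator (box a b) x)"
    "(LBINT x. u x * indicator (box a b) x) = 0" for a b
  proof -
    have le: "\<bar>indicator (box a b) x :: real\<bar> \<le> 1" for x by (simp add: indicator_def)
    show *: "integrable lborel (\<lambda>x. u x * indicator (box a b) x)"
      by (rule integrable_loc_int_mult[OF u _ le])
         (auto simp: indicator_def intro!: bounded_subset[OF bounded_box[of a b]])
    have [measurable]: "boxbump a b N \<in> borel_measurable borel" for N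
      using boxbump_test test_measurable by blast
    have "(\<lambda>N. LBINT x. u x * boxbump a b N x) \<longlonglongrightarrow> (LBINT x. u x * indicator (box a b) x)"
    proof (rule integral_dominated_convergence[where w="\<lambda>x. \<bar>u x * indicator (box a b) x\<bar>"])
      show "AE x in lborel. norm (u x * boxbump a b N x) \<le> \<bar>u x * indicator (box a b) x\<bar>" for N
      proof (intro AE_I2)
        fix x
        show "norm (u x * boxbump a b N x) \<le> \<bar>u x * indicator (box a b) x\<bar>"
          using boxbump_bounds[of a b N x] boxbump_nonzero[of a b N x]
          by (cases "x \<in> box a b") (auto simp: abs_mult mult_left_le)
      qed
    qed (use * in \<open>auto intro!: tendsto_mult tendsto_const boxbump_tendsto AE_I2\<close>)
    moreover have "(LBINT x. u x * boxbump a b N x) = 0" for N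
      using orth boxbump_test by blast
    ultimately show "(LBINT x. u x * indicator (box a b) x) = 0"
      using LIMSEQ_unique[OF _ tendsto_const] by fastforce
  qed
  \<comment> \<open>Restriction to a bounded box makes \<open>u\<close> integrable over the whole
    space, as countable additivity and \<open>density_zero\<close> require. The boxes with natural
    \<open>r\<close> exhaust the space.\<close>
  have "AE x in lborel. x \<in> box (- (\<chi> i. r)) (\<chi> i. r) \<longrightarrow> u x = 0" for r :: real
  proof -
    let ?B = "box (- (\<chi> i. r)) (\<chi> i. r) :: R4 set"
    let ?v = "\<lambda>x. u x * indicator ?B x"
    have v: "integrable lborel ?v" by (rule box)
    have iv: "integrable lborel (\<lambda>x. indicator A x * ?v x)" if "A \<in> sets borel" for A
      using that by (intro Bochner_Integration.integrable_bound[OF v]) (auto simp: indicator_def)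
    have "set_lebesgue_integral lborel A ?v = 0" if "A \<in> sets lborel" for A
    proof -
      have "Int_stable (range (\<lambda>(a, b). box a b :: R4 set))"
        by (auto simp: Int_stable_def box_Int_box)
      moreover have "range (\<lambda>(a, b). box a b :: R4 set) \<subseteq> Pow UNIV" by auto
      moreover have "A \<in> sigma_sets UNIV (range (\<lambda>(a, b). box a b))"
        using that by (simp add: borel_eq_box)
      ultimately show ?thesis
      proof (induction rule: sigma_sets_induct_disjoint)
        case (basic A)
        then obtain a b where A: "A = box a b" by auto
        obtain a' b' where ab: "box a b \<inter> ?B = box a' b'"
          using box_Int_box by blast
        have "indicator A x *\<^sub>R ?v x = u x * indicator (box a' b') x" for x
          unfolding A ab[symmetric] by (simp add: indicator_def)
        then show ?case using box(2)[of a' b'] unfolding set_lebesgue_integral_def by presburger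
      next
        case empty
        then show ?case by (simp add: set_lebesgue_integral_def)
      next
        case (compl A)
        then have "A \<in> sets borel" by (simp add: borel_eq_box)
        have "(LBINT x. indicator (UNIV - A) x * ?v x) = (LBINT x. ?v x - indicator A x * ?v x)"
          by (intro Bochner_Integration.integral_cong) (auto simp: indicator_def)
        also have "\<dots> = 0"
          using compl(2) box(2) iv[OF \<open>A \<in> sets borel\<close>] v
          by (subst Bochner_Integration.integral_diff) (auto simp: set_lebesgue_integral_def)
        finally show ?case by (simp add: set_lebesgue_integral_def)
      next
        case (union A)
        then have A: "A i \<in> sets borel" for i by (auto simp: borel_eq_box)
        have "set_lebesgue_integral lborel (\<Union>i. A i) ?v = (\<Sum>i. set_lebesgue_integral lborel (A i) ?v)"
          using union(1) A iv[of "\<Union>i. A i"]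
          by (intro lebesgue_integral_countable_add) (auto simp: disjoint_family_on_def set_integrable_def)
        then show ?case using union by simp
      qed
    qed
    from sigma_finite_measure.density_zero[OF sigma_finite_lborel v this] show ?thesis
      by (auto elim!: eventually_mono simp: indicator_def)
  qed
  then have "AE x in lborel. \<forall>n. x \<in> box (- (\<chi> i. real n)) (\<chi> i. real n) \<longrightarrow> u x = 0"
    by (subst AE_all_countable) blast
  then show ?thesis
  proof (eventually_elim)
    case (elim x)
    obtain n where "norm x < real n" using reals_Archimedean2 by blast
    then have "\<bar>x $ i\<bar> < real n" for i using component_le_norm_cart[of x i] by linarith
    then have "x \<in> box (- (\<chi> i. real n)) (\<chi> i. real n)"
      by (auto simp: mem_box_cart abs_less_iff minus_less_iff)
    with elim show ?case by blast
  qed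
qed

lemma integrable_cmult_abs: "integrable M f \<Longrightarrow> integrable M (\<lambda>x. c * \<bar>f x\<bar> :: real)"
  by simp

section \<open>Differentiation under the integral and integration by parts\<close>

lemma partial_line:
  assumes "f differentiable (at (x + t *\<^sub>R axis k 1))"
  shows "((\<lambda>t. f (x + t *\<^sub>R axis k 1)) has_real_derivative partial k f (x + t *\<^sub>R axis k 1)) (at t)"
proof -
  let ?z = "x + t *\<^sub>R axis k 1"
  obtain D where D: "(f has_derivative D) (at ?z)" using assms by (auto simp: differentiable_def)
  have "((\<lambda>t. f (x + t *\<^sub>R axis k 1)) has_derivative (\<lambda>s. D (s *\<^sub>R axis k 1))) (at t)"
    by (rule has_derivative_compose[where g=f and f="\<lambda>t. x + t *\<^sub>R axis k 1" and f'="\<lambda>s. s *\<^sub>R axis k 1"])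
       (auto intro!: derivative_eq_intros D)
  moreover have "D (s *\<^sub>R axis k 1) = partial k f ?z * s" for s
    using has_derivative_bounded_linear[OF D] partial_eq[OF D] by (simp add: linear_simps mult.commute)
  ultimately show ?thesis by (simp add: has_field_derivative_def)
qed

text \<open>The shift sits on the smooth factor, so \<open>u\<close> may be merely locally
  integrable: the difference quotients are bounded by a constant on one fixed cube, and dominated
  convergence applies along every null sequence.\<close>

lemma DERIV_integral_translate:
  assumes u: "loc_int u" and f: "C_k (Suc 0) f" "bounded {x. f x \<noteq> 0}"
  shows "((\<lambda>t. LBINT x. u x * f (x + t *\<^sub>R axis k 1)) has_real_derivative
     (LBINT x. u x * partial k f (x + t *\<^sub>R axis k 1))) (at t)"
proof -
  let ?e = "axis k 1 :: R4"
  have um[measurable]: "u \<in> borel_measurable borel" using u by (simp add: loc_int_def)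
  have fc: "continuous_on UNIV f" and pc: "continuous_on UNIV (partial k f)"
    using C_k_imp_continuous[OF f(1)] f(1) by auto
  have fm[measurable]: "f \<in> borel_measurable borel" "partial k f \<in> borel_measurable borel"
    using fc pc borel_measurable_continuous_onI by auto
  obtain M where M: "M > 0" "\<And>x. \<bar>partial k f x\<bar> \<le> M"
    using continuous_bounded_support_bounded[OF pc partial_bounded_support[OF f(2)]] by metis
  obtain r where r: "r > 0" "{x. f x \<noteq> 0} \<subseteq> cube r" using bounded_subset_cube[OF f(2)] by blast
  have tr: "continuous_on UNIV (\<lambda>x. f (x + s *\<^sub>R ?e))" "bounded {x. f (x + s *\<^sub>R ?e) \<noteq> 0}" for s
  proof -
    show "continuous_on UNIV (\<lambda>x. f (x + s *\<^sub>R ?e))"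
      by (rule continuous_on_compose2[OF fc]) (auto intro!: continuous_intros)
    have "{x. f (x + s *\<^sub>R ?e) \<noteq> 0} = (\<lambda>z. - (s *\<^sub>R ?e) + z) ` {x. f x \<noteq> 0}"
      by (auto intro!: image_eqI[where x="_ + s *\<^sub>R ?e"])
    then show "bounded {x. f (x + s *\<^sub>R ?e) \<noteq> 0}" using bounded_translation[OF f(2)] by metis
  qed
  have int: "integrable lborel (\<lambda>x. u x * f (x + s *\<^sub>R ?e))" for s
    by (rule integrable_loc_int_continuous[OF u tr])
  \<comment> \<open>Enlarging the cube by \<open>\<bar>t\<bar> + 1\<close> covers the supports of
    all shifts by \<open>t + h\<close> with \<open>\<bar>h\<bar> \<le> 1\<close>; inside it the mean
    value theorem gives the factor \<open>M\<close>.\<close>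
  have quot: "\<bar>f (x + (t + h) *\<^sub>R ?e) - f (x + t *\<^sub>R ?e)\<bar> \<le> M * \<bar>h\<bar> * indicator (cube (r + \<bar>t\<bar> + 1)) x"
    if "\<bar>h\<bar> \<le> 1" for h x
  proof (cases "x \<in> cube (r + \<bar>t\<bar> + 1)")
    case True
    have "norm (f (x + (t + h) *\<^sub>R ?e) - f (x + t *\<^sub>R ?e)) \<le> M * norm ((t + h) - t)"
      by (rule field_differentiable_bound[of UNIV "\<lambda>t. f (x + t *\<^sub>R ?e)" "\<lambda>t. partial k f (x + t *\<^sub>R ?e)"])
         (use f(1) M in \<open>auto intro!: has_field_derivative_at_within partial_line\<close>)
    with True show ?thesis by simp
  next
    case False
    have "x + s *\<^sub>R ?e \<notin> cube r" if "\<bar>s\<bar> \<le> \<bar>t\<bar> + 1" for s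
    proof
      assume "x + s *\<^sub>R ?e \<in> cube r"
      then have "\<bar>(x + s *\<^sub>R ?e) $ i\<bar> \<le> r" for i by (simp add: mem_cube)
      moreover have "\<bar>(s *\<^sub>R ?e) $ i\<bar> \<le> \<bar>t\<bar> + 1" for i using that by (auto simp: axis_def)
      ultimately have "\<bar>x $ i\<bar> \<le> r + \<bar>t\<bar> + 1" for i
        using abs_triangle_ineq4[of "(x + s *\<^sub>R ?e) $ i" "(s *\<^sub>R ?e) $ i"]
        by (smt (verit) vector_add_component)
      with False show False by (simp add: mem_cube)
    qed
    moreover have "\<bar>t + h\<bar> \<le> \<bar>t\<bar> + 1" using that by linarith
    ultimately have "f (x + (t + h) *\<^sub>R ?e) = 0" "f (x + t *\<^sub>R ?e) = 0"
      using r(2) by auto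
    then show ?thesis using M(1) by simp
  qed
  have lim: "(\<lambda>n. (LBINT x. u x * f (x + (t + h n) *\<^sub>R ?e)) / h n - (LBINT x. u x * f (x + t *\<^sub>R ?e)) / h n)
      \<longlonglongrightarrow> (LBINT x. u x * partial k f (x + t *\<^sub>R ?e))"
    if h: "\<And>n. h n \<noteq> 0" "\<And>n. \<bar>h n\<bar> \<le> 1" "h \<longlonglongrightarrow> 0" for h :: "nat \<Rightarrow> real"
  proof -
    have "(\<lambda>n. LBINT x. u x * ((f (x + (t + h n) *\<^sub>R ?e) - f (x + t *\<^sub>R ?e)) / h n))
      \<longlonglongrightarrow> (LBINT x. u x * partial k f (x + t *\<^sub>R ?e))"
    proof (rule integral_dominated_convergence[where w="\<lambda>x. M * \<bar>indicator (cube (r + \<bar>t\<bar> + 1)) x * u x\<bar>"])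
      show "integrable lborel (\<lambda>x. M * \<bar>indicator (cube (r + \<bar>t\<bar> + 1)) x * u x\<bar>)"
        using u by (intro integrable_cmult_abs) (simp add: loc_int_def)
      show "AE x in lborel. (\<lambda>n. u x * ((f (x + (t + h n) *\<^sub>R ?e) - f (x + t *\<^sub>R ?e)) / h n))
         \<longlonglongrightarrow> u x * partial k f (x + t *\<^sub>R ?e)"
      proof (intro AE_I2 tendsto_mult tendsto_const)
        fix x
        have "((\<lambda>h. (f (x + (t + h) *\<^sub>R ?e) - f (x + t *\<^sub>R ?e)) / h) \<longlongrightarrow> partial k f (x + t *\<^sub>R ?e)) (at 0)"
          using partial_line[of f x t k] f(1) by (simp add: DERIV_def)
        then show "(\<lambda>n. (f (x + (t + h n) *\<^sub>R ?e) - f (x + t *\<^sub>R ?e)) / h n) \<longlonglongrightarrow> partial k f (x + t *\<^sub>R ?e)"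
          by (rule filterlim_compose) (use h in \<open>simp add: filterlim_at\<close>)
      qed
      show "AE x in lborel. norm (u x * ((f (x + (t + h n) *\<^sub>R ?e) - f (x + t *\<^sub>R ?e)) / h n))
         \<le> M * \<bar>indicator (cube (r + \<bar>t\<bar> + 1)) x * u x\<bar>" for n
      proof (intro AE_I2)
        fix x
        have "\<bar>(f (x + (t + h n) *\<^sub>R ?e) - f (x + t *\<^sub>R ?e)) / h n\<bar> \<le> M * indicator (cube (r + \<bar>t\<bar> + 1)) x"
          using quot[OF h(2)[of n], of x] h(1)[of n] by (simp add: field_simps)
        then have "\<bar>u x\<bar> * \<bar>(f (x + (t + h n) *\<^sub>R ?e) - f (x + t *\<^sub>R ?e)) / h n\<bar> \<le> \<bar>u x\<bar> * (M * indicator (cube (r + \<bar>t\<bar> + 1)) x)"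
          by (intro mult_left_mono) auto
        then show "norm (u x * ((f (x + (t + h n) *\<^sub>R ?e) - f (x + t *\<^sub>R ?e)) / h n))
         \<le> M * \<bar>indicator (cube (r + \<bar>t\<bar> + 1)) x * u x\<bar>"
          by (simp add: abs_mult mult_ac)
      qed
    qed measurable
    moreover have "(LBINT x. u x * ((f (x + (t + h n) *\<^sub>R ?e) - f (x + t *\<^sub>R ?e)) / h n)) =
      (LBINT x. u x * f (x + (t + h n) *\<^sub>R ?e)) / h n - (LBINT x. u x * f (x + t *\<^sub>R ?e)) / h n" for n
    proof -
      have "u x * ((f (x + (t + h n) *\<^sub>R ?e) - f (x + t *\<^sub>R ?e)) / h n) =
          u x * f (x + (t + h n) *\<^sub>R ?e) / h n - u x * f (x + t *\<^sub>R ?e) / h n" for x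
        by (simp add: algebra_simps diff_divide_distrib)
      then show ?thesis
        by (simp only: integral_divide_zero Bochner_Integration.integral_diff[OF integrable_divide_zero integrable_divide_zero] int)
    qed
    ultimately show ?thesis by simp
  qed
  show ?thesis unfolding DERIV_def tendsto_at_iff_sequentially
  proof (intro allI impI)
    fix h :: "nat \<Rightarrow> real" assume h: "\<forall>i. h i \<in> UNIV - {0}" "h \<longlonglongrightarrow> 0"
    have "\<forall>\<^sub>F n in sequentially. dist (h n) 0 < 1" by (rule tendstoD[OF h(2)]) simp
    then obtain N where N: "\<And>n. n \<ge> N \<Longrightarrow> \<bar>h n\<bar> \<le> 1"
      by (auto simp: eventually_sequentially intro: less_imp_le)
    have "(\<lambda>n. h (n + N)) \<longlonglongrightarrow> 0" by (rule LIMSEQ_ignore_initial_segment[OF h(2)])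
    then have "(\<lambda>n. (LBINT x. u x * f (x + (t + h (n + N)) *\<^sub>R ?e)) / h (n + N) -
        (LBINT x. u x * f (x + t *\<^sub>R ?e)) / h (n + N)) \<longlonglongrightarrow> (LBINT x. u x * partial k f (x + t *\<^sub>R ?e))"
      using h(1) N by (intro lim) auto
    then show "((\<lambda>h. ((LBINT x. u x * f (x + (t + h) *\<^sub>R ?e)) - (LBINT x. u x * f (x + t *\<^sub>R ?e))) / h) \<circ> h)
       \<longlonglongrightarrow> (LBINT x. u x * partial k f (x + t *\<^sub>R ?e))"
      unfolding o_def diff_divide_distrib by (rule LIMSEQ_offset)
  qed
qed

text \<open>By translation invariance the integral of the shifted function is constant in the shift.
  Its derivative at 0, given by the preceding rule with \<open>u = 1\<close>, is the left-hand
  side.\<close>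

lemma integral_partial_eq_0:
  assumes f: "C_k (Suc 0) f" "bounded {x. f x \<noteq> 0}"
  shows "(LBINT x. partial k f x) = 0"
proof -
  have [measurable]: "f \<in> borel_measurable borel"
    using C_k_imp_continuous[OF f(1)] by (rule borel_measurable_continuous_onI)
  have "(LBINT x. 1 * f (x + t *\<^sub>R axis k 1)) = (LBINT x. f x)" for t
    using integral_translate(1)[of f "t *\<^sub>R axis k 1"] by (simp add: add.commute)
  then have "((\<lambda>_. LBINT x. f x) has_real_derivative (LBINT x. partial k f x)) (at 0)"
    using DERIV_integral_translate[OF _ f, of "\<lambda>_. 1" k 0] by (simp add: loc_int_continuous)
  from DERIV_unique[OF this DERIV_const] show ?thesis .
qed

lemma integration_by_parts:
  assumes f: "C_k (Suc 0) f" and \<phi>: "\<phi> \<in> test_functions"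
  shows "(LBINT x. f x * partial k \<phi> x) = - (LBINT x. partial k f x * \<phi> x)"
proof -
  have "C_k (Suc 0) \<phi>" using \<phi> by (rule test_smooth)
  have 1: "integrable lborel (\<lambda>x. f x * partial k \<phi> x)"
    using C_k_imp_continuous[OF f] by (intro integrable_loc_int_test loc_int_continuous test_partial \<phi>)
  have 2: "integrable lborel (\<lambda>x. partial k f x * \<phi> x)"
    using C_k_imp_continuous[of 0 "partial k f"] f by (intro integrable_loc_int_test loc_int_continuous \<phi>) auto
  have "bounded {x. f x * \<phi> x \<noteq> 0}" using test_bounded[OF \<phi>] by (rule bounded_subset) auto
  then have "(LBINT x. partial k (\<lambda>x. f x * \<phi> x) x) = 0"
    by (intro integral_partial_eq_0 C_k_mult f test_smooth \<phi>)
  moreover have "partial k (\<lambda>x. f x * \<phi> x) x = f x * partial k \<phi> x + partial k f x * \<phi> x" for x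
    using partial_eq[OF has_derivative_mult[OF has_derivative_C_k[OF f] has_derivative_C_k[OF \<open>C_k (Suc 0) \<phi>\<close>]], of k x]
    by (simp add: axis_def if_distrib if_distribR cong: if_cong)
  ultimately show ?thesis using 1 2 by simp
qed

lemma AE_lborel_translate:
  fixes h :: "'a::euclidean_space"
  assumes "AE x in lborel. P x"
  shows "AE x in lborel. P (h + x)"
proof -
  have "AE x in distr lborel borel ((+) h). P x" using assms by (subst lborel_distr_plus)
  then obtain N where N: "{x. \<not> P x} \<subseteq> N" "N \<in> sets borel" "emeasure (distr lborel borel ((+) h)) N = 0"
    by (auto simp: eventually_ae_filter null_sets_def)
  then have "emeasure lborel ((+) h -` N) = 0" by (simp add: emeasure_distr)
  moreover have "(+) h -` N \<in> sets borel" using measurable_sets_borel[of "(+) h" borel N] N(2) by simp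
  ultimately show ?thesis using N(1) by (intro AE_I[of _ _ "(+) h -` N"]) auto
qed

lemma sq_le_one_add: "\<bar>a\<bar> \<le> 1 + (a::real)\<^sup>2"
proof -
  have "0 \<le> (\<bar>a\<bar> - 1)\<^sup>2" by simp
  then have "2 * \<bar>a\<bar> \<le> 1 + a\<^sup>2" by (simp add: power2_diff)
  then show ?thesis by linarith
qed

lemma fourth_le_one_add: "\<bar>a\<bar> \<le> 1 + (a::real) ^ 4"
proof -
  have "a\<^sup>2 \<le> a ^ 4 \<or> \<bar>a\<bar> \<le> 1"
  proof (cases "\<bar>a\<bar> \<le> 1")
    case False
    then have "\<bar>a\<bar> ^ 2 \<le> \<bar>a\<bar> ^ 4" by (intro power_increasing) auto
    then show ?thesis by simp
  qed simp
  moreover have "0 \<le> a ^ 4" by simp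
  ultimately show ?thesis using sq_le_one_add[of a] by linarith
qed

section \<open>The space D12 and the Dirichlet form\<close>

lemma D12_loc_int: "u \<in> D12 \<Longrightarrow> loc_int u"
  by (rule loc_int_bound[OF _ _ fourth_le_one_add]) (auto simp: D12_def)

lemma D12_measurable: "u \<in> D12 \<Longrightarrow> u \<in> borel_measurable borel"
  by (simp add: D12_def)

lemma D12_integrable: "u \<in> D12 \<Longrightarrow> integrable lborel (\<lambda>x. u x ^ 4)"
  by (simp add: D12_def)

lemma measurable_vec_nth: "g \<in> borel_measurable borel \<Longrightarrow> (\<lambda>x. (g x :: real ^ 'n) $ k) \<in> borel_measurable borel"
  by (rule measurable_compose[OF _ borel_measurable_continuous_onI]) (auto intro: continuous_intros)

lemma weak_gradient_loc_int:
  assumes "is_L2_weak_gradient u g" shows "loc_int (\<lambda>x. g x $ k)"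
proof (rule loc_int_bound)
  show "(\<lambda>x. g x $ k) \<in> borel_measurable borel"
    using assms by (auto simp: is_L2_weak_gradient_def intro: measurable_vec_nth)
  show "integrable lborel (\<lambda>x. (norm (g x))\<^sup>2)" using assms by (simp add: is_L2_weak_gradient_def)
  show "\<bar>g x $ k\<bar> \<le> 1 + (norm (g x))\<^sup>2" for x
    using component_le_norm_cart[of "g x" k] sq_le_one_add[of "norm (g x)"] by simp
qed

lemma weak_gradientD:
  "is_L2_weak_gradient u g \<Longrightarrow> \<phi> \<in> test_functions \<Longrightarrow>
    (LBINT x. u x * partial k \<phi> x) = - (LBINT x. g x $ k * \<phi> x)"
  by (simp add: is_L2_weak_gradient_def)

lemma weak_gradient_unique:
  assumes g: "is_L2_weak_gradient u g" and h: "is_L2_weak_gradient u h"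
  shows "AE x in lborel. g x = h x"
proof -
  have "AE x in lborel. g x $ k - h x $ k = 0" for k
  proof (rule fundamental_lemma)
    note li = weak_gradient_loc_int[OF g, of k] weak_gradient_loc_int[OF h, of k]
    then show "loc_int (\<lambda>x. g x $ k - h x $ k)"
      by (auto simp: loc_int_def right_diff_distrib)
    fix \<phi> assume \<phi>: "\<phi> \<in> test_functions"
    have "(LBINT x. g x $ k * \<phi> x) = (LBINT x. h x $ k * \<phi> x)"
      using weak_gradientD[OF g \<phi>, of k] weak_gradientD[OF h \<phi>, of k] by linarith
    then show "(LBINT x. (g x $ k - h x $ k) * \<phi> x) = 0"
      using integrable_loc_int_test[OF li(1) \<phi>] integrable_loc_int_test[OF li(2) \<phi>]
      by (simp add: left_diff_distrib)
  qed
  then have "AE x in lborel. \<forall>k\<in>UNIV. g x $ k - h x $ k = 0"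
    by (intro AE_finite_allI) auto
  then show ?thesis by (simp add: vec_eq_iff)
qed

lemma weak_grad: "u \<in> D12 \<Longrightarrow> is_L2_weak_gradient u (weak_grad u)"
  unfolding weak_grad_def D12_def using someI_ex[of "is_L2_weak_gradient u"] by blast

text \<open>This makes the choice by \<open>SOME\<close> harmless: under an integral sign
  \<open>weak_grad u\<close> may be replaced by any explicit weak gradient, as is done for sums,
  multiples, translates and absolute values.\<close>

lemma weak_grad_AE: "is_L2_weak_gradient u g \<Longrightarrow> AE x in lborel. weak_grad u x = g x"
  using weak_gradient_unique[of u "weak_grad u" g] someI_ex[of "is_L2_weak_gradient u"] unfolding weak_grad_def by blast

lemma weak_grad_measurable: "u \<in> D12 \<Longrightarrow> weak_grad u \<in> borel_measurable borel"
  using weak_grad by (auto simp: is_L2_weak_gradient_def)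

definition dirichlet :: "(R4 \<Rightarrow> real) \<Rightarrow> real" where
  "dirichlet u = (LBINT x. (norm (weak_grad u x))\<^sup>2)"

definition dform :: "(R4 \<Rightarrow> real) \<Rightarrow> (R4 \<Rightarrow> real) \<Rightarrow> real" where
  "dform u v = (LBINT x. weak_grad u x \<bullet> weak_grad v x)"

lemma dirichlet_nonneg: "0 \<le> dirichlet u"
  by (simp add: dirichlet_def)

lemma dirichlet_integrable: "u \<in> D12 \<Longrightarrow> integrable lborel (\<lambda>x. (norm (weak_grad u x))\<^sup>2)"
  using weak_grad by (auto simp: is_L2_weak_gradient_def)

lemma dirichlet_eq:
  assumes "is_L2_weak_gradient u g" shows "dirichlet u = (LBINT x. (norm (g x))\<^sup>2)"
proof -
  have "is_L2_weak_gradient u (weak_grad u)" unfolding weak_grad_def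
    using assms by (intro someI_ex[of "is_L2_weak_gradient u"]) blast
  then show ?thesis unfolding dirichlet_def
    using weak_grad_AE[OF assms] assms
    by (intro integral_cong_AE) (auto simp: is_L2_weak_gradient_def)
qed

lemma norm_add_sq_le: "(norm (x + y :: 'a::real_normed_vector))\<^sup>2 \<le> 2 * (norm x)\<^sup>2 + 2 * (norm y)\<^sup>2"
proof -
  have "(norm (x + y))\<^sup>2 \<le> (norm x + norm y)\<^sup>2" by (simp add: norm_triangle_ineq power_mono)
  also have "\<dots> \<le> 2 * (norm x)\<^sup>2 + 2 * (norm y)\<^sup>2" using sum_squares_bound[of "norm x" "norm y"]
    by (simp add: power2_sum)
  finally show ?thesis .
qed

lemma fourth_add_le: "(x + y :: real) ^ 4 \<le> 8 * x ^ 4 + 8 * y ^ 4"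
proof -
  have "(x + y) ^ 4 = ((x + y)\<^sup>2)\<^sup>2" by simp
  also have "\<dots> \<le> (2 * x\<^sup>2 + 2 * y\<^sup>2)\<^sup>2"
    using norm_add_sq_le[of x y] by (intro power_mono) auto
  also have "\<dots> \<le> 2 * (2 * x\<^sup>2)\<^sup>2 + 2 * (2 * y\<^sup>2)\<^sup>2"
    using norm_add_sq_le[of "2 * x\<^sup>2" "2 * y\<^sup>2"] by simp
  also have "\<dots> = 8 * x ^ 4 + 8 * y ^ 4" by (simp add: power_mult_distrib)
  finally show ?thesis .
qed

lemma weak_gradient_add:
  assumes u: "loc_int u" "is_L2_weak_gradient u g" and v: "loc_int v" "is_L2_weak_gradient v h"
  shows "is_L2_weak_gradient (\<lambda>x. u x + v x) (\<lambda>x. g x + h x)"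
  unfolding is_L2_weak_gradient_def
proof (intro conjI ballI allI)
  have [measurable]: "g \<in> borel_measurable borel" "h \<in> borel_measurable borel"
    using u v by (auto simp: is_L2_weak_gradient_def)
  show "(\<lambda>x. g x + h x) \<in> borel_measurable lborel" by simp
  show "integrable lborel (\<lambda>x. (norm (g x + h x))\<^sup>2)"
  proof (rule Bochner_Integration.integrable_bound[of _ "\<lambda>x. 2 * (norm (g x))\<^sup>2 + 2 * (norm (h x))\<^sup>2"])
    show "integrable lborel (\<lambda>x. 2 * (norm (g x))\<^sup>2 + 2 * (norm (h x))\<^sup>2)"
      using u v by (auto simp: is_L2_weak_gradient_def)
  qed (auto simp: norm_add_sq_le)
  fix \<phi> k assume \<phi>: "\<phi> \<in> test_functions"
  note int = integrable_loc_int_test[OF u(1) test_partial[OF \<phi>]] integrable_loc_int_test[OF v(1) test_partial[OF \<phi>]]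
   integrable_loc_int_test[OF weak_gradient_loc_int[OF u(2)] \<phi>] integrable_loc_int_test[OF weak_gradient_loc_int[OF v(2)] \<phi>]
  show "(LBINT x. (u x + v x) * partial k \<phi> x) = - (LBINT x. (g x + h x) $ k * \<phi> x)"
    using int u(2) v(2) \<phi> by (simp add: distrib_right is_L2_weak_gradient_def)
qed

lemma weak_gradient_cmult:
  assumes "is_L2_weak_gradient u g"
  shows "is_L2_weak_gradient (\<lambda>x. c * u x) (\<lambda>x. c *\<^sub>R g x)"
  using assms by (auto simp: is_L2_weak_gradient_def power_mult_distrib mult.assoc simp del: mult_minus_right)

lemma weak_gradient_translate:
  assumes "u \<in> borel_measurable borel" "is_L2_weak_gradient u g"
  shows "is_L2_weak_gradient (\<lambda>x. u (h + x)) (\<lambda>x. g (h + x))"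
  unfolding is_L2_weak_gradient_def
proof (intro conjI ballI allI)
  have [measurable]: "u \<in> borel_measurable borel" "g \<in> borel_measurable borel"
    using assms by (auto simp: is_L2_weak_gradient_def)
  show "(\<lambda>x. g (h + x)) \<in> borel_measurable lborel" by simp
  show "integrable lborel (\<lambda>x. (norm (g (h + x)))\<^sup>2)"
    using assms(2) integral_translate(2)[of "\<lambda>x. (norm (g x))\<^sup>2" h] by (simp add: is_L2_weak_gradient_def)
  fix \<phi> k assume \<phi>: "\<phi> \<in> test_functions"
  note [measurable] = test_measurable[OF \<phi>] measurable_vec_nth[of g k]
  have d: "\<phi> differentiable (at x)" for x using test_smooth[OF \<phi>, of "Suc 0"] by simp
  let ?\<psi> = "\<lambda>x. \<phi> (- h + 1 *\<^sub>R x)"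
  have \<psi>: "?\<psi> \<in> test_functions" by (rule test_affine[OF \<phi>]) simp
  note [measurable] = test_measurable[OF test_partial[OF \<psi>]] test_measurable[OF \<psi>]
  have p: "partial k ?\<psi> (h + x) = partial k \<phi> x" for x
    using partial_affine[where f=\<phi> and c=1 and y="- h" and x="h + x"] d by simp
  have "(LBINT x. u (h + x) * partial k \<phi> x) = (LBINT x. u (h + x) * partial k ?\<psi> (h + x))"
    by (simp only: p)
  also have "\<dots> = (LBINT x. u x * partial k ?\<psi> x)"
    by (rule integral_translate(1)[of "\<lambda>x. u x * partial k ?\<psi> x"]) measurable
  also have "\<dots> = - (LBINT x. g x $ k * ?\<psi> x)"
    using assms(2) \<psi> by (simp add: is_L2_weak_gradient_def)
  also have "(LBINT x. g x $ k * ?\<psi> x) = (LBINT x. g (h + x) $ k * ?\<psi> (h + x))"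
    by (rule integral_translate(1)[of "\<lambda>x. g x $ k * ?\<psi> x", symmetric]) measurable
  finally show "(LBINT x. u (h + x) * partial k \<phi> x) = - (LBINT x. g (h + x) $ k * \<phi> x)" by simp
qed

lemma D12I:
  "u \<in> borel_measurable borel \<Longrightarrow> integrable lborel (\<lambda>x. u x ^ 4) \<Longrightarrow> is_L2_weak_gradient u g \<Longrightarrow> u \<in> D12"
  by (auto simp: D12_def)

lemma D12_add:
  assumes u: "u \<in> D12" and v: "v \<in> D12" shows "(\<lambda>x. u x + v x) \<in> D12"
proof (rule D12I)
  note [measurable] = D12_measurable[OF u] D12_measurable[OF v]
  show "(\<lambda>x. u x + v x) \<in> borel_measurable borel" by measurable
  show "integrable lborel (\<lambda>x. (u x + v x) ^ 4)"
    by (rule Bochner_Integration.integrable_bound[of _ "\<lambda>x. 8 * u x ^ 4 + 8 * v x ^ 4"])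
       (use D12_integrable[OF u] D12_integrable[OF v] fourth_add_le in auto)
  show "is_L2_weak_gradient (\<lambda>x. u x + v x) (\<lambda>x. weak_grad u x + weak_grad v x)"
    by (intro weak_gradient_add D12_loc_int weak_grad u v)
qed

lemma D12_cmult:
  assumes "u \<in> D12" shows "(\<lambda>x. c * u x) \<in> D12"
  using D12_measurable[OF assms] D12_integrable[OF assms]
  by (intro D12I[OF _ _ weak_gradient_cmult[OF weak_grad[OF assms]]]) (auto simp: power_mult_distrib)

lemma D12_translate:
  assumes "u \<in> D12" shows "(\<lambda>x. u (h + x)) \<in> D12"
proof (rule D12I[OF _ _ weak_gradient_translate[OF _ weak_grad[OF assms]]])
  note [measurable] = D12_measurable[OF assms]
  show "(\<lambda>x. u (h + x)) \<in> borel_measurable borel" by measurable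
  show "integrable lborel (\<lambda>x. u (h + x) ^ 4)"
    using D12_integrable[OF assms] by (subst integral_translate(2)[of "\<lambda>x. u x ^ 4"]) auto
qed (fact D12_measurable[OF assms])

lemma dirichlet_cmult: "u \<in> D12 \<Longrightarrow> dirichlet (\<lambda>x. c * u x) = c\<^sup>2 * dirichlet u"
  by (subst dirichlet_eq[OF weak_gradient_cmult[OF weak_grad]])
     (auto simp: power_mult_distrib dirichlet_def)

lemma dirichlet_translate:
  assumes "u \<in> D12" shows "dirichlet (\<lambda>x. u (h + x)) = dirichlet u"
  using D12_measurable[OF assms] weak_grad_measurable[OF assms]
  by (subst dirichlet_eq[OF weak_gradient_translate[OF _ weak_grad[OF assms]]])
     (auto simp: dirichlet_def intro!: integral_translate(1)[of "\<lambda>x. (norm (weak_grad u x))\<^sup>2"])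

lemma dform_integrable:
  assumes u: "u \<in> D12" and v: "v \<in> D12" shows "integrable lborel (\<lambda>x. weak_grad u x \<bullet> weak_grad v x)"
proof (rule Bochner_Integration.integrable_bound[of _ "\<lambda>x. (norm (weak_grad u x))\<^sup>2 + (norm (weak_grad v x))\<^sup>2"])
  note [measurable] = weak_grad_measurable[OF u] weak_grad_measurable[OF v]
  show "(\<lambda>x. weak_grad u x \<bullet> weak_grad v x) \<in> borel_measurable lborel" by measurable
  have "\<bar>a \<bullet> b\<bar> \<le> (norm a)\<^sup>2 + (norm b)\<^sup>2" for a b :: R4
    using Cauchy_Schwarz_ineq2[of a b] sum_squares_bound[of "norm a" "norm b"]
      mult_nonneg_nonneg[OF norm_ge_zero[of a] norm_ge_zero[of b]] by linarith
  then show "AE x in lborel. norm (weak_grad u x \<bullet> weak_grad v x)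
      \<le> norm ((norm (weak_grad u x))\<^sup>2 + (norm (weak_grad v x))\<^sup>2)" by simp
qed (use u v dirichlet_integrable in auto)

lemma dirichlet_add_cmult:
  assumes u: "u \<in> D12" and v: "v \<in> D12"
  shows "dirichlet (\<lambda>x. u x + t * v x) = dirichlet u + 2 * t * dform u v + t\<^sup>2 * dirichlet v"
proof -
  note int = dform_integrable[OF u v] dirichlet_integrable[OF u] dirichlet_integrable[OF v]
  have "dirichlet (\<lambda>x. u x + t * v x) = (LBINT x. (norm (weak_grad u x + t *\<^sub>R weak_grad v x))\<^sup>2)"
    by (intro dirichlet_eq weak_gradient_add weak_gradient_cmult weak_grad D12_loc_int D12_cmult u v)
  also have "\<dots> = (LBINT x. (norm (weak_grad u x))\<^sup>2 + 2 * t * (weak_grad u x \<bullet> weak_grad v x)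
      + t\<^sup>2 * (norm (weak_grad v x))\<^sup>2)"
    by (intro Bochner_Integration.integral_cong)
       (auto simp: power2_norm_eq_inner inner_left_distrib inner_right_distrib inner_commute power2_eq_square[of t] algebra_simps
         simp del: norm_eq_sqrt_inner)
  also have "\<dots> = dirichlet u + 2 * t * dform u v + t\<^sup>2 * dirichlet v"
    using int by (simp add: dirichlet_def dform_def)
  finally show ?thesis .
qed

text \<open>The integrals \<open>\<integral> u \<phi>(x + t e\<^sub>k)\<close> do not depend on \<open>t\<close> when the gradient vanishes, and they tend to 0
  as \<open>t \<rightarrow> \<infinity>\<close> because \<open>u \<in> L\<^sup>4\<close>.\<close>

lemma dirichlet_eq_0_imp:
  assumes u: "u \<in> D12" and d: "dirichlet u = 0"
  shows "AE x in lborel. u x = 0"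
proof (rule fundamental_lemma)
  show li: "loc_int u" using u by (rule D12_loc_int)
  note [measurable] = D12_measurable[OF u] weak_grad_measurable[OF u]
  have "AE x in lborel. (norm (weak_grad u x))\<^sup>2 = 0"
    using d integral_nonneg_eq_0_iff_AE[OF dirichlet_integrable[OF u]] by (simp add: dirichlet_def)
  then have g0: "AE x in lborel. weak_grad u x = 0" by simp
  have zero: "(LBINT x. u x * partial k \<phi> x) = 0" if "\<phi> \<in> test_functions" for \<phi> k
  proof -
    have "(LBINT x. weak_grad u x $ k * \<phi> x) = 0"
      using g0 by (intro integral_eq_zero_AE) (auto elim!: eventually_mono)
    then show ?thesis using weak_grad[OF u] that by (simp add: is_L2_weak_gradient_def)
  qed
  fix \<phi> assume \<phi>: "\<phi> \<in> test_functions"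
  \<comment> \<open>Any fixed direction serves; \<open>0\<close> merely names one element of the
    index type.\<close>
  define k :: 4 where "k = 0"
  let ?e = "axis k 1 :: R4"
  let ?G = "\<lambda>t. LBINT x. u x * \<phi> (x + t *\<^sub>R ?e)"
  have "(?G has_real_derivative 0) (at t)" for t
  proof -
    have "\<phi> differentiable (at x)" for x using test_smooth[OF \<phi>, of "Suc 0"] by simp
    then have p: "partial k (\<lambda>x. \<phi> (t *\<^sub>R ?e + 1 *\<^sub>R x)) x = partial k \<phi> (x + t *\<^sub>R ?e)" for x
      using partial_affine[where f=\<phi> and c=1 and y="t *\<^sub>R ?e" and x=x] by (simp add: add.commute)
    have "(LBINT x. u x * partial k \<phi> (x + t *\<^sub>R ?e)) = 0"
      using zero[OF test_affine[OF \<phi>, of 1 "t *\<^sub>R ?e"], of k] unfolding p by simp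
    then show ?thesis
      using DERIV_integral_translate[OF li test_smooth[OF \<phi>] test_bounded[OF \<phi>], of k t] by simp
  qed
  then have const: "?G t = ?G 0" for t using DERIV_isconst_all[of ?G] by blast
  obtain M where M: "M > 0" "\<And>x. \<bar>\<phi> x\<bar> \<le> M"
    using continuous_bounded_support_bounded[OF test_continuous[OF \<phi>] test_bounded[OF \<phi>]] by metis
  obtain r where r: "r > 0" "{x. \<phi> x \<noteq> 0} \<subseteq> cube r" using bounded_subset_cube[OF test_bounded[OF \<phi>]] by blast
  \<comment> \<open>\<open>I n\<close> contains the support of the test function shifted by
    \<open>n\<close>. For fixed \<open>x\<close> it vanishes once \<open>n\<close> exceeds
    \<open>r\<close> plus the absolute value of the \<open>k\<close>-th coordinate, so the part of
    the L4 mass that it selects tends to 0.\<close>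
  define I where "I n x = (indicator (cube r) (x + real n *\<^sub>R ?e) :: real)" for n x
  have Im[measurable]: "I n \<in> borel_measurable borel" for n unfolding I_def by measurable
  have Iint: "integrable lborel (I n)" "integral\<^sup>L lborel (I n) = integral\<^sup>L lborel (indicator (cube r))" for n
    using integral_translate[of "indicator (cube r) :: R4 \<Rightarrow> real" "real n *\<^sub>R ?e"] integrable_indicator_cube
    by (simp_all add: I_def[abs_def] add.commute)
  define V :: real where "V = integral\<^sup>L lborel (indicator (cube r))"
  have V: "0 \<le> V" unfolding V_def by (rule Bochner_Integration.integral_nonneg) simp
  have I4int: "integrable lborel (\<lambda>x. u x ^ 4 * I n x)" for n
    by (rule Bochner_Integration.integrable_bound[OF D12_integrable[OF u]]) (auto simp: I_def indicator_def)
  have "(\<lambda>n. LBINT x. u x ^ 4 * I n x) \<longlonglongrightarrow> (LINT x|(lborel :: R4 measure). 0 :: real)"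
  proof (rule integral_dominated_convergence[where w="\<lambda>x. u x ^ 4" and f="\<lambda>x. 0"])
    show "integrable lborel (\<lambda>x. u x ^ 4)" by (rule D12_integrable[OF u])
    show "AE x in lborel. (\<lambda>n. u x ^ 4 * I n x) \<longlonglongrightarrow> 0"
    proof (intro AE_I2 tendsto_eventually)
      fix x
      obtain N where N: "real N > r + \<bar>x $ k\<bar>" using reals_Archimedean2 by blast
      have "x + real n *\<^sub>R ?e \<notin> cube r" if "n \<ge> N" for n
      proof
        assume "x + real n *\<^sub>R ?e \<in> cube r"
        then have "\<bar>x $ k + real n\<bar> \<le> r" by (auto simp: mem_cube axis_def dest: spec[of _ k])
        moreover have "real N \<le> real n" using that by simp
        ultimately show False using N by linarith
      qed
      then show "\<forall>\<^sub>F n in sequentially. u x ^ 4 * I n x = 0"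
        by (intro eventually_sequentiallyI[of N]) (simp add: I_def)
    qed
  qed (auto simp: I_def indicator_def)
  then have lim: "(\<lambda>n. LBINT x. u x ^ 4 * I n x) \<longlonglongrightarrow> 0" by simp
  \<comment> \<open>The values of \<open>u\<close> are split at height \<epsilon>: below it the
    contribution is at most \<epsilon> times a fixed volume, above it
    \<open>\<bar>u x\<bar> \<le> u x ^ 4 / \<epsilon> ^ 3\<close>. Letting \<open>n\<close> tend to
    infinity for fixed \<epsilon> removes the second part, and \<epsilon> tending to 0 removes the
    other.\<close>
  have bound: "\<bar>?G 0\<bar> \<le> M * (\<epsilon> * V + (LBINT x. u x ^ 4 * I n x) / \<epsilon> ^ 3)" if "\<epsilon> > 0" for \<epsilon> n
  proof -
    have pt: "\<bar>u x\<bar> \<le> \<epsilon> + u x ^ 4 / \<epsilon> ^ 3" for x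
    proof (cases "\<bar>u x\<bar> \<le> \<epsilon>")
      case True
      then show ?thesis using that by (simp add: add_increasing2)
    next
      case False
      then have "\<epsilon> ^ 3 \<le> \<bar>u x\<bar> ^ 3" using that by (intro power_mono) auto
      then have "\<bar>u x\<bar> * \<epsilon> ^ 3 \<le> \<bar>u x\<bar> * \<bar>u x\<bar> ^ 3" by (intro mult_left_mono) auto
      also have "\<dots> = u x ^ 4" by (subst power_Suc[symmetric]) (simp add: power_even_abs)
      finally have "\<bar>u x\<bar> \<le> u x ^ 4 / \<epsilon> ^ 3" using that by (simp add: field_simps)
      then show ?thesis using that by simp
    qed
    have le: "\<bar>u x * \<phi> (x + real n *\<^sub>R ?e)\<bar> \<le> M * (\<epsilon> * I n x + (u x ^ 4 * I n x) / \<epsilon> ^ 3)" for x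
    proof (cases "\<phi> (x + real n *\<^sub>R ?e) = 0")
      case True
      have "0 \<le> M * (\<epsilon> * I n x + (u x ^ 4 * I n x) / \<epsilon> ^ 3)"
        using M(1) that by (intro mult_nonneg_nonneg add_nonneg_nonneg divide_nonneg_nonneg) (auto simp: I_def)
      with True show ?thesis by simp
    next
      case False
      then have "I n x = 1" using r by (auto simp: I_def)
      moreover have "\<bar>u x\<bar> * \<bar>\<phi> (x + real n *\<^sub>R ?e)\<bar> \<le> (\<epsilon> + u x ^ 4 / \<epsilon> ^ 3) * M"
        using M that by (intro mult_mono pt) auto
      ultimately show ?thesis by (simp add: abs_mult mult.commute)
    qed
    have "\<bar>?G 0\<bar> = \<bar>?G (real n)\<bar>" using const by metis
    also have "\<dots> \<le> (LBINT x. \<bar>u x * \<phi> (x + real n *\<^sub>R ?e)\<bar>)"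
      by (rule integral_abs_bound)
    also have "\<dots> \<le> (LBINT x. M * (\<epsilon> * I n x + (u x ^ 4 * I n x) / \<epsilon> ^ 3))"
    proof (rule integral_mono_AE')
      show "integrable lborel (\<lambda>x. M * (\<epsilon> * I n x + (u x ^ 4 * I n x) / \<epsilon> ^ 3))"
        using Iint I4int by auto
      show "AE x in lborel. \<bar>u x * \<phi> (x + real n *\<^sub>R ?e)\<bar> \<le> M * (\<epsilon> * I n x + (u x ^ 4 * I n x) / \<epsilon> ^ 3)"
        by (rule AE_I2) (rule le)
      show "AE x in lborel. 0 \<le> M * (\<epsilon> * I n x + (u x ^ 4 * I n x) / \<epsilon> ^ 3)"
        by (rule AE_I2) (rule order_trans[OF abs_ge_zero le])
    qed
    also have "\<dots> = M * (\<epsilon> * V + (LBINT x. u x ^ 4 * I n x) / \<epsilon> ^ 3)"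
      using Iint I4int by (simp add: V_def del: Bochner_Integration.integral_indicator integral_indicator)
    finally show ?thesis .
  qed
  have "\<bar>?G 0\<bar> \<le> M * (\<epsilon> * V)" if "\<epsilon> > 0" for \<epsilon>
  proof -
    have "(\<lambda>n. M * (\<epsilon> * V + (LBINT x. u x ^ 4 * I n x) / \<epsilon> ^ 3)) \<longlonglongrightarrow> M * (\<epsilon> * V + 0 / \<epsilon> ^ 3)"
      using that by (intro tendsto_intros lim) auto
    from LIMSEQ_le_const[OF this] bound[OF that] show ?thesis by simp
  qed
  then have "\<forall>\<^sub>F \<epsilon> in at_right 0. \<bar>?G 0\<bar> \<le> M * (\<epsilon> * V)"
    by (auto simp: eventually_at_filter)
  moreover have "((\<lambda>\<epsilon>. M * (\<epsilon> * V)) \<longlongrightarrow> M * (0 * V)) (at_right 0)"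
    by (intro tendsto_intros)
  ultimately have "\<bar>?G 0\<bar> \<le> M * (0 * V)" by (intro tendsto_lowerbound) auto
  then show "(LBINT x. u x * \<phi> x) = 0" by simp
qed

section \<open>Continuity of translations in L1\<close>

text \<open>The limit is stated along sequences so that dominated convergence applies
  directly.\<close>

definition trans_cont :: "(R4 \<Rightarrow> real) \<Rightarrow> bool" where
  "trans_cont f \<longleftrightarrow> (\<forall>h. h \<longlonglongrightarrow> 0 \<longrightarrow> (\<lambda>n. LBINT x. \<bar>f (h n + x) - f x\<bar>) \<longlonglongrightarrow> 0)"

lemma integrable_translate: "integrable lborel f \<Longrightarrow> integrable lborel (\<lambda>x. f (h + x))"
  for f :: "'a::euclidean_space \<Rightarrow> 'b::{banach, second_countable_topology}"
  using integral_translate(2)[of f h] borel_measurable_integrable[of lborel f] by simp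

text \<open>An e/3 argument: translation preserves the L1 norm, so the approximation error is the
  same before and after the shift. The lemma closes the class under L1 limits, as needed for the
  induction over integrable functions.\<close>

lemma trans_cont_approx:
  assumes f: "integrable lborel f"
    and ex: "\<And>e. e > 0 \<Longrightarrow> \<exists>g. integrable lborel g \<and> trans_cont g \<and> (LBINT x. \<bar>f x - g x\<bar>) < e"
  shows "trans_cont f"
  unfolding trans_cont_def
proof (intro allI impI)
  fix h :: "nat \<Rightarrow> R4" assume h: "h \<longlonglongrightarrow> 0"
  show "(\<lambda>n. LBINT x. \<bar>f (h n + x) - f x\<bar>) \<longlonglongrightarrow> 0"
  proof (rule LIMSEQ_I)
    fix e :: real assume "e > 0"
    then obtain g where g: "integrable lborel g" "trans_cont g" "(LBINT x. \<bar>f x - g x\<bar>) < e / 3"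
      using ex[of "e / 3"] by auto
    have "(\<lambda>n. LBINT x. \<bar>g (h n + x) - g x\<bar>) \<longlonglongrightarrow> 0"
      using g(2) h by (simp add: trans_cont_def)
    then obtain N where N: "\<And>n. n \<ge> N \<Longrightarrow> \<bar>LBINT x. \<bar>g (h n + x) - g x\<bar>\<bar> < e / 3"
      using LIMSEQ_D[of _ 0 "e / 3"] \<open>e > 0\<close> by force
    have "\<bar>LBINT x. \<bar>f (h n + x) - f x\<bar>\<bar> < e" if "n \<ge> N" for n
    proof -
      note int = f g(1) integrable_translate[OF f, of "h n"] integrable_translate[OF g(1), of "h n"]
      have "(LBINT x. \<bar>f (h n + x) - f x\<bar>) \<le>
        (LBINT x. \<bar>f (h n + x) - g (h n + x)\<bar> + \<bar>g (h n + x) - g x\<bar> + \<bar>f x - g x\<bar>)"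
        using int by (intro integral_mono) auto
      also have "\<dots> = (LBINT x. \<bar>f (h n + x) - g (h n + x)\<bar>) + (LBINT x. \<bar>g (h n + x) - g x\<bar>)
          + (LBINT x. \<bar>f x - g x\<bar>)"
        using int by simp
      also have "(LBINT x. \<bar>f (h n + x) - g (h n + x)\<bar>) = (LBINT x. \<bar>f x - g x\<bar>)"
        using borel_measurable_integrable[OF f] borel_measurable_integrable[OF g(1)]
        by (intro integral_translate(1)[of "\<lambda>x. \<bar>f x - g x\<bar>"]) simp
      finally have "(LBINT x. \<bar>f (h n + x) - f x\<bar>) < e" using g(3) N[OF that] by linarith
      then show ?thesis by simp
    qed
    then show "\<exists>N. \<forall>n\<ge>N. norm ((LBINT x. \<bar>f (h n + x) - f x\<bar>) - 0) < e" by auto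
  qed
qed

text \<open>The boundary of \<open>U\<close> may have positive measure, so shifted indicators need
  not converge pointwise there. Their minimum with the indicator of \<open>U\<close> does converge
  everywhere, because \<open>U\<close> is open, and \<bar>a - b\<bar> = a + b - 2 min(a, b) together
  with translation invariance turns this into L1 convergence.\<close>

lemma trans_cont_open:
  assumes U: "open U" "emeasure lborel U < \<infinity>"
  shows "trans_cont (indicator U)"
  unfolding trans_cont_def
proof (intro allI impI)
  fix h :: "nat \<Rightarrow> R4" assume h: "h \<longlonglongrightarrow> 0"
  let ?f = "indicator U :: R4 \<Rightarrow> real"
  have [measurable]: "U \<in> sets borel" using U by auto
  have f: "integrable lborel ?f" using U by (intro integrable_real_indicator) auto
  have ft: "integrable lborel (\<lambda>x. ?f (h n + x))" for n by (rule integrable_translate[OF f])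
  have m: "integrable lborel (\<lambda>x. min (?f x) (?f (h n + x)))" for n
    by (rule Bochner_Integration.integrable_bound[OF f]) (auto simp: indicator_def)
  have eq: "(LBINT x. \<bar>?f (h n + x) - ?f x\<bar>)
      = 2 * (LBINT x. ?f x) - 2 * (LBINT x. min (?f x) (?f (h n + x)))" for n
  proof -
    have "(LBINT x. \<bar>?f (h n + x) - ?f x\<bar>)
        = (LBINT x. ?f (h n + x) + ?f x - 2 * min (?f x) (?f (h n + x)))"
      by (intro Bochner_Integration.integral_cong) (auto simp: min_def)
    also have "\<dots> = (LBINT x. ?f (h n + x)) + (LBINT x. ?f x) - 2 * (LBINT x. min (?f x) (?f (h n + x)))"
      using f ft m by (simp del: integral_indicator Bochner_Integration.integral_indicator)
    finally show ?thesis using integral_translate(1)[of ?f "h n"] by simp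
  qed
  have "(\<lambda>n. LBINT x. min (?f x) (?f (h n + x))) \<longlonglongrightarrow> (LBINT x. ?f x)"
  proof (rule integral_dominated_convergence[OF _ _ f])
    show "AE x in lborel. (\<lambda>n. min (?f x) (?f (h n + x))) \<longlonglongrightarrow> ?f x"
    proof (rule AE_I2)
      fix x
      show "(\<lambda>n. min (?f x) (?f (h n + x))) \<longlonglongrightarrow> ?f x"
      proof (cases "x \<in> U")
        case True
        have "(\<lambda>n. h n + x) \<longlonglongrightarrow> 0 + x" by (intro tendsto_intros h)
        then have "\<forall>\<^sub>F n in sequentially. h n + x \<in> U" using U(1) True by (intro topological_tendstoD) auto
        then show ?thesis using True by (intro tendsto_eventually) (auto elim!: eventually_mono)
      qed (simp add: min_def)
    qed
  qed (auto simp: indicator_def)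
  then have "(\<lambda>n. 2 * (LBINT x. ?f x) - 2 * (LBINT x. min (?f x) (?f (h n + x))))
      \<longlonglongrightarrow> 2 * (LBINT x. ?f x) - 2 * (LBINT x. ?f x)" by (intro tendsto_intros)
  then show "(\<lambda>n. LBINT x. \<bar>?f (h n + x) - ?f x\<bar>) \<longlonglongrightarrow> 0" unfolding eq by simp
qed

lemma trans_cont_add:
  assumes f: "integrable lborel f" "trans_cont f" and g: "integrable lborel g" "trans_cont g"
  shows "trans_cont (\<lambda>x. f x + g x)"
  unfolding trans_cont_def
proof (intro allI impI)
  fix h :: "nat \<Rightarrow> R4" assume h: "h \<longlonglongrightarrow> 0"
  note int = f(1) g(1) integrable_translate[OF f(1)] integrable_translate[OF g(1)]
  show "(\<lambda>n. LBINT x. \<bar>f (h n + x) + g (h n + x) - (f x + g x)\<bar>) \<longlonglongrightarrow> 0"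
  proof (rule tendsto_sandwich[OF always_eventually always_eventually tendsto_const])
    show "(\<lambda>n. (LBINT x. \<bar>f (h n + x) - f x\<bar>) + (LBINT x. \<bar>g (h n + x) - g x\<bar>)) \<longlonglongrightarrow> 0"
      using f(2) g(2) h by (intro tendsto_add_zero) (simp_all add: trans_cont_def)
    show "\<forall>n. (LBINT x. \<bar>f (h n + x) + g (h n + x) - (f x + g x)\<bar>) \<le>
      (LBINT x. \<bar>f (h n + x) - f x\<bar>) + (LBINT x. \<bar>g (h n + x) - g x\<bar>)"
    proof
      fix n
      have "(LBINT x. \<bar>f (h n + x) + g (h n + x) - (f x + g x)\<bar>) \<le>
        (LBINT x. \<bar>f (h n + x) - f x\<bar> + \<bar>g (h n + x) - g x\<bar>)"
        using int by (intro integral_mono) auto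
      then show "(LBINT x. \<bar>f (h n + x) + g (h n + x) - (f x + g x)\<bar>) \<le>
      (LBINT x. \<bar>f (h n + x) - f x\<bar>) + (LBINT x. \<bar>g (h n + x) - g x\<bar>)" using int by simp
    qed
  qed simp
qed

lemma trans_cont_cmult:
  assumes "trans_cont f" shows "trans_cont (\<lambda>x. c * f x)"
  unfolding trans_cont_def
proof (intro allI impI)
  fix h :: "nat \<Rightarrow> R4" assume "h \<longlonglongrightarrow> 0"
  then have "(\<lambda>n. \<bar>c\<bar> * (LBINT x. \<bar>f (h n + x) - f x\<bar>)) \<longlonglongrightarrow> \<bar>c\<bar> * 0"
    using assms by (intro tendsto_intros) (simp add: trans_cont_def)
  then show "(\<lambda>n. LBINT x. \<bar>c * f (h n + x) - c * f x\<bar>) \<longlonglongrightarrow> 0"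
    by (simp add: abs_mult flip: right_diff_distrib)
qed

text \<open>Outer regularity reduces indicators of measurable sets of finite measure to open sets;
  sums and dominated limits of simple functions are covered by the closure lemmas.\<close>

theorem integrable_trans_cont:
  assumes "integrable lborel f" shows "trans_cont f"
  using assms
proof (induction rule: integrable_induct)
  case (base A c)
  have [measurable]: "A \<in> sets borel" using base by simp
  have A: "integrable lborel (indicator A :: R4 \<Rightarrow> real)" using base by (intro integrable_real_indicator) auto
  have "trans_cont (indicator A)"
  proof (rule trans_cont_approx[OF A])
    fix e :: real assume e: "e > 0"
    obtain U where U: "open U" "A \<subseteq> U" "emeasure lborel (U - A) < e"
      using outer_regular_lborel[of A e] base e by auto
    have [measurable]: "U \<in> sets borel" using U by auto
    have "emeasure lborel U = emeasure lborel A + emeasure lborel (U - A)"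
      using U(2) by (subst plus_emeasure) (auto simp: Un_absorb1)
    then have fin: "emeasure lborel U < \<infinity>"
      using base(2) order_less_trans[OF U(3), of \<infinity>] by simp
    have "(LBINT x. \<bar>indicator A x - indicator U x\<bar> :: real) = (LBINT x. indicator (U - A) x)"
      using U(2) by (intro Bochner_Integration.integral_cong) (auto simp: indicator_def)
    also have "\<dots> < e"
      using U(3) e by (simp add: measure_def enn2real_less_iff order_less_trans[OF U(3)])
    finally have "(LBINT x. \<bar>indicator A x - indicator U x\<bar>) < e" .
    moreover have "integrable lborel (indicator U :: R4 \<Rightarrow> real)" using fin by (intro integrable_real_indicator) auto
    ultimately show "\<exists>g. integrable lborel g \<and> trans_cont g \<and> (LBINT x. \<bar>indicator A x - g x\<bar>) < e"
      using trans_cont_open[OF U(1) fin] by blast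
  qed
  from trans_cont_cmult[OF this, of c] show ?case by (simp add: mult.commute)
next
  case (add f g)
  then show ?case by (intro trans_cont_add)
next
  case (lim f s)
  note [measurable] = borel_measurable_integrable[OF lim.hyps(1)] borel_measurable_integrable[OF lim.hyps(4)]
  \<comment> \<open>The factor 3 arises from the bound \<open>2 * \<bar>f x\<bar>\<close> on the
    approximants in the induction rule.\<close>
  have "(\<lambda>i. LBINT x. \<bar>f x - s i x\<bar>) \<longlonglongrightarrow> (LINT x|(lborel::R4 measure). 0)"
  proof (rule integral_dominated_convergence[where w="\<lambda>x. 3 * \<bar>f x\<bar>"])
    show "AE x in lborel. (\<lambda>i. \<bar>f x - s i x\<bar>) \<longlonglongrightarrow> 0"
    proof (intro AE_I2 tendsto_rabs_zero)
      fix x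
      have "(\<lambda>i. f x - s i x) \<longlonglongrightarrow> f x - f x" using lim.hyps(2) by (intro tendsto_intros) simp
      then show "(\<lambda>i. f x - s i x) \<longlonglongrightarrow> 0" by simp
    qed
    show "AE x in lborel. norm \<bar>f x - s i x\<bar> \<le> 3 * \<bar>f x\<bar>" for i
    proof (rule AE_I2)
      fix x show "norm \<bar>f x - s i x\<bar> \<le> 3 * \<bar>f x\<bar>" using lim.hyps(3)[of x i] abs_triangle_ineq4[of "f x" "s i x"] by simp
    qed
  qed (use lim.hyps(4) in auto)
  then have "(\<lambda>i. LBINT x. \<bar>f x - s i x\<bar>) \<longlonglongrightarrow> 0" by simp
  show ?case
  proof (rule trans_cont_approx[OF lim.hyps(4)])
    fix e :: real assume "e > 0"
    then obtain i where "\<bar>LBINT x. \<bar>f x - s i x\<bar>\<bar> < e"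
      using LIMSEQ_D[OF \<open>(\<lambda>i. LBINT x. \<bar>f x - s i x\<bar>) \<longlonglongrightarrow> 0\<close>] by fastforce
    then show "\<exists>g. integrable lborel g \<and> trans_cont g \<and> (LBINT x. \<bar>f x - g x\<bar>) < e"
      using lim.hyps(1) lim.IH by (intro exI[of _ "s i"]) auto
  qed
qed

section \<open>Translations of locally integrable functions\<close>

lemma cube_translate: "norm h \<le> T \<Longrightarrow> x \<in> cube r \<Longrightarrow> h + x \<in> cube (r + T)"
proof -
  assume h: "norm h \<le> T" and x: "x \<in> cube r"
  have "\<bar>(h + x) $ i\<bar> \<le> r + T" for i
  proof -
    have "\<bar>h $ i\<bar> \<le> T" using h component_le_norm_cart[of h i] by linarith
    moreover have "\<bar>x $ i\<bar> \<le> r" using x by (simp add: mem_cube)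
    ultimately show ?thesis by simp
  qed
  then show ?thesis by (simp add: mem_cube)
qed

lemma loc_int_abs: "loc_int u \<Longrightarrow> integrable lborel (\<lambda>x. indicator (cube r) x * \<bar>u x\<bar>)"
proof -
  assume "loc_int u"
  then have "integrable lborel (\<lambda>x. \<bar>indicator (cube r) x * u x\<bar>)" by (simp add: loc_int_def)
  then show ?thesis by (simp add: abs_mult)
qed

lemma loc_int_translate:
  assumes "loc_int u" shows "loc_int (\<lambda>x. u (h + x))"
    and "norm h \<le> T \<Longrightarrow> (LBINT x. indicator (cube r) x * \<bar>u (h + x)\<bar>) \<le> (LBINT x. indicator (cube (r + T)) x * \<bar>u x\<bar>)"
proof -
  have [measurable]: "u \<in> borel_measurable borel" using assms by (simp add: loc_int_def)
  have int: "integrable lborel (\<lambda>x. indicator (cube (r + T)) (h + x) * \<bar>u (h + x)\<bar>)" for r T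
    by (rule integrable_translate[OF loc_int_abs[OF assms]])
  have le: "indicator (cube r) x * \<bar>u (h + x)\<bar> \<le> indicator (cube (r + T)) (h + x) * \<bar>u (h + x)\<bar>"
    if "norm h \<le> T" for r x T using cube_translate[OF that, of x r] by (auto simp: indicator_def)
  have int': "integrable lborel (\<lambda>x. indicator (cube r) x * u (h + x))" for r
    by (rule Bochner_Integration.integrable_bound[OF int[of r "norm h"]])
       (use le[of "norm h"] in \<open>auto simp: abs_mult\<close>)
  then show "loc_int (\<lambda>x. u (h + x))" by (simp add: loc_int_def)
  assume T: "norm h \<le> T"
  have "(LBINT x. indicator (cube r) x * \<bar>u (h + x)\<bar>) \<le> (LBINT x. indicator (cube (r + T)) (h + x) * \<bar>u (h + x)\<bar>)"
    using integrable_norm[OF int'[of r]] by (intro integral_mono int le T) (simp add: abs_mult)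
  also have "\<dots> = (LBINT x. indicator (cube (r + T)) x * \<bar>u x\<bar>)"
    by (rule integral_translate(1)[of "\<lambda>x. indicator (cube (r + T)) x * \<bar>u x\<bar>"]) measurable
  finally show "(LBINT x. indicator (cube r) x * \<bar>u (h + x)\<bar>) \<le> (LBINT x. indicator (cube (r + T)) x * \<bar>u x\<bar>)" .
qed

lemma loc_int_minus: "loc_int u \<Longrightarrow> loc_int v \<Longrightarrow> loc_int (\<lambda>x. u x - v x)"
  by (auto simp: loc_int_def right_diff_distrib)

lemma loc_int_trans_cont:
  assumes u: "loc_int u" and h: "h \<longlonglongrightarrow> 0"
  shows "(\<lambda>n. LBINT x. indicator (cube r) x * \<bar>u (h n + x) - u x\<bar>) \<longlonglongrightarrow> 0"
proof -
  \<comment> \<open>With radius \<open>r + 1\<close> the truncation changes neither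
    \<open>u x\<close> nor \<open>u (h n + x)\<close> for \<open>x\<close> in \<open>cube r\<close>,
    once \<open>h n\<close> has norm below 1.\<close>
  let ?f = "\<lambda>x. indicator (cube (r + 1)) x * u x"
  have f: "integrable lborel ?f" using u by (simp add: loc_int_def)
  have lim: "(\<lambda>n. LBINT x. \<bar>?f (h n + x) - ?f x\<bar>) \<longlonglongrightarrow> 0"
    using integrable_trans_cont[OF f] h by (auto simp: trans_cont_def)
  have "\<forall>\<^sub>F n in sequentially. dist (h n) 0 < 1" using h by (rule tendstoD) simp
  then have ev: "\<forall>\<^sub>F n in sequentially. (LBINT x. indicator (cube r) x * \<bar>u (h n + x) - u x\<bar>)
      \<le> (LBINT x. \<bar>?f (h n + x) - ?f x\<bar>)"
  proof eventually_elim
    case (elim n)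
    show ?case
    proof (rule integral_mono)
      show "integrable lborel (\<lambda>x. indicator (cube r) x * \<bar>u (h n + x) - u x\<bar>)"
        by (intro loc_int_abs loc_int_minus loc_int_translate(1) u)
      show "integrable lborel (\<lambda>x. \<bar>?f (h n + x) - ?f x\<bar>)"
        using f integrable_translate[OF f, of "h n"] by auto
      fix x
      show "indicator (cube r) x * \<bar>u (h n + x) - u x\<bar> \<le> \<bar>?f (h n + x) - ?f x\<bar>"
        using cube_translate[of "h n" 1 x r] elim cube_mono[of r "r + 1"] by (auto simp: indicator_def)
    qed
  qed
  show ?thesis
    by (rule tendsto_sandwich[OF always_eventually ev tendsto_const lim])
       (auto intro!: Bochner_Integration.integral_nonneg)
qed

section \<open>The absolute value of a Sobolev function\<close>

text \<open>Prepares the exchange of the average over \<open>s\<close> with the integral over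
  \<open>x\<close>. The bound is uniform in \<open>s\<close> because for \<open>s\<close> in [0,1]
  every shift has norm at most that of \<open>t *\<^sub>R e\<close>, so one enlarged cube
  suffices.\<close>

lemma pair_integrable_translate:
  assumes u: "loc_int u" and f: "f \<in> borel_measurable borel" "\<And>x. \<bar>f x\<bar> \<le> M" "bounded {x. f x \<noteq> 0}"
  shows "integrable (lborel \<Otimes>\<^sub>M lborel) (\<lambda>(s, x). indicator {0..1::real} s * (u ((s * t) *\<^sub>R e + x) * f x))"
proof (rule lborel_pair.Fubini_integrable)
  note [measurable] = f(1)
  have [measurable]: "u \<in> borel_measurable borel" using u by (simp add: loc_int_def)
  obtain r where r: "{x. f x \<noteq> 0} \<subseteq> cube r" using bounded_subset_cube[OF f(3)] by blast
  let ?F = "\<lambda>(s, x). indicator {0..1::real} s * (u ((s * t) *\<^sub>R e + x) * f x)"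
  have M: "0 \<le> M" using f(2)[of 0] by linarith
  let ?T = "norm (t *\<^sub>R e)"
  let ?C = "LBINT x. indicator (cube (r + ?T)) x * \<bar>u x\<bar>"
  show "?F \<in> borel_measurable (lborel \<Otimes>\<^sub>M lborel)" by measurable
  have int: "integrable lborel (\<lambda>x. u (h + x) * f x)" for h
    by (rule integrable_loc_int_mult[OF loc_int_translate(1)[OF u] f])
  then show "AE s in lborel. integrable lborel (\<lambda>x. ?F (s, x))" by simp
  have bd: "(LBINT x. norm (?F (s, x))) \<le> M * ?C * indicator {0..1} s" for s
  proof (cases "s \<in> {0..1}")
    case True
    have n: "norm ((s * t) *\<^sub>R e) \<le> ?T"
      using True mult_right_mono[of "\<bar>s\<bar>" 1 "\<bar>t\<bar> * norm e"] by (auto simp: abs_mult mult.assoc)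
    have li: "loc_int (\<lambda>x. u ((s * t) *\<^sub>R e + x))" by (rule loc_int_translate(1)[OF u])
    have "(LBINT x. norm (?F (s, x))) \<le> (LBINT x. M * (indicator (cube r) x * \<bar>u ((s * t) *\<^sub>R e + x)\<bar>))"
    proof (rule integral_mono_AE')
      show "integrable lborel (\<lambda>x. M * (indicator (cube r) x * \<bar>u ((s * t) *\<^sub>R e + x)\<bar>))"
        by (intro integrable_mult_right loc_int_abs li)
      show "AE x in lborel. norm (?F (s, x)) \<le> M * (indicator (cube r) x * \<bar>u ((s * t) *\<^sub>R e + x)\<bar>)"
      proof (rule AE_I2)
        fix x
        show "norm (?F (s, x)) \<le> M * (indicator (cube r) x * \<bar>u ((s * t) *\<^sub>R e + x)\<bar>)"
        proof (cases "f x = 0")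
          case False
          then have "x \<in> cube r" using r by auto
          moreover have "\<bar>u ((s * t) *\<^sub>R e + x)\<bar> * \<bar>f x\<bar> \<le> \<bar>u ((s * t) *\<^sub>R e + x)\<bar> * M"
            by (intro mult_left_mono f) simp
          ultimately show ?thesis using True by (simp add: abs_mult mult.commute)
        qed (use M in auto)
      qed
      show "AE x in lborel. 0 \<le> M * (indicator (cube r) x * \<bar>u ((s * t) *\<^sub>R e + x)\<bar>)" using M by simp
    qed
    also have "\<dots> \<le> M * ?C" using loc_int_translate(2)[OF u n, of r] M by (simp add: mult_left_mono)
    finally show ?thesis using True by simp
  qed simp
  show "integrable lborel (\<lambda>s. LBINT x. norm (?F (s, x)))"
  proof (rule Bochner_Integration.integrable_bound[of _ "\<lambda>s. M * ?C * indicator {0..1} s"])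
    show "integrable lborel (\<lambda>s. M * ?C * indicator {0..1::real} s)"
      by (intro integrable_mult_right integrable_real_indicator) auto
    show "(\<lambda>s. LBINT x. norm (?F (s, x))) \<in> borel_measurable lborel"
      by (rule lborel.borel_measurable_lebesgue_integral) measurable
    show "AE s in lborel. norm (LBINT x. norm (?F (s, x))) \<le> norm (M * ?C * indicator {0..1} s)"
    proof (rule AE_I2)
      fix s
      have "0 \<le> (LBINT x. norm (?F (s, x)))" by (rule Bochner_Integration.integral_nonneg) simp
      then show "norm (LBINT x. norm (?F (s, x))) \<le> norm (M * ?C * indicator {0..1} s)"
        using bd[of s] by simp
    qed
  qed
qed

text \<open>The mean of \<open>u\<close> over the segment from \<open>x\<close> to
  \<open>x + t *\<^sub>R e\<close>. The parameter is normalised to [0,1], so the domain of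
  integration stays fixed as \<open>t\<close> tends to 0.\<close>

abbreviation line_avg :: "(R4 \<Rightarrow> real) \<Rightarrow> R4 \<Rightarrow> real \<Rightarrow> R4 \<Rightarrow> real" where
  "line_avg u e t x \<equiv> LBINT s. indicator {0..1::real} s * u ((s * t) *\<^sub>R e + x)"

lemma loc_int_line_avg:
  assumes u: "loc_int u" shows "loc_int (line_avg u e t)"
  unfolding loc_int_def
proof (intro conjI allI)
  have [measurable]: "u \<in> borel_measurable borel" using u by (simp add: loc_int_def)
  show "line_avg u e t \<in> borel_measurable borel"
    using lborel.borel_measurable_lebesgue_integral[of "\<lambda>x s. indicator {0..1::real} s * u ((s * t) *\<^sub>R e + x)" lborel] by simp
  fix r
  have "integrable lborel (\<lambda>x. LBINT s. indicator {0..1::real} s * (u ((s * t) *\<^sub>R e + x) * indicator (cube r) x))"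
    by (rule lborel_pair.integrable_snd[OF pair_integrable_translate[OF u, of _ 1]])
       (auto simp: indicator_def intro: bounded_subset[OF bounded_cbox[of "- (\<chi> i. r)" "\<chi> i. r"]])
  moreover have "(LBINT s. indicator {0..1::real} s * (u ((s * t) *\<^sub>R e + x) * indicator (cube r) x))
      = indicator (cube r) x * line_avg u e t x" for x
    by (simp add: mult.commute mult.left_commute flip: integral_mult_right_zero)
  ultimately show "integrable lborel (\<lambda>x. indicator (cube r) x * line_avg u e t x)" by simp
qed

text \<open>A substitution moves the shift to the test function with opposite sign, the derivative
  falls on the test function, and the weak gradient identity returns it to \<open>u\<close>; the two
  signs cancel. Continuity follows since a component of \<open>g\<close> paired with shifted test
  functions is differentiable in the shift for the same reason.\<close>

lemma has_derivative_translate_sobolev: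
  assumes u: "loc_int u" and g: "is_L2_weak_gradient u g" and \<phi>: "\<phi> \<in> test_functions"
  shows "((\<lambda>t. LBINT x. u (t *\<^sub>R axis k 1 + x) * \<phi> x) has_real_derivative
     (LBINT x. g (t *\<^sub>R axis k 1 + x) $ k * \<phi> x)) (at t)"
    and "isCont (\<lambda>t. LBINT x. g (t *\<^sub>R axis k 1 + x) $ k * \<phi> x) t"
proof -
  let ?e = "axis k 1 :: R4"
  note [measurable] = test_measurable[OF \<phi>]
  have d: "\<phi> differentiable (at x)" for x using test_smooth[OF \<phi>, of "Suc 0"] by simp
  have shift: "(LBINT x. v (t *\<^sub>R ?e + x) * \<phi> x) = (LBINT x. v x * \<phi> (x + (- t) *\<^sub>R ?e))"
    if "loc_int v" for v t
  proof -
    have [measurable]: "v \<in> borel_measurable borel" using that by (simp add: loc_int_def)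
    show ?thesis
      using integral_translate(1)[of "\<lambda>x. v x * \<phi> (x + (- t) *\<^sub>R ?e)" "t *\<^sub>R ?e"] by simp
  qed
  have der: "((\<lambda>t. LBINT x. v (t *\<^sub>R ?e + x) * \<phi> x) has_real_derivative
      - (LBINT x. v x * partial k \<phi> (x + (- t) *\<^sub>R ?e))) (at t)" if v: "loc_int v" for v t
  proof -
    have "((\<lambda>t. LBINT x. v x * \<phi> (x + (- t) *\<^sub>R ?e)) has_real_derivative
       (LBINT x. v x * partial k \<phi> (x + (- t) *\<^sub>R ?e)) * (-1)) (at t)"
      by (rule DERIV_chain2[where f="\<lambda>t. LBINT x. v x * \<phi> (x + t *\<^sub>R ?e)" and g=uminus,
            OF DERIV_integral_translate[OF v test_smooth[OF \<phi>] test_bounded[OF \<phi>]]])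
         (auto intro!: derivative_eq_intros)
    then show ?thesis unfolding shift[OF v] by simp
  qed
  have gk: "loc_int (\<lambda>x. g x $ k)" by (rule weak_gradient_loc_int[OF g])
  show "isCont (\<lambda>t. LBINT x. g (t *\<^sub>R axis k 1 + x) $ k * \<phi> x) t"
    using DERIV_isCont[OF der[OF gk]] by simp
  have p: "partial k (\<lambda>x. \<phi> ((- t) *\<^sub>R ?e + 1 *\<^sub>R x)) x = partial k \<phi> (x + (- t) *\<^sub>R ?e)" for x
    using partial_affine[where f=\<phi> and c=1 and y="(- t) *\<^sub>R ?e" and x=x] d by (simp add: add.commute)
  have "(LBINT x. u x * partial k \<phi> (x + (- t) *\<^sub>R ?e)) = - (LBINT x. g x $ k * \<phi> (x + (- t) *\<^sub>R ?e))"
    using weak_gradientD[OF g test_affine[OF \<phi>, of 1 "(- t) *\<^sub>R ?e"], of k] unfolding p by (simp add: add.commute)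
  then show "((\<lambda>t. LBINT x. u (t *\<^sub>R ?e + x) * \<phi> x) has_real_derivative
     (LBINT x. g (t *\<^sub>R axis k 1 + x) $ k * \<phi> x)) (at t)"
    using der[OF u, of t] shift[OF gk, of t] by simp
qed

text \<open>The fundamental theorem of calculus on segments, in weak form: it is applied to the
  smooth function of \<open>s\<close> obtained by pairing the shifted \<open>u\<close> with a test
  function. Fubini brings the average inside, and the fundamental lemma removes the test
  function.\<close>

lemma translate_eq_line_avg:
  assumes u: "loc_int u" and g: "is_L2_weak_gradient u g"
  shows "AE x in lborel. u (t *\<^sub>R axis k 1 + x) - u x - t * line_avg (\<lambda>x. g x $ k) (axis k 1) t x = 0"
proof (rule fundamental_lemma)
  let ?e = "axis k 1 :: R4"
  let ?A = "line_avg (\<lambda>x. g x $ k) ?e t"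
  have gk: "loc_int (\<lambda>x. g x $ k)" by (rule weak_gradient_loc_int[OF g])
  have A: "loc_int ?A" by (rule loc_int_line_avg[OF gk])
  have tA: "loc_int (\<lambda>x. t * ?A x)" using A by (auto simp: loc_int_def mult.left_commute)
  have ut: "loc_int (\<lambda>x. u (t *\<^sub>R ?e + x))" by (rule loc_int_translate(1)[OF u])
  show "loc_int (\<lambda>x. u (t *\<^sub>R ?e + x) - u x - t * ?A x)"
    by (intro loc_int_minus ut u tA)
  fix \<phi> assume \<phi>: "\<phi> \<in> test_functions"
  note [measurable] = test_measurable[OF \<phi>]
  obtain M where M: "\<And>x. \<bar>\<phi> x\<bar> \<le> M"
    using continuous_bounded_support_bounded[OF test_continuous[OF \<phi>] test_bounded[OF \<phi>]] by metis
  let ?H = "\<lambda>s. LBINT x. u ((s * t) *\<^sub>R ?e + x) * \<phi> x"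
  let ?h = "\<lambda>s. LBINT x. g ((s * t) *\<^sub>R ?e + x) $ k * \<phi> x"
  have der: "(?H has_real_derivative t * ?h s) (at s)" for s
  proof -
    have "(?H has_real_derivative ?h s * t) (at s)"
      by (rule DERIV_chain2[where f="\<lambda>t. LBINT x. u (t *\<^sub>R ?e + x) * \<phi> x" and g="\<lambda>s. s * t",
            OF has_derivative_translate_sobolev(1)[OF u g \<phi>, where k=k and t="s * t"]])
         (auto intro!: derivative_eq_intros)
    then show ?thesis by (simp add: mult.commute)
  qed
  have cont: "isCont (\<lambda>s. t * ?h s) s" for s
    using isCont_o2[of s "\<lambda>s. s * t", OF _ has_derivative_translate_sobolev(2)[OF u g \<phi>, where k=k and t="s * t"]]
    by (intro continuous_intros) auto
  have "(LBINT s. (t * ?h s) * indicator {0..1} s) = ?H 1 - ?H 0"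
    by (rule integral_FTC_Icc_real) (use der cont in auto)
  also have "(LBINT s. (t * ?h s) * indicator {0..1} s)
      = t * (LBINT s. LBINT x. indicator {0..1} s * (g ((s * t) *\<^sub>R ?e + x) $ k * \<phi> x))"
    by (simp add: mult.commute mult.left_commute flip: integral_mult_right_zero)
  also have "(LBINT s. LBINT x. indicator {0..1} s * (g ((s * t) *\<^sub>R ?e + x) $ k * \<phi> x))
     = (LBINT x. LBINT s. indicator {0..1} s * (g ((s * t) *\<^sub>R ?e + x) $ k * \<phi> x))"
    by (rule lborel_pair.Fubini_integral[symmetric, OF pair_integrable_translate[OF gk _ M test_bounded[OF \<phi>]]]) simp
  also have "\<dots> = (LBINT x. ?A x * \<phi> x)"
    by (simp flip: integral_mult_left_zero mult.assoc)
  finally have "t * (LBINT x. ?A x * \<phi> x) = (LBINT x. u (t *\<^sub>R ?e + x) * \<phi> x) - (LBINT x. u x * \<phi> x)" by simp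
  then show "(LBINT x. (u (t *\<^sub>R ?e + x) - u x - t * ?A x) * \<phi> x) = 0"
    using integrable_loc_int_test[OF ut \<phi>] integrable_loc_int_test[OF u \<phi>] integrable_loc_int_test[OF A \<phi>]
    by (simp add: left_diff_distrib mult.assoc)
qed

text \<open>The difference quotient is the average of the gradient component over a short segment,
  so its distance to that component is at most an average of L1 distances between the component and
  its small translates.\<close>

lemma difference_quotient_L1:
  assumes u: "loc_int u" and g: "is_L2_weak_gradient u g" and t: "t \<longlonglongrightarrow> 0" "\<And>n. t n \<noteq> 0"
  shows "(\<lambda>n. LBINT x. indicator (cube r) x * \<bar>(u (t n *\<^sub>R axis k 1 + x) - u x) / t n - g x $ k\<bar>) \<longlonglongrightarrow> 0"
proof -
  let ?e = "axis k 1 :: R4"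
  let ?g = "\<lambda>x. g x $ k"
  have gk: "loc_int ?g" by (rule weak_gradient_loc_int[OF g])
  then have [measurable]: "?g \<in> borel_measurable borel" by (simp add: loc_int_def)
  let ?d = "\<lambda>t s x. indicator (cube r) x * \<bar>?g ((s * t) *\<^sub>R ?e + x) - ?g x\<bar>"
  let ?\<omega> = "\<lambda>t s. LBINT x. ?d t s x"
  have I: "bounded {x. indicator (cube r) x \<noteq> (0::real)}" "\<And>x. \<bar>indicator (cube r) x :: real\<bar> \<le> 1"
    by (auto simp: indicator_def intro: bounded_subset[OF bounded_cbox[of "- (\<chi> i. r)" "\<chi> i. r"]])
  have pint: "integrable (lborel \<Otimes>\<^sub>M lborel) (\<lambda>(s, x). indicator {0..1} s * ?d t s x)" for t :: real
  proof -
    \<comment> \<open>The unshifted term is the case \<open>t = 0\<close> of the same integrability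
      lemma, hence the artificial \<open>s * 0\<close>.\<close>
    have "integrable (lborel \<Otimes>\<^sub>M lborel) (\<lambda>z. \<bar>(case z of (s, x) \<Rightarrow> indicator {0..1::real} s * (?g ((s * t) *\<^sub>R ?e + x) * indicator (cube r) x)) -
       (case z of (s, x) \<Rightarrow> indicator {0..1::real} s * (?g ((s * 0) *\<^sub>R ?e + x) * indicator (cube r) x))\<bar>)"
      by (intro integrable_abs Bochner_Integration.integrable_diff pair_integrable_translate[OF gk _ I(2) I(1)]) auto
    also have "(\<lambda>z. \<bar>(case z of (s, x) \<Rightarrow> indicator {0..1::real} s * (?g ((s * t) *\<^sub>R ?e + x) * indicator (cube r) x)) -
       (case z of (s, x) \<Rightarrow> indicator {0..1::real} s * (?g ((s * 0) *\<^sub>R ?e + x) * indicator (cube r) x))\<bar>)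
       = (\<lambda>(s, x). indicator {0..1} s * ?d t s x)"
      by (auto simp: indicator_def)
    finally show ?thesis .
  qed
  have bound: "(LBINT x. indicator (cube r) x * \<bar>(u (t *\<^sub>R ?e + x) - u x) / t - ?g x\<bar>)
     \<le> (LBINT s. indicator {0..1} s * ?\<omega> t s)" if "t \<noteq> 0" for t
  proof -
    have 1: "AE x in lborel. integrable lborel (\<lambda>s. indicator {0..1} s * ?d t s x)"
      by (rule lborel_pair.AE_integrable_snd[OF pint])
    have gint: "integrable (lborel \<Otimes>\<^sub>M lborel) (\<lambda>(s, x). indicator {0..1::real} s * (?g ((s * t) *\<^sub>R ?e + x) * indicator (cube r) x))"
      by (rule pair_integrable_translate[OF gk _ I(2) I(1)]) auto
    have 2: "AE x in lborel. integrable lborel (\<lambda>s. indicator {0..1::real} s * (?g ((s * t) *\<^sub>R ?e + x) * indicator (cube r) x))"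
      by (rule lborel_pair.AE_integrable_snd[OF gint])
    have "(LBINT x. indicator (cube r) x * \<bar>(u (t *\<^sub>R ?e + x) - u x) / t - ?g x\<bar>)
       \<le> (LBINT x. LBINT s. indicator {0..1} s * ?d t s x)"
    proof (rule integral_mono_AE')
      show "integrable lborel (\<lambda>x. LBINT s. indicator {0..1} s * ?d t s x)"
        by (rule lborel_pair.integrable_snd[OF pint])
      show "AE x in lborel. 0 \<le> (LBINT s. indicator {0..1} s * ?d t s x)"
        by (intro AE_I2 Bochner_Integration.integral_nonneg) simp
      show "AE x in lborel. indicator (cube r) x * \<bar>(u (t *\<^sub>R ?e + x) - u x) / t - ?g x\<bar>
         \<le> (LBINT s. indicator {0..1} s * ?d t s x)"
        using translate_eq_line_avg[OF u g, of t k] 1 2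
      proof eventually_elim
        case (elim x)
        show ?case
        proof (cases "x \<in> cube r")
          case True
          have q: "(u (t *\<^sub>R ?e + x) - u x) / t = line_avg ?g ?e t x"
            using elim(1) that by (simp add: field_simps)
          have i1: "integrable lborel (\<lambda>s. indicator {0..1} s * ?g ((s * t) *\<^sub>R ?e + x))" using elim(3) True by simp
          have i2: "integrable lborel (\<lambda>s. indicator {0..1::real} s * ?g x)"
            by (intro integrable_mult_left integrable_real_indicator) auto
          have "line_avg ?g ?e t x - ?g x = (LBINT s. indicator {0..1} s * ?g ((s * t) *\<^sub>R ?e + x)) - (LBINT s. indicator {0..1::real} s * ?g x)"
            by simp
          also have "\<dots> = (LBINT s. indicator {0..1} s * ?g ((s * t) *\<^sub>R ?e + x) - indicator {0..1::real} s * ?g x)"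
            by (rule Bochner_Integration.integral_diff[symmetric, OF i1 i2])
          finally have eq: "line_avg ?g ?e t x - ?g x = (LBINT s. indicator {0..1} s * ?g ((s * t) *\<^sub>R ?e + x) - indicator {0..1::real} s * ?g x)" .
          have "\<bar>line_avg ?g ?e t x - ?g x\<bar> \<le> (LBINT s. \<bar>indicator {0..1} s * ?g ((s * t) *\<^sub>R ?e + x) - indicator {0..1::real} s * ?g x\<bar>)"
            unfolding eq by (rule integral_abs_bound)
          also have "\<dots> = (LBINT s. indicator {0..1} s * ?d t s x)"
            using True by (simp add: abs_mult flip: right_diff_distrib)
          finally show ?thesis using True q by simp
        qed simp
      qed
    qed
    also have "\<dots> = (LBINT s. LBINT x. indicator {0..1} s * ?d t s x)"
      by (rule lborel_pair.Fubini_integral[OF pint])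
    finally show ?thesis by simp
  qed
  have lim: "(\<lambda>n. LBINT s. indicator {0..1} s * ?\<omega> (t n) s) \<longlonglongrightarrow> (LINT s|(lborel::real measure). 0)"
  proof -
    obtain T where T: "\<And>n. norm (t n) \<le> T" using convergent_imp_Bseq[OF convergentI[OF t(1)]] by (auto simp: Bseq_def)
    let ?C = "\<lambda>r. LBINT x. indicator (cube r) x * \<bar>?g x\<bar>"
    have \<omega>_le: "?\<omega> (t n) s \<le> ?C (r + T) + ?C r" if s: "s \<in> {0..1}" for n s
    proof -
      have "\<bar>s * t n\<bar> \<le> 1 * T" unfolding abs_mult using s T[of n] by (intro mult_mono) auto
      then have n: "norm ((s * t n) *\<^sub>R ?e) \<le> T" by simp
      have "?\<omega> (t n) s \<le> (LBINT x. indicator (cube r) x * \<bar>?g ((s * t n) *\<^sub>R ?e + x)\<bar> + indicator (cube r) x * \<bar>?g x\<bar>)"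
        by (intro integral_mono Bochner_Integration.integrable_add loc_int_abs loc_int_minus loc_int_translate(1) gk)
           (auto simp: indicator_def)
      also have "\<dots> = (LBINT x. indicator (cube r) x * \<bar>?g ((s * t n) *\<^sub>R ?e + x)\<bar>) + ?C r"
        by (intro Bochner_Integration.integral_add loc_int_abs loc_int_translate(1) gk)
      also have "\<dots> \<le> ?C (r + T) + ?C r" using loc_int_translate(2)[OF gk n] by simp
      finally show ?thesis .
    qed
    have \<omega>_nonneg: "0 \<le> ?\<omega> t s" for t s by (rule Bochner_Integration.integral_nonneg) simp
    show ?thesis
    proof (rule integral_dominated_convergence[where w="\<lambda>s. (?C (r + T) + ?C r) * indicator {0..1} s"])
      show "integrable lborel (\<lambda>s. (?C (r + T) + ?C r) * indicator {0..1::real} s)"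
        by (intro integrable_mult_right integrable_real_indicator) auto
      show "AE s in lborel. norm (indicator {0..1} s * ?\<omega> (t n) s) \<le> (?C (r + T) + ?C r) * indicator {0..1} s" for n
        using \<omega>_le[of _ n] \<omega>_nonneg[of "t n"] by (intro AE_I2) (auto simp: indicator_def)
      show "AE s in lborel. (\<lambda>n. indicator {0..1} s * ?\<omega> (t n) s) \<longlonglongrightarrow> 0"
      proof (intro AE_I2)
        fix s :: real
        have "(\<lambda>n. (s * t n) *\<^sub>R ?e) \<longlonglongrightarrow> (s * 0) *\<^sub>R ?e" by (intro tendsto_intros t)
        then have "(\<lambda>n. indicator {0..1} s * ?\<omega> (t n) s) \<longlonglongrightarrow> indicator {0..1} s * 0"
          by (intro tendsto_intros loc_int_trans_cont gk) simp
        then show "(\<lambda>n. indicator {0..1} s * ?\<omega> (t n) s) \<longlonglongrightarrow> 0" by simp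
      qed
      show "(\<lambda>s. indicator {0..1} s * ?\<omega> (t n) s) \<in> borel_measurable lborel" for n by measurable
    qed simp
  qed
  show ?thesis
  proof (rule tendsto_sandwich[OF always_eventually always_eventually tendsto_const])
    show "\<forall>n. 0 \<le> (LBINT x. indicator (cube r) x * \<bar>(u (t n *\<^sub>R ?e + x) - u x) / t n - ?g x\<bar>)"
      by (intro allI Bochner_Integration.integral_nonneg) simp
    show "(\<lambda>n. LBINT s. indicator {0..1} s * ?\<omega> (t n) s) \<longlonglongrightarrow> 0" using lim by simp
    show "\<forall>n. (LBINT x. indicator (cube r) x * \<bar>(u (t n *\<^sub>R ?e + x) - u x) / t n - ?g x\<bar>)
       \<le> (LBINT s. indicator {0..1} s * ?\<omega> (t n) s)" using bound t(2) by blast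
  qed
qed

text \<open>At \<open>a = 0\<close> one-sided quotients would give the absolute value of
  \<open>g\<close> up to sign; the symmetric quotient vanishes there, in agreement with
  \<open>sgn 0 = 0\<close>. Elsewhere the quotient is eventually constant, as \<open>a\<close> fixes
  both signs.\<close>

lemma abs_difference_quotient:
  fixes a g :: real assumes "t \<longlonglongrightarrow> 0" "\<And>n. t n > 0"
  shows "(\<lambda>n. (\<bar>a + t n * g\<bar> - \<bar>a - t n * g\<bar>) / (2 * t n)) \<longlonglongrightarrow> sgn a * g"
proof (rule tendsto_eventually)
  have "(\<lambda>n. t n * \<bar>g\<bar>) \<longlonglongrightarrow> 0 * \<bar>g\<bar>" by (intro tendsto_intros assms)
  then have "\<forall>\<^sub>F n in sequentially. a \<noteq> 0 \<longrightarrow> t n * \<bar>g\<bar> < \<bar>a\<bar>"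
    by (cases "a = 0") (auto dest!: order_tendstoD(2)[where a="\<bar>a\<bar>"])
  then show "\<forall>\<^sub>F n in sequentially. (\<bar>a + t n * g\<bar> - \<bar>a - t n * g\<bar>) / (2 * t n) = sgn a * g"
  proof eventually_elim
    case (elim n)
    have t: "t n > 0" by fact
    show ?case
    proof (cases "a = 0")
      case False
      then have "\<bar>t n * g\<bar> < \<bar>a\<bar>" using elim t by (simp add: abs_mult)
      then have "\<bar>a + t n * g\<bar> = sgn a * (a + t n * g)" "\<bar>a - t n * g\<bar> = sgn a * (a - t n * g)"
        by (auto simp: sgn_if)
      then have "\<bar>a + t n * g\<bar> - \<bar>a - t n * g\<bar> = 2 * t n * (sgn a * g)" by (simp add: algebra_simps)
      then show ?thesis using t by simp
    qed simp
  qed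
qed

lemma loc_int_abs_fun: "loc_int u \<Longrightarrow> loc_int (\<lambda>x. \<bar>u x\<bar>)"
  using loc_int_abs by (auto simp: loc_int_def)

text \<open>The symmetric difference quotient of \<open>\<bar>u\<bar>\<close> is compared in \<open>L\<^sup>1\<close> with the one of
  \<open>t \<mapsto> \<bar>u(x) + t g(x)\<bar>\<close>, which converges pointwise to \<open>sgn (u x) g(x)\<close>, also where \<open>u x = 0\<close>.\<close>

lemma weak_gradient_abs:
  assumes u: "loc_int u" and g: "is_L2_weak_gradient u g"
  shows "is_L2_weak_gradient (\<lambda>x. \<bar>u x\<bar>) (\<lambda>x. sgn (u x) *\<^sub>R g x)"
  unfolding is_L2_weak_gradient_def
proof (intro conjI ballI allI)
  have [measurable]: "u \<in> borel_measurable borel" "g \<in> borel_measurable borel"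
    using u g by (auto simp: loc_int_def is_L2_weak_gradient_def)
  show "(\<lambda>x. sgn (u x) *\<^sub>R g x) \<in> borel_measurable lborel" by measurable
  show "integrable lborel (\<lambda>x. (norm (sgn (u x) *\<^sub>R g x))\<^sup>2)"
    by (rule Bochner_Integration.integrable_bound[of _ "\<lambda>x. (norm (g x))\<^sup>2"])
       (use g in \<open>auto simp: is_L2_weak_gradient_def power_mult_distrib sgn_if\<close>)
  fix \<phi> and k :: 4 assume \<phi>: "\<phi> \<in> test_functions"
  note [measurable] = test_measurable[OF \<phi>]
  let ?e = "axis k 1 :: R4"
  let ?g = "\<lambda>x. g x $ k"
  have gk: "loc_int ?g" by (rule weak_gradient_loc_int[OF g])
  then have [measurable]: "?g \<in> borel_measurable borel" by (simp add: loc_int_def)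
  obtain M where M: "M > 0" "\<And>x. \<bar>\<phi> x\<bar> \<le> M"
    using continuous_bounded_support_bounded[OF test_continuous[OF \<phi>] test_bounded[OF \<phi>]] by metis
  obtain r where r: "{x. \<phi> x \<noteq> 0} \<subseteq> cube r" using bounded_subset_cube[OF test_bounded[OF \<phi>]] by blast
  have \<phi>M: "\<bar>\<phi> x\<bar> \<le> M * indicator (cube r) x" for x
    using M r by (cases "\<phi> x = 0") auto
  define t where "t n = inverse (real (Suc n))" for n
  have t: "t \<longlonglongrightarrow> 0" "\<And>n. t n > 0" unfolding t_def by (rule LIMSEQ_inverse_real_of_nat) simp
  have t0: "t n \<noteq> 0" for n using t(2)[of n] by simp
  let ?a = "\<lambda>x. \<bar>u x\<bar>"
  have a: "loc_int ?a" by (rule loc_int_abs_fun[OF u])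
  let ?L = "\<lambda>t. LBINT x. ?a x * \<phi> (x + t *\<^sub>R ?e)"
  let ?q = "\<lambda>n x. (?a (t n *\<^sub>R ?e + x) - ?a ((- t n) *\<^sub>R ?e + x)) / (2 * t n)"
  let ?r = "\<lambda>n x. (\<bar>u x + t n * ?g x\<bar> - \<bar>u x - t n * ?g x\<bar>) / (2 * t n)"
  have L_shift: "?L (- s) = (LBINT x. ?a (s *\<^sub>R ?e + x) * \<phi> x)" for s
    using integral_translate(1)[of "\<lambda>x. ?a x * \<phi> (x + (- s) *\<^sub>R ?e)" "s *\<^sub>R ?e"] by simp
  have at: "loc_int (\<lambda>x. ?a (s *\<^sub>R ?e + x))" for s by (rule loc_int_translate(1)[OF a])
  have atq: "integrable lborel (\<lambda>x. ?a (s *\<^sub>R ?e + x) * \<phi> x)" for s by (rule integrable_loc_int_test[OF at \<phi>])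
  \<comment> \<open>Shifting the test function forward amounts to shifting the absolute value of
    \<open>u\<close> backward, hence the minus sign.\<close>
  have Lq: "(?L (t n) - ?L (- t n)) / (2 * t n) = - (LBINT x. ?q n x * \<phi> x)" for n
  proof -
    have "(LBINT x. ?q n x * \<phi> x) = (LBINT x. (?a (t n *\<^sub>R ?e + x) * \<phi> x - ?a ((- t n) *\<^sub>R ?e + x) * \<phi> x) / (2 * t n))"
      by (intro Bochner_Integration.integral_cong) (simp_all add: algebra_simps)
    also have "\<dots> = (?L (- t n) - ?L (- (- t n))) / (2 * t n)"
      unfolding L_shift using atq[of "t n"] atq[of "- t n"] by simp
    finally have "(LBINT x. ?q n x * \<phi> x) = (?L (- t n) - ?L (t n)) / (2 * t n)" by simp
    then show ?thesis by (simp add: diff_divide_distrib)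
  qed
  have L_deriv: "(?L has_real_derivative (LBINT x. ?a x * partial k \<phi> x)) (at 0)"
    using DERIV_integral_translate[OF a test_smooth[OF \<phi>] test_bounded[OF \<phi>], of k 0] by simp
  have lim1: "(\<lambda>n. (?L (t n) - ?L (- t n)) / (2 * t n)) \<longlonglongrightarrow> (LBINT x. ?a x * partial k \<phi> x)"
  proof -
    have quot: "((\<lambda>h. (?L h - ?L 0) / h) \<longlongrightarrow> (LBINT x. ?a x * partial k \<phi> x)) (at 0)"
      using L_deriv by (simp add: DERIV_def)
    have "filterlim t (at 0) sequentially" using t(1) t0 by (simp add: filterlim_at)
    from filterlim_compose[OF quot this] have 1: "(\<lambda>n. (?L (t n) - ?L 0) / t n) \<longlonglongrightarrow> (LBINT x. ?a x * partial k \<phi> x)" .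
    have "filterlim (\<lambda>n. - t n) (at 0) sequentially"
      using tendsto_minus[OF t(1)] t0 by (simp add: filterlim_at)
    from filterlim_compose[OF quot this] have 2: "(\<lambda>n. (?L (- t n) - ?L 0) / (- t n)) \<longlonglongrightarrow> (LBINT x. ?a x * partial k \<phi> x)" .
    have eq: "((A - C) / s + (B - C) / (- s)) / 2 = (A - B) / (2 * s)" for A B C s :: real
      by (cases "s = 0") (auto simp: field_simps)
    have half: "(X + X) / 2 = X" for X :: real by simp
    have "(\<lambda>n. ((?L (t n) - ?L 0) / t n + (?L (- t n) - ?L 0) / (- t n)) / 2)
       \<longlonglongrightarrow> ((LBINT x. ?a x * partial k \<phi> x) + (LBINT x. ?a x * partial k \<phi> x)) / 2"
      by (intro tendsto_intros 1 2) simp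
    then show ?thesis unfolding eq half .
  qed
  have lim2: "(\<lambda>n. LBINT x. ?r n x * \<phi> x) \<longlonglongrightarrow> (LBINT x. (sgn (u x) * ?g x) * \<phi> x)"
  proof (rule integral_dominated_convergence[where w="\<lambda>x. \<bar>?g x * \<phi> x\<bar>"])
    show "integrable lborel (\<lambda>x. \<bar>?g x * \<phi> x\<bar>)" using integrable_loc_int_test[OF gk \<phi>] by simp
    show "AE x in lborel. (\<lambda>n. ?r n x * \<phi> x) \<longlonglongrightarrow> sgn (u x) * ?g x * \<phi> x"
      by (intro AE_I2 tendsto_mult tendsto_const abs_difference_quotient t)
    show "AE x in lborel. norm (?r n x * \<phi> x) \<le> \<bar>?g x * \<phi> x\<bar>" for n
    proof (rule AE_I2)
      fix x
      have "\<bar>\<bar>u x + t n * ?g x\<bar> - \<bar>u x - t n * ?g x\<bar>\<bar> \<le> \<bar>2 * t n * ?g x\<bar>"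
        using abs_triangle_ineq3[of "u x + t n * ?g x" "u x - t n * ?g x"] by simp
      then have "\<bar>?r n x\<bar> \<le> \<bar>?g x\<bar>" using t(2)[of n] by (simp add: abs_mult field_simps)
      then show "norm (?r n x * \<phi> x) \<le> \<bar>?g x * \<phi> x\<bar>" 
        unfolding real_norm_def abs_mult by (rule mult_right_mono) simp
    qed
  qed measurable
  let ?P = "\<lambda>s x. indicator (cube r) x * \<bar>(u (s *\<^sub>R ?e + x) - u x) / s - ?g x\<bar>"
  have Pint: "integrable lborel (?P s)" for s
  proof -
    have "loc_int (\<lambda>x. u (s *\<^sub>R ?e + x) - u x)" by (intro loc_int_minus loc_int_translate(1) u)
    then have "loc_int (\<lambda>x. (u (s *\<^sub>R ?e + x) - u x) / s)" by (auto simp: loc_int_def)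
    then show ?thesis by (intro loc_int_abs loc_int_minus gk)
  qed
  \<comment> \<open>The reverse triangle inequality removes the absolute values, so the error is
    controlled by the L1 errors of the quotients of \<open>u\<close> itself with steps
    \<open>t n\<close> and \<open>- t n\<close>.\<close>
  have diff: "\<bar>(LBINT x. ?q n x * \<phi> x) - (LBINT x. ?r n x * \<phi> x)\<bar>
      \<le> M / 2 * ((LBINT x. ?P (t n) x) + (LBINT x. ?P (- t n) x))" for n
  proof -
    have tn: "t n > 0" by (rule t)
    have rint: "integrable lborel (\<lambda>x. ?r n x * \<phi> x)"
    proof -
      have tg: "loc_int (\<lambda>x. c * ?g x)" for c using gk by (auto simp: loc_int_def mult.left_commute)
      have "loc_int (\<lambda>x. \<bar>u x - (- t n) * ?g x\<bar> - \<bar>u x - t n * ?g x\<bar>)"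
        by (intro loc_int_minus loc_int_abs_fun u tg)
      then have "loc_int (\<lambda>x. ?r n x)" by (auto simp: loc_int_def)
      then show ?thesis by (rule integrable_loc_int_test[OF _ \<phi>])
    qed
    have qint: "integrable lborel (\<lambda>x. ?q n x * \<phi> x)"
    proof -
      have "loc_int (\<lambda>x. ?a (t n *\<^sub>R ?e + x) - ?a ((- t n) *\<^sub>R ?e + x))" by (intro loc_int_minus at)
      then have "loc_int (?q n)" by (auto simp: loc_int_def)
      then show ?thesis by (rule integrable_loc_int_test[OF _ \<phi>])
    qed
    have "\<bar>(LBINT x. ?q n x * \<phi> x) - (LBINT x. ?r n x * \<phi> x)\<bar> = \<bar>LBINT x. ?q n x * \<phi> x - ?r n x * \<phi> x\<bar>"
      by (simp only: Bochner_Integration.integral_diff[OF qint rint])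
    also have "\<dots> \<le> (LBINT x. \<bar>?q n x * \<phi> x - ?r n x * \<phi> x\<bar>)" by (rule integral_abs_bound)
    also have "\<dots> \<le> (LBINT x. M / 2 * (?P (t n) x + ?P (- t n) x))"
    proof (rule integral_mono)
      show "integrable lborel (\<lambda>x. \<bar>?q n x * \<phi> x - ?r n x * \<phi> x\<bar>)" using qint rint by simp
      show "integrable lborel (\<lambda>x. M / 2 * (?P (t n) x + ?P (- t n) x))"
        by (intro integrable_mult_right Bochner_Integration.integrable_add Pint)
      fix x
      let ?p = "(u (t n *\<^sub>R ?e + x) - u x) / t n" and ?m = "(u ((- t n) *\<^sub>R ?e + x) - u x) / (- t n)"
      have e1: "u (t n *\<^sub>R ?e + x) - (u x + t n * ?g x) = t n * (?p - ?g x)" using tn by (simp add: field_simps)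
      have 1: "\<bar>?a (t n *\<^sub>R ?e + x) - \<bar>u x + t n * ?g x\<bar>\<bar> \<le> t n * \<bar>?p - ?g x\<bar>"
        using abs_triangle_ineq3[of "u (t n *\<^sub>R ?e + x)" "u x + t n * ?g x"] tn unfolding e1 by (simp add: abs_mult)
      have e2: "u ((- t n) *\<^sub>R ?e + x) - (u x - t n * ?g x) = - t n * (?m - ?g x)" using tn by (simp add: field_simps)
      have 2: "\<bar>?a ((- t n) *\<^sub>R ?e + x) - \<bar>u x - t n * ?g x\<bar>\<bar> \<le> t n * \<bar>?m - ?g x\<bar>"
        using abs_triangle_ineq3[of "u ((- t n) *\<^sub>R ?e + x)" "u x - t n * ?g x"] tn unfolding e2 by (simp add: abs_mult)
      have e3: "?q n x - ?r n x = ((?a (t n *\<^sub>R ?e + x) - \<bar>u x + t n * ?g x\<bar>) - (?a ((- t n) *\<^sub>R ?e + x) - \<bar>u x - t n * ?g x\<bar>)) / (2 * t n)"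
        by (simp add: diff_divide_distrib)
      have "\<bar>?q n x - ?r n x\<bar> \<le> (t n * \<bar>?p - ?g x\<bar> + t n * \<bar>?m - ?g x\<bar>) / \<bar>2 * t n\<bar>"
        unfolding e3 abs_divide using 1 2 by (intro divide_right_mono order_trans[OF abs_triangle_ineq4]) auto
      also have "\<dots> = (\<bar>?p - ?g x\<bar> + \<bar>?m - ?g x\<bar>) / 2" using tn by (simp add: field_simps)
      finally have qr: "\<bar>?q n x - ?r n x\<bar> \<le> (\<bar>?p - ?g x\<bar> + \<bar>?m - ?g x\<bar>) / 2" .
      have "\<bar>?q n x * \<phi> x - ?r n x * \<phi> x\<bar> = \<bar>?q n x - ?r n x\<bar> * \<bar>\<phi> x\<bar>"
        by (simp only: left_diff_distrib[symmetric] abs_mult)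
      also have "\<dots> \<le> (\<bar>?p - ?g x\<bar> + \<bar>?m - ?g x\<bar>) / 2 * (M * indicator (cube r) x)"
        by (intro mult_mono qr \<phi>M) auto
      also have "\<dots> = M / 2 * (?P (t n) x + ?P (- t n) x)" by (simp add: algebra_simps)
      finally show "\<bar>?q n x * \<phi> x - ?r n x * \<phi> x\<bar> \<le> M / 2 * (?P (t n) x + ?P (- t n) x)" .
    qed
    also have "\<dots> = M / 2 * ((LBINT x. ?P (t n) x) + (LBINT x. ?P (- t n) x))"
      by (simp only: integral_mult_right_zero Bochner_Integration.integral_add[OF Pint Pint])
    finally show ?thesis .
  qed
  have Plim: "(\<lambda>n. LBINT x. ?P (t n) x) \<longlonglongrightarrow> 0" "(\<lambda>n. LBINT x. ?P (- t n) x) \<longlonglongrightarrow> 0"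
    using difference_quotient_L1[OF u g t(1), of r k] difference_quotient_L1[OF u g, of "\<lambda>n. - t n" r k]
      t0 tendsto_minus[OF t(1)] by simp_all
  have "(\<lambda>n. M / 2 * ((LBINT x. ?P (t n) x) + (LBINT x. ?P (- t n) x))) \<longlonglongrightarrow> M / 2 * (0 + 0)"
    by (intro tendsto_intros Plim)
  then have "(\<lambda>n. M / 2 * ((LBINT x. ?P (t n) x) + (LBINT x. ?P (- t n) x))) \<longlonglongrightarrow> 0" by simp
  then have lim3: "(\<lambda>n. (LBINT x. ?q n x * \<phi> x) - (LBINT x. ?r n x * \<phi> x)) \<longlonglongrightarrow> 0"
    by (rule Lim_null_comparison[OF always_eventually, rotated]) (unfold real_norm_def, intro allI diff)
  have "(\<lambda>n. (LBINT x. ?q n x * \<phi> x)) \<longlonglongrightarrow> (LBINT x. (sgn (u x) * ?g x) * \<phi> x)"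
    using tendsto_add[OF lim3 lim2] by simp
  then have "(\<lambda>n. (?L (t n) - ?L (- t n)) / (2 * t n)) \<longlonglongrightarrow> - (LBINT x. (sgn (u x) * ?g x) * \<phi> x)"
    unfolding Lq by (rule tendsto_minus)
  from LIMSEQ_unique[OF lim1 this]
  show "(LBINT x. \<bar>u x\<bar> * partial k \<phi> x) = - (LBINT x. (sgn (u x) *\<^sub>R g x) $ k * \<phi> x)" by simp
qed

lemma D12_abs:
  assumes "u \<in> D12" shows "(\<lambda>x. \<bar>u x\<bar>) \<in> D12"
  using D12_measurable[OF assms] D12_integrable[OF assms]
  by (intro D12I[OF _ _ weak_gradient_abs[OF D12_loc_int weak_grad]] assms) auto

lemma dirichlet_abs_le:
  assumes "u \<in> D12" shows "dirichlet (\<lambda>x. \<bar>u x\<bar>) \<le> dirichlet u"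
proof -
  have "dirichlet (\<lambda>x. \<bar>u x\<bar>) = (LBINT x. (norm (sgn (u x) *\<^sub>R weak_grad u x))\<^sup>2)"
    by (intro dirichlet_eq weak_gradient_abs D12_loc_int weak_grad assms)
  also have "\<dots> \<le> dirichlet u" unfolding dirichlet_def
    by (intro integral_mono_AE' dirichlet_integrable assms AE_I2) (auto simp: sgn_if)
  finally show ?thesis .
qed

section \<open>The kernel of the Laplacian and strict positivity\<close>

abbreviation weight :: "R4 \<Rightarrow> real" where
  "weight x \<equiv> sqrt (1 + (norm x)\<^sup>2)"

lemma weight_ge_1: "1 \<le> weight x" and weight_pos: "0 < weight x"
proof -
  show "1 \<le> weight x" by (rule real_le_rsqrt) simp
  then show "0 < weight x" by linarith
qed

lemma inverse_weight_le_1: "inverse (weight x) \<le> 1"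
  using weight_ge_1[of x] by (simp add: inverse_le_1_iff)

lemma norm_le_weight: "norm x \<le> weight x"
  by (rule real_le_rsqrt) simp

lemma measure_cube: "0 \<le> r \<Longrightarrow> measure lborel (cube r) = (2 * r) ^ 4"
proof -
  assume "0 \<le> r"
  then have "(0 :: R4) \<in> cube r" by (simp add: mem_cube)
  then have "cube r \<noteq> {}" by blast
  from content_cbox_cart[OF this] show ?thesis by simp
qed

text \<open>A dyadic decomposition: outside \<open>cube (2 ^ (n - 1))\<close> the function is at
  most \<open>32 * (1 / 32) ^ n\<close>, while \<open>cube (2 ^ n)\<close> has volume
  \<open>16 * 16 ^ n\<close>, so the integrals form a geometric series of ratio 1/2. The exponent 5
  is the least integer above the dimension.\<close>

lemma integrable_weight_5: "integrable lborel (\<lambda>x. inverse (weight x) ^ 5)"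
proof -
  let ?f = "\<lambda>n x. 32 * (1 / 32) ^ n * indicator (cube (2 ^ n)) x :: real"
  have int: "integrable lborel (?f n)" for n
    by (intro integrable_mult_right integrable_indicator_cube)
  have norm_eq: "(LBINT x. norm (?f n x)) = 512 * (1 / 2) ^ n" for n
  proof -
    have "(LBINT x. norm (?f n x)) = (LBINT x. ?f n x)"
      by (intro Bochner_Integration.integral_cong) auto
    also have "\<dots> = 32 * (1 / 32) ^ n * (2 * 2 ^ n) ^ 4"
      by (simp add: measure_cube)
    also have "\<dots> = 512 * ((1 / 32) ^ n * (2 ^ n) ^ 4)" by (simp add: power_mult_distrib)
    also have "(2 ^ n :: real) ^ 4 = (2 ^ 4) ^ n" by (simp only: power_mult[symmetric] mult.commute)
    also have "(1 / 32 :: real) ^ n * (2 ^ 4) ^ n = (1 / 2) ^ n" by (simp flip: power_mult_distrib)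
    finally show ?thesis .
  qed
  have sum: "summable (\<lambda>n. LBINT x. norm (?f n x))"
    unfolding norm_eq by (intro summable_mult summable_geometric) simp
  have ptsum: "summable (\<lambda>n. norm (?f n x))" for x
    by (rule summable_comparison_test'[where g="\<lambda>n. 32 * (1 / 32) ^ n" and N=0])
       (auto simp: indicator_def intro!: summable_mult)
  have I: "integrable lborel (\<lambda>x. \<Sum>n. ?f n x)"
    using ptsum by (intro integrable_suminf int sum) simp
  show ?thesis
  proof (rule Bochner_Integration.integrable_bound[OF I])
    show "AE x in lborel. norm (inverse (weight x) ^ 5) \<le> norm (\<Sum>n. ?f n x)"
    proof (rule AE_I2)
      fix x
      have "\<exists>n. x \<in> cube (2 ^ n)"
      proof -
        obtain n where "norm x < 2 ^ n" using real_arch_pow[of 2 "norm x"] by auto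
        then show ?thesis using norm_le_cube less_imp_le by blast
      qed
      then obtain n where n: "x \<in> cube (2 ^ n)" "\<And>m. m < n \<Longrightarrow> x \<notin> cube (2 ^ m)"
        using exists_least_iff[of "\<lambda>n. x \<in> cube (2 ^ n)"] by blast
      have "inverse (weight x) ^ 5 \<le> 32 * (1 / 32) ^ n"
      proof (cases n)
        case 0
        have "inverse (weight x) ^ 5 \<le> 1" using inverse_weight_le_1 weight_pos
          by (intro power_le_one) (auto intro: less_imp_le)
        with 0 show ?thesis by simp
      next
        case (Suc m)
        then have "x \<notin> cube (2 ^ m)" using n(2) by simp
        then have "\<not> norm x \<le> 2 ^ m" using norm_le_cube by blast
        then have "2 ^ m \<le> norm x" by simp
        then have "2 ^ m \<le> weight x" using norm_le_weight order_trans by blast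
        then have "inverse (weight x) \<le> inverse (2 ^ m)" by (intro le_imp_inverse_le) auto
        then have "inverse (weight x) ^ 5 \<le> inverse (2 ^ m) ^ 5" using weight_pos[of x] by (intro power_mono) auto
        also have "\<dots> = inverse ((2 ^ 5) ^ m)" by (simp only: power_inverse power_mult[symmetric] mult.commute)
        also have "\<dots> = (1 / 32) ^ m" by (simp add: power_one_over inverse_eq_divide)
        also have "\<dots> = 32 * (1 / 32) ^ n" using Suc by simp
        finally show ?thesis .
      qed
      also have "\<dots> = ?f n x" using n by simp
      also have "\<dots> \<le> (\<Sum>n. ?f n x)"
      proof -
        have "(\<Sum>m\<in>{n}. ?f m x) \<le> (\<Sum>n. ?f n x)"
          by (rule sum_le_suminf[OF summable_norm_cancel[OF ptsum]]) auto
        then show ?thesis by (simp only: sum.insert[OF finite.emptyI] sum.empty empty_iff not_False_eq_True add_0_right)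
      qed
      finally show "norm (inverse (weight x) ^ 5) \<le> norm (\<Sum>n. ?f n x)"
        using weight_pos[of x] by simp
    qed
  qed measurable
qed

lemma integrable_weight_bound:
  assumes f: "f \<in> borel_measurable borel" and le: "\<And>x. \<bar>f x\<bar> \<le> C * inverse (weight x) ^ n" and n: "5 \<le> n"
  shows "integrable lborel f"
proof (rule Bochner_Integration.integrable_bound[of _ "\<lambda>x. C * inverse (weight x) ^ 5"])
  show "integrable lborel (\<lambda>x. C * inverse (weight x) ^ 5)"
    by (intro integrable_mult_right integrable_weight_5)
  show "AE x in lborel. norm (f x) \<le> norm (C * inverse (weight x) ^ 5)"
  proof (rule AE_I2)
    fix x
    have w: "0 < inverse (weight x)" using weight_pos by simp
    then have "0 \<le> C" using order_trans[OF abs_ge_zero le[of 0]] by simp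
    moreover have "inverse (weight x) ^ n \<le> inverse (weight x) ^ 5"
      using w by (intro power_decreasing n inverse_weight_le_1) auto
    ultimately have "C * inverse (weight x) ^ n \<le> C * inverse (weight x) ^ 5" by (intro mult_left_mono)
    with le[of x] show "norm (f x) \<le> norm (C * inverse (weight x) ^ 5)" by simp
  qed
qed (use f in simp)

text \<open>The pairing of L4 with its dual exponent, done by using 2ab \<le> a^2 + b^2 twice: once
  to replace the first power of \<open>w\<close> by its square, once more to reach the fourth power.
  The decay of order 4 is that of the second derivatives of the kernel below.\<close>

lemma integrable_D12_weight:
  assumes w: "w \<in> D12" shows "integrable lborel (\<lambda>x. \<bar>w x\<bar> * inverse (weight x) ^ 4)"
proof (rule Bochner_Integration.integrable_bound[of _ "\<lambda>x. w x ^ 4 + inverse (weight x) ^ 5"])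
  note [measurable] = D12_measurable[OF w]
  show "integrable lborel (\<lambda>x. w x ^ 4 + inverse (weight x) ^ 5)"
    by (intro Bochner_Integration.integrable_add D12_integrable w integrable_weight_5)
  show "(\<lambda>x. \<bar>w x\<bar> * inverse (weight x) ^ 4) \<in> borel_measurable lborel" by measurable
  show "AE x in lborel. norm (\<bar>w x\<bar> * inverse (weight x) ^ 4) \<le> norm (w x ^ 4 + inverse (weight x) ^ 5)"
  proof (rule AE_I2)
    fix x
    define i where "i = inverse (weight x)"
    have i: "0 < i" "i \<le> 1" using weight_pos inverse_weight_le_1 by (auto simp: i_def)
    have "2 * (\<bar>w x\<bar> * i) * 1 \<le> (w x)\<^sup>2 + i\<^sup>2" using sum_squares_bound[of "\<bar>w x\<bar>" i] by simp
    then have "2 * (\<bar>w x\<bar> * i) * i ^ 3 \<le> ((w x)\<^sup>2 + i\<^sup>2) * i ^ 3" using i by (intro mult_right_mono) auto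
    then have 1: "2 * (\<bar>w x\<bar> * i ^ 4) \<le> (w x)\<^sup>2 * i ^ 3 + i ^ 5" by (simp add: algebra_simps eval_nat_numeral)
    have "2 * (w x)\<^sup>2 * i ^ 3 \<le> ((w x)\<^sup>2)\<^sup>2 + (i ^ 3)\<^sup>2" by (rule sum_squares_bound)
    then have 2: "2 * ((w x)\<^sup>2 * i ^ 3) \<le> w x ^ 4 + i ^ 6" by (simp flip: power_mult)
    have "i ^ 6 \<le> i ^ 5" using i by (intro power_decreasing) auto
    moreover have "0 \<le> i ^ 5" "0 \<le> w x ^ 4" using i by auto
    ultimately have "\<bar>w x\<bar> * i ^ 4 \<le> w x ^ 4 + i ^ 5" using 1 2 by linarith
    then show "norm (\<bar>w x\<bar> * inverse (weight x) ^ 4) \<le> norm (w x ^ 4 + inverse (weight x) ^ 5)"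
      using i by (simp add: i_def[symmetric])
  qed
qed

lemma mult_le_add_squares: "(a :: real) * b \<le> a\<^sup>2 + b\<^sup>2"
proof -
  have "2 * (a * b) \<le> a\<^sup>2 + b\<^sup>2" using sum_squares_bound[of a b] by (simp add: mult.assoc)
  moreover have "0 \<le> a\<^sup>2 + b\<^sup>2" by simp
  ultimately show ?thesis by linarith
qed

text \<open>Extends the weak gradient identity to smooth functions with the decay of a first
  derivative of the kernel. Compact support is restored by cut-offs stretched by the factor
  \<open>inverse (c n)\<close>, and dominated convergence removes them on both sides.\<close>

lemma weak_gradient_decaying:
  assumes w: "w \<in> D12" and h: "\<And>n. C_k n h"
    and h_le: "\<And>x. \<bar>h x\<bar> \<le> C * inverse (weight x) ^ 3" and dh_le: "\<And>x. \<bar>partial k h x\<bar> \<le> C * inverse (weight x) ^ 4"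
  shows "(LBINT x. w x * partial k h x) = - (LBINT x. weak_grad w x $ k * h x)"
proof -
  let ?g = "\<lambda>x. weak_grad w x $ k"
  have gk: "loc_int ?g" by (rule weak_gradient_loc_int[OF weak_grad[OF w]])
  then have [measurable]: "?g \<in> borel_measurable borel" by (simp add: loc_int_def)
  note [measurable] = D12_measurable[OF w]
  have [measurable]: "h \<in> borel_measurable borel" "partial k h \<in> borel_measurable borel"
    using C_k_imp_continuous[OF h[of 0]] C_k_imp_continuous[of 0 "partial k h"] h[of "Suc 0"]
    by (auto intro: borel_measurable_continuous_onI)
  define \<zeta> where "\<zeta> = boxbump (- 1) 1 0"
  have \<zeta>: "\<zeta> \<in> test_functions" unfolding \<zeta>_def by (rule boxbump_test)
  \<comment> \<open>The stretched cut-offs tend to the constant \<open>\<zeta> 0\<close> rather than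
    to 1; this nonzero factor appears on both sides of the limit and cancels.\<close>
  have \<zeta>0: "\<zeta> 0 \<noteq> 0" unfolding \<zeta>_def boxbump_nonzero by (simp add: mem_box_cart)
  obtain M where M: "M > 0" "\<And>x. \<bar>\<zeta> x\<bar> \<le> M"
    using continuous_bounded_support_bounded[OF test_continuous[OF \<zeta>] test_bounded[OF \<zeta>]] by metis
  have d\<zeta>: "partial k \<zeta> \<in> test_functions" by (rule test_partial[OF \<zeta>])
  obtain M' where M': "M' > 0" "\<And>x. \<bar>partial k \<zeta> x\<bar> \<le> M'"
    using continuous_bounded_support_bounded[OF test_continuous[OF d\<zeta>] test_bounded[OF d\<zeta>]] by metis
  obtain r where r: "r > 0" "\<And>x. partial k \<zeta> x \<noteq> 0 \<Longrightarrow> norm x \<le> r"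
    using test_bounded[OF d\<zeta>] by (auto simp: bounded_pos)
  define c where "c n = inverse (real (Suc n))" for n
  have c: "c \<longlonglongrightarrow> 0" "\<And>n. c n > 0" "\<And>n. c n \<le> 1"
    unfolding c_def by (rule LIMSEQ_inverse_real_of_nat) (simp_all add: inverse_le_1_iff)
  define cut where "cut n x = \<zeta> (0 + c n *\<^sub>R x)" for n x
  have c0: "c n \<noteq> 0" for n using c(2)[of n] by simp
  have cut: "cut n \<in> test_functions" for n unfolding cut_def using test_affine[OF \<zeta> c0, of 0 n] by simp
  note [measurable] = test_measurable[OF cut] test_measurable[OF test_partial[OF cut]]
  have cutM: "\<bar>cut n x\<bar> \<le> M" for n x unfolding cut_def by (rule M)
  have cut_lim: "(\<lambda>n. cut n x) \<longlonglongrightarrow> \<zeta> 0" for x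
  proof -
    have "isCont \<zeta> 0" using test_continuous[OF \<zeta>] by (simp add: continuous_on_eq_continuous_at)
    moreover have "(\<lambda>n. 0 + c n *\<^sub>R x) \<longlonglongrightarrow> 0 + 0 *\<^sub>R x" by (intro tendsto_intros c)
    ultimately show ?thesis unfolding cut_def by (intro isCont_tendsto_compose[of 0 \<zeta>]) simp_all
  qed
  have dcut: "partial k (cut n) x = c n * partial k \<zeta> (0 + c n *\<^sub>R x)" for n x
    unfolding cut_def using test_smooth[OF \<zeta>, of "Suc 0"] by (intro partial_affine) simp
  have dcut_le: "\<bar>partial k (cut n) x\<bar> \<le> M' * c n" for n x
    unfolding dcut abs_mult using M'(2)[of "0 + c n *\<^sub>R x"] c(2)[of n] by (simp add: mult.commute)
  \<comment> \<open>Where the derivative of the cut-off is nonzero,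
    \<open>c n * norm x \<le> r\<close>. The factor \<open>c n\<close> is therefore worth one power
    of decay, uniformly in \<open>n\<close>, which supplies the dominating function.\<close>
  have dcut_le': "\<bar>partial k (cut n) x\<bar> \<le> M' * (1 + r) * inverse (weight x)" for n x
  proof (cases "partial k (cut n) x = 0")
    case True
    then show ?thesis using M' r weight_pos[of x] by simp
  next
    case False
    then have "norm (c n *\<^sub>R x) \<le> r" using r(2)[of "c n *\<^sub>R x"] by (simp add: dcut del: norm_scaleR)
    then have cr: "c n * norm x \<le> r" using c(2)[of n] by simp
    have "weight x \<le> 1 + norm x" by (rule real_le_lsqrt) (auto simp: power2_sum)
    then have "c n * weight x \<le> c n * (1 + norm x)" using c(2)[of n] by (intro mult_left_mono) auto
    also have "\<dots> \<le> 1 + r" using cr c(3)[of n] by (simp add: algebra_simps)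
    finally have "c n \<le> (1 + r) * inverse (weight x)" using weight_pos[of x] by (simp add: field_simps)
    then have "M' * c n \<le> M' * ((1 + r) * inverse (weight x))" using M' by (intro mult_left_mono) auto
    then show ?thesis using dcut_le[of n x] by (simp add: mult.assoc)
  qed
  have cuth: "(\<lambda>x. h x * cut n x) \<in> test_functions" for n by (rule test_mult[OF cut h])
  have dprod: "partial k (\<lambda>x. h x * cut n x) x = h x * partial k (cut n) x + partial k h x * cut n x" for n x
    using partial_eq[OF has_derivative_mult[OF has_derivative_C_k[OF h[of "Suc 0"]] has_derivative_C_k[OF test_smooth[OF cut[of n], of "Suc 0"]]], of k x]
    by (simp add: axis_def if_distrib if_distribR cong: if_cong)
  have C: "0 \<le> C" using order_trans[OF abs_ge_zero h_le[of 0]] by simp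
  define D where "D = C * (M + M' * (1 + r))"
  have "(\<lambda>n. LBINT x. w x * partial k (\<lambda>x. h x * cut n x) x) \<longlonglongrightarrow> (LBINT x. w x * (partial k h x * \<zeta> 0))"
  proof (rule integral_dominated_convergence[where w="\<lambda>x. D * (\<bar>w x\<bar> * inverse (weight x) ^ 4)"])
    show "integrable lborel (\<lambda>x. D * (\<bar>w x\<bar> * inverse (weight x) ^ 4))"
      by (intro integrable_mult_right integrable_D12_weight w)
    show "AE x in lborel. (\<lambda>n. w x * partial k (\<lambda>x. h x * cut n x) x) \<longlonglongrightarrow> w x * (partial k h x * \<zeta> 0)"
    proof (rule AE_I2)
      fix x
      have "(\<lambda>n. M' * c n) \<longlonglongrightarrow> M' * 0" by (intro tendsto_intros c)
      then have "(\<lambda>n. M' * c n) \<longlonglongrightarrow> 0" by simp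
      then have "(\<lambda>n. partial k (cut n) x) \<longlonglongrightarrow> 0"
        by (rule Lim_null_comparison[OF always_eventually, rotated]) (unfold real_norm_def, intro allI dcut_le)
      then have "(\<lambda>n. w x * (h x * partial k (cut n) x + partial k h x * cut n x)) \<longlonglongrightarrow> w x * (h x * 0 + partial k h x * \<zeta> 0)"
        by (intro tendsto_intros cut_lim)
      then show "(\<lambda>n. w x * partial k (\<lambda>x. h x * cut n x) x) \<longlonglongrightarrow> w x * (partial k h x * \<zeta> 0)"
        unfolding dprod by simp
    qed
    show "AE x in lborel. norm (w x * partial k (\<lambda>x. h x * cut n x) x) \<le> D * (\<bar>w x\<bar> * inverse (weight x) ^ 4)" for n
    proof (rule AE_I2)
      fix x
      let ?i = "inverse (weight x)"
      have i: "0 < ?i" using weight_pos by simp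
      have "\<bar>h x * partial k (cut n) x\<bar> \<le> (C * ?i ^ 3) * (M' * (1 + r) * ?i)"
        unfolding abs_mult using i C by (intro mult_mono h_le dcut_le') auto
      moreover have "\<bar>partial k h x * cut n x\<bar> \<le> (C * ?i ^ 4) * M"
        unfolding abs_mult using i C by (intro mult_mono dh_le cutM) auto
      ultimately have "\<bar>partial k (\<lambda>x. h x * cut n x) x\<bar> \<le> (C * ?i ^ 3) * (M' * (1 + r) * ?i) + (C * ?i ^ 4) * M"
        unfolding dprod by linarith
      also have "\<dots> = D * ?i ^ 4" by (simp add: D_def algebra_simps power4_eq_xxxx power3_eq_cube)
      finally have "\<bar>w x\<bar> * \<bar>partial k (\<lambda>x. h x * cut n x) x\<bar> \<le> \<bar>w x\<bar> * (D * ?i ^ 4)" by (intro mult_left_mono) auto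
      then show "norm (w x * partial k (\<lambda>x. h x * cut n x) x) \<le> D * (\<bar>w x\<bar> * inverse (weight x) ^ 4)"
        by (simp add: abs_mult mult_ac)
    qed
    show "(\<lambda>x. w x * partial k (\<lambda>x. h x * cut n x) x) \<in> borel_measurable lborel" for n
      unfolding dprod by measurable
  qed measurable
  \<comment> \<open>On this side both factors are square integrable, the gradient by assumption and
    \<open>h\<close> because its square decays with order 6.\<close>
  moreover have "(\<lambda>n. - (LBINT x. ?g x * (h x * cut n x))) \<longlonglongrightarrow> - (LBINT x. ?g x * (h x * \<zeta> 0))"
  proof (intro tendsto_minus integral_dominated_convergence[where w="\<lambda>x. M * (norm (weak_grad w x))\<^sup>2 + M * C\<^sup>2 * inverse (weight x) ^ 6"])
    have "integrable lborel (\<lambda>x. inverse (weight x) ^ 6)"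
      by (rule integrable_weight_bound[of _ 1 6]) auto
    then show "integrable lborel (\<lambda>x. M * (norm (weak_grad w x))\<^sup>2 + M * C\<^sup>2 * inverse (weight x) ^ 6)"
      by (intro Bochner_Integration.integrable_add integrable_mult_right dirichlet_integrable w)
    show "AE x in lborel. (\<lambda>n. ?g x * (h x * cut n x)) \<longlonglongrightarrow> ?g x * (h x * \<zeta> 0)"
      by (intro AE_I2 tendsto_intros cut_lim)
    show "AE x in lborel. norm (?g x * (h x * cut n x)) \<le> M * (norm (weak_grad w x))\<^sup>2 + M * C\<^sup>2 * inverse (weight x) ^ 6" for n
    proof (rule AE_I2)
      fix x
      let ?i = "inverse (weight x)"
      have "\<bar>?g x * (h x * cut n x)\<bar> \<le> norm (weak_grad w x) * ((C * ?i ^ 3) * M)"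
        unfolding abs_mult using C weight_pos[of x]
        by (intro mult_mono component_le_norm_cart h_le cutM) auto
      also have "\<dots> = M * (norm (weak_grad w x) * (C * ?i ^ 3))" by simp
      also have "\<dots> \<le> M * ((norm (weak_grad w x))\<^sup>2 + (C * ?i ^ 3)\<^sup>2)"
        using M(1) by (intro mult_left_mono mult_le_add_squares) auto
      finally show "norm (?g x * (h x * cut n x)) \<le> M * (norm (weak_grad w x))\<^sup>2 + M * C\<^sup>2 * ?i ^ 6"
        by (simp add: power_mult_distrib algebra_simps flip: power_mult)
    qed
  qed measurable
  moreover have "(LBINT x. w x * partial k (\<lambda>x. h x * cut n x) x) = - (LBINT x. ?g x * (h x * cut n x))" for n
    by (rule weak_gradientD[OF weak_grad[OF w] cuth])
  ultimately have "(LBINT x. w x * (partial k h x * \<zeta> 0)) = - (LBINT x. ?g x * (h x * \<zeta> 0))"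
    by (simp add: LIMSEQ_unique)
  then have "(LBINT x. w x * partial k h x) * \<zeta> 0 = (- (LBINT x. ?g x * h x)) * \<zeta> 0"
    by (simp flip: mult.assoc)
  then show ?thesis using \<zeta>0 by (rule mult_right_cancel[THEN iffD1, rotated])
qed

text \<open>\<open>Gam \<delta>\<close> regularises the fundamental solution \<open>\<bar>x\<bar>\<^sup>-\<^sup>2\<close> of the Laplacian of \<open>\<real>\<^sup>4\<close>, and
  \<open>- \<Delta> (Gam \<delta>) = 8 \<delta>\<^sup>2 (\<bar>x\<bar>\<^sup>2 + \<delta>\<^sup>2)\<^sup>-\<^sup>3\<close> is a rescaled fixed bump.\<close>

definition Gam :: "real \<Rightarrow> R4 \<Rightarrow> real" where
  "Gam \<delta> x = inverse ((norm x)\<^sup>2 + \<delta>\<^sup>2)"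

text \<open>This is \<open>- \<Delta> (Gam 1)\<close>. It is positive everywhere, and its decay of
  order 6 makes it integrable.\<close>

definition bump :: "R4 \<Rightarrow> real" where
  "bump x = 8 * inverse (1 + (norm x)\<^sup>2) ^ 3"

lemma norm_sq_cart: "(norm (x :: R4))\<^sup>2 = (\<Sum>i\<in>UNIV. (x $ i)\<^sup>2)"
  unfolding norm_vec_def L2_set_def by (simp add: sum_nonneg)

context
  fixes \<delta> :: real
  assumes \<delta>: "0 < \<delta>" "\<delta> \<le> 1"
begin

lemma denom_pos: "0 < (norm (x :: R4))\<^sup>2 + \<delta>\<^sup>2"
  using \<delta> by (intro add_nonneg_pos) auto

lemma Gam_pos: "0 < Gam \<delta> x"
  using denom_pos by (simp add: Gam_def)

lemma C_k_Gam: "C_k n (Gam \<delta>)"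
proof -
  have "C_k n (\<lambda>x. (\<Sum>i\<in>UNIV. (x $ i)\<^sup>2) + \<delta>\<^sup>2)"
    unfolding power2_eq_square by (intro C_k_add C_k_sum C_k_mult C_k_coord C_k_const)
  then have "C_k n (\<lambda>x. inverse ((\<Sum>i\<in>UNIV. (x $ i)\<^sup>2) + \<delta>\<^sup>2))"
  proof (rule C_k_inverse)
    show "(\<Sum>i\<in>UNIV. (x $ i)\<^sup>2) + \<delta>\<^sup>2 \<noteq> 0" for x :: R4
      using denom_pos[of x] unfolding norm_sq_cart by linarith
  qed
  then show ?thesis unfolding Gam_def[abs_def] norm_sq_cart .
qed

lemma has_derivative_Gam:
  "(Gam \<delta> has_derivative (\<lambda>v. - (2 * (x \<bullet> v)) * (Gam \<delta> x)\<^sup>2)) (at x)"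
proof -
  have "((\<lambda>x. inverse (x \<bullet> x + \<delta>\<^sup>2)) has_derivative
      (\<lambda>v. - (2 * (x \<bullet> v)) * (inverse (x \<bullet> x + \<delta>\<^sup>2))\<^sup>2)) (at x)"
    using denom_pos[of x] unfolding power2_norm_eq_inner
    by (auto intro!: derivative_eq_intros simp: inner_commute power2_eq_square algebra_simps)
  then show ?thesis unfolding Gam_def[abs_def] power2_norm_eq_inner .
qed

lemma partial_Gam: "partial k (Gam \<delta>) = (\<lambda>x. - 2 * x $ k * (Gam \<delta> x)\<^sup>2)"
  using partial_eq[OF has_derivative_Gam, of k] by (auto simp: inner_axis)

lemma partial_partial_Gam:
  "partial j (partial k (Gam \<delta>)) x = (if j = k then - 2 * (Gam \<delta> x)\<^sup>2 else 0) + 8 * x $ k * x $ j * Gam \<delta> x ^ 3"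
proof -
  have c: "((\<lambda>x::R4. x $ k) has_derivative (\<lambda>v. v $ k)) (at x)"
    by (rule bounded_linear_imp_has_derivative[OF bounded_linear_vec_nth])
  have "((\<lambda>x. - 2 * x $ k * (Gam \<delta> x)\<^sup>2) has_derivative
     (\<lambda>v. - 2 * v $ k * (Gam \<delta> x)\<^sup>2 + - 2 * x $ k * (2 * (- (2 * (x \<bullet> v)) * (Gam \<delta> x)\<^sup>2) * Gam \<delta> x))) (at x)"
    by (rule derivative_eq_intros c has_derivative_Gam refl | simp)+
  from partial_eq[OF this, of j] show ?thesis
    unfolding partial_Gam by (simp add: inner_axis power2_eq_square power3_eq_cube) (simp add: axis_def)
qed

text \<open>The four diagonal terms add up to \<open>- 8 * (Gam \<delta> x)\<^sup>2\<close>. Since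
  \<open>(norm x)\<^sup>2 * Gam \<delta> x = 1 - \<delta>\<^sup>2 * Gam \<delta> x\<close>, the
  quadratic terms cancel exactly in dimension 4, and only the contribution of \<delta>
  remains.\<close>

lemma Laplacian_Gam: "(\<Sum>k\<in>UNIV. partial k (partial k (Gam \<delta>)) x) = - 8 * \<delta>\<^sup>2 * Gam \<delta> x ^ 3"
proof -
  have "(\<Sum>k\<in>UNIV. partial k (partial k (Gam \<delta>)) x) = - 8 * (Gam \<delta> x)\<^sup>2 + 8 * (\<Sum>k\<in>UNIV. (x $ k)\<^sup>2) * Gam \<delta> x ^ 3"
    unfolding partial_partial_Gam by (simp add: sum.distrib sum_subtractf sum_distrib_left sum_distrib_right power2_eq_square mult.assoc)
  also have "(\<Sum>k\<in>UNIV. (x $ k)\<^sup>2) = ((norm x)\<^sup>2 + \<delta>\<^sup>2) - \<delta>\<^sup>2" by (simp add: norm_sq_cart)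
  also have "8 * (((norm x)\<^sup>2 + \<delta>\<^sup>2) - \<delta>\<^sup>2) * Gam \<delta> x ^ 3 = 8 * ((((norm x)\<^sup>2 + \<delta>\<^sup>2) * Gam \<delta> x) * (Gam \<delta> x)\<^sup>2) - 8 * \<delta>\<^sup>2 * Gam \<delta> x ^ 3"
    by (simp add: algebra_simps power2_eq_square power3_eq_cube)
  also have "((norm x)\<^sup>2 + \<delta>\<^sup>2) * Gam \<delta> x = 1"
    unfolding Gam_def by (rule right_inverse[OF less_imp_neq[OF denom_pos, symmetric]])
  finally show ?thesis by simp
qed

lemma Gam_le: "Gam \<delta> x \<le> inverse (\<delta>\<^sup>2) * inverse (weight x) ^ 2"
proof -
  have "\<delta>\<^sup>2 * (1 + (norm x)\<^sup>2) \<le> (norm x)\<^sup>2 + \<delta>\<^sup>2"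
    using \<delta> mult_right_mono[of "\<delta>\<^sup>2" 1 "(norm x)\<^sup>2"] by (simp add: power_le_one distrib_left)
  then have "Gam \<delta> x \<le> inverse (\<delta>\<^sup>2 * (1 + (norm x)\<^sup>2))"
    unfolding Gam_def using \<delta> by (intro le_imp_inverse_le mult_pos_pos) (auto intro: add_pos_nonneg)
  then show ?thesis by (simp add: power_inverse)
qed

lemma Gam_power_le: "Gam \<delta> x ^ n \<le> inverse (\<delta>\<^sup>2) ^ n * inverse (weight x) ^ (2 * n)"
  using power_mono[OF Gam_le[of x], of n] Gam_pos[of x] by (simp add: power_mult_distrib power_mult)

lemma coord_le_weight: "\<bar>x $ k\<bar> \<le> weight x"
  using component_le_norm_cart[of x k] norm_le_weight[of x] by linarith

text \<open>Each coordinate factor consumes one power of decay; this is used once for the first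
  derivatives of the kernel and twice for the second ones.\<close>

lemma coord_weight: "\<bar>x $ k\<bar> * inverse (weight x) ^ Suc n \<le> inverse (weight x) ^ n"
proof -
  have "\<bar>x $ k\<bar> * inverse (weight x) \<le> 1"
    using coord_le_weight[of x k] weight_pos[of x] by (simp add: field_simps)
  from mult_right_mono[OF this, of "inverse (weight x) ^ n"] weight_pos[of x]
  show ?thesis by (simp add: mult.assoc)
qed

text \<open>The constant 10 is the 2 + 8 of the second derivatives; it is shared with the first
  derivatives because \<open>weak_gradient_decaying\<close> asks for one constant. The bound
  \<delta> \<le> 1 allows lower powers of \<open>inverse (\<delta>\<^sup>2)\<close> to be raised to
  the third.\<close>

lemma partial_Gam_le: "\<bar>partial k (Gam \<delta>) x\<bar> \<le> (10 * inverse (\<delta>\<^sup>2) ^ 3) * inverse (weight x) ^ 3"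
proof -
  have d1: "1 \<le> inverse (\<delta>\<^sup>2)" using \<delta> by (simp add: one_le_inverse power_le_one)
  then have d: "inverse (\<delta>\<^sup>2) ^ 2 \<le> inverse (\<delta>\<^sup>2) ^ 3" by (intro power_increasing) auto
  have "\<bar>partial k (Gam \<delta>) x\<bar> = 2 * (\<bar>x $ k\<bar> * (Gam \<delta> x)\<^sup>2)"
    unfolding partial_Gam by (simp add: abs_mult)
  also have "\<dots> \<le> 2 * (\<bar>x $ k\<bar> * (inverse (\<delta>\<^sup>2) ^ 2 * inverse (weight x) ^ (2 * 2)))"
    by (intro mult_left_mono Gam_power_le) auto
  also have "\<dots> = 2 * inverse (\<delta>\<^sup>2) ^ 2 * (\<bar>x $ k\<bar> * inverse (weight x) ^ Suc 3)" by (simp add: algebra_simps)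
  also have "\<dots> \<le> 10 * inverse (\<delta>\<^sup>2) ^ 3 * inverse (weight x) ^ 3"
    using d d1 weight_pos[of x] by (intro mult_mono coord_weight) auto
  finally show ?thesis .
qed

lemma partial_partial_Gam_le: "\<bar>partial k (partial k (Gam \<delta>)) x\<bar> \<le> (10 * inverse (\<delta>\<^sup>2) ^ 3) * inverse (weight x) ^ 4"
proof -
  have d1: "1 \<le> inverse (\<delta>\<^sup>2)" using \<delta> by (simp add: one_le_inverse power_le_one)
  then have d: "inverse (\<delta>\<^sup>2) ^ 2 \<le> inverse (\<delta>\<^sup>2) ^ 3" by (intro power_increasing) auto
  have i: "0 < inverse (weight x)" using weight_pos by simp
  have "\<bar>x $ k\<bar> * (\<bar>x $ k\<bar> * inverse (weight x) ^ Suc 5) \<le> \<bar>x $ k\<bar> * inverse (weight x) ^ Suc 4"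
    using coord_weight[of x k 5] by (intro mult_left_mono) auto
  also have "\<dots> \<le> inverse (weight x) ^ 4" by (rule coord_weight)
  finally have c: "\<bar>x $ k\<bar> * (\<bar>x $ k\<bar> * inverse (weight x) ^ 6) \<le> inverse (weight x) ^ 4" by simp
  have "\<bar>8 * x $ k * x $ k * Gam \<delta> x ^ 3\<bar> = 8 * (\<bar>x $ k\<bar> * (\<bar>x $ k\<bar> * Gam \<delta> x ^ 3))"
    using Gam_pos[of x] by (simp add: abs_mult)
  also have "\<dots> \<le> 8 * (\<bar>x $ k\<bar> * (\<bar>x $ k\<bar> * (inverse (\<delta>\<^sup>2) ^ 3 * inverse (weight x) ^ (2 * 3))))"
    by (intro mult_left_mono Gam_power_le) auto
  also have "\<dots> = 8 * inverse (\<delta>\<^sup>2) ^ 3 * (\<bar>x $ k\<bar> * (\<bar>x $ k\<bar> * inverse (weight x) ^ 6))" by (simp add: algebra_simps)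
  also have "\<dots> \<le> 8 * inverse (\<delta>\<^sup>2) ^ 3 * inverse (weight x) ^ 4"
    by (intro mult_left_mono c) auto
  finally have 1: "\<bar>8 * x $ k * x $ k * Gam \<delta> x ^ 3\<bar> \<le> 8 * inverse (\<delta>\<^sup>2) ^ 3 * inverse (weight x) ^ 4" .
  have "(Gam \<delta> x)\<^sup>2 \<le> inverse (\<delta>\<^sup>2) ^ 2 * inverse (weight x) ^ (2 * 2)" by (rule Gam_power_le)
  also have "\<dots> \<le> inverse (\<delta>\<^sup>2) ^ 3 * inverse (weight x) ^ 4" using d i by (simp add: mult_right_mono)
  finally have 2: "(Gam \<delta> x)\<^sup>2 \<le> inverse (\<delta>\<^sup>2) ^ 3 * inverse (weight x) ^ 4" .
  have "\<bar>- 2 * (Gam \<delta> x)\<^sup>2 + 8 * x $ k * x $ k * Gam \<delta> x ^ 3\<bar> \<le> 2 * (Gam \<delta> x)\<^sup>2 + \<bar>8 * x $ k * x $ k * Gam \<delta> x ^ 3\<bar>"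
    by (rule order_trans[OF abs_triangle_ineq]) simp
  also have "\<dots> \<le> 10 * (inverse (\<delta>\<^sup>2) ^ 3 * inverse (weight x) ^ 4)" using 1 2 by linarith
  finally show ?thesis unfolding partial_partial_Gam by (simp only: simp_thms if_True mult.assoc)
qed

lemma weak_gradient_Gam: "is_L2_weak_gradient (Gam \<delta>) (\<lambda>x. \<chi> k. partial k (Gam \<delta>) x)"
  unfolding is_L2_weak_gradient_def
proof (intro conjI ballI allI)
  have pc: "continuous_on UNIV (partial k (Gam \<delta>))" for k
    using C_k_Gam[of "Suc 0"] by simp
  then have "continuous_on UNIV (\<lambda>x. \<chi> k. partial k (Gam \<delta>) x)" by (intro continuous_intros)
  then show m: "(\<lambda>x. \<chi> k. partial k (Gam \<delta>) x) \<in> borel_measurable lborel"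
    by (simp add: borel_measurable_continuous_onI)
  show "integrable lborel (\<lambda>x. (norm (\<chi> k. partial k (Gam \<delta>) x))\<^sup>2)"
    unfolding norm_sq_cart vec_lambda_beta
  proof (intro Bochner_Integration.integrable_sum integrable_weight_bound)
    fix k :: 4
    show "(\<lambda>x. (partial k (Gam \<delta>) x)\<^sup>2) \<in> borel_measurable borel"
      using pc[of k] by (intro borel_measurable_power borel_measurable_continuous_onI)
    show "\<bar>(partial k (Gam \<delta>) x)\<^sup>2\<bar> \<le> (10 * inverse (\<delta>\<^sup>2) ^ 3)\<^sup>2 * inverse (weight x) ^ 6" for x
      using power_mono[OF partial_Gam_le[of k x] abs_ge_zero, of 2] by (simp add: power_mult_distrib flip: power_mult)
  qed simp
  fix \<phi> k assume "\<phi> \<in> test_functions"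
  then show "(LBINT x. Gam \<delta> x * partial k \<phi> x) = - (LBINT x. (\<chi> k. partial k (Gam \<delta>) x) $ k * \<phi> x)"
    using integration_by_parts[OF C_k_Gam] by simp
qed

lemma Gam_measurable [measurable]: "Gam \<delta> \<in> borel_measurable borel"
  using C_k_imp_continuous[OF C_k_Gam] by (rule borel_measurable_continuous_onI)

lemma D12_Gam: "Gam \<delta> \<in> D12"
proof (rule D12I[OF Gam_measurable _ weak_gradient_Gam])
  show "integrable lborel (\<lambda>x. Gam \<delta> x ^ 4)"
    by (rule integrable_weight_bound[where n=8 and C="inverse (\<delta>\<^sup>2) ^ 4"])
       (use Gam_power_le[of _ 4] Gam_pos in \<open>auto simp: less_imp_le\<close>)
qed

text \<open>The gradient is moved from \<open>w\<close> to the kernel, whose Laplacian is explicit.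
  After the substitution x = \<delta> z the Jacobian \<open>\<delta> ^ 4\<close> and the factor
  \<open>\<delta>\<^sup>2\<close> exactly cancel the power \<open>\<delta> ^ 6\<close> in the
  denominator, so the averaging profile does not depend on \<delta>.\<close>

lemma dform_Gam:
  assumes w: "w \<in> D12"
  shows "dform w (Gam \<delta>) = (LBINT z. w (\<delta> *\<^sub>R z) * bump z)"
proof -
  note [measurable] = D12_measurable[OF w] weak_grad_measurable[OF w]
  let ?G = "\<lambda>x. \<chi> k. partial k (Gam \<delta>) x"
  have smooth: "C_k n (partial k (Gam \<delta>))" for n k using C_k_Gam[of "Suc n"] by simp
  have cont: "continuous_on UNIV (partial k (Gam \<delta>))" "continuous_on UNIV (partial k (partial k (Gam \<delta>)))" for k
    using C_k_imp_continuous[OF smooth[of 0 k]] smooth[of "Suc 0" k] by auto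
  note [measurable] = borel_measurable_continuous_onI[OF cont(1)] borel_measurable_continuous_onI[OF cont(2)]
  have Gm[measurable]: "?G \<in> borel_measurable borel" using weak_gradient_Gam by (simp add: is_L2_weak_gradient_def)
  have int1: "integrable lborel (\<lambda>x. weak_grad w x $ k * partial k (Gam \<delta>) x)" for k
  proof (rule Bochner_Integration.integrable_bound[of _ "\<lambda>x. (norm (weak_grad w x))\<^sup>2 + (norm (?G x))\<^sup>2"])
    show "integrable lborel (\<lambda>x. (norm (weak_grad w x))\<^sup>2 + (norm (?G x))\<^sup>2)"
      using weak_gradient_Gam by (intro Bochner_Integration.integrable_add dirichlet_integrable w) (simp add: is_L2_weak_gradient_def)
    show "(\<lambda>x. weak_grad w x $ k * partial k (Gam \<delta>) x) \<in> borel_measurable lborel"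
      using measurable_vec_nth[of "weak_grad w" k] by simp
    show "AE x in lborel. norm (weak_grad w x $ k * partial k (Gam \<delta>) x) \<le> norm ((norm (weak_grad w x))\<^sup>2 + (norm (?G x))\<^sup>2)"
    proof (rule AE_I2)
      fix x
      have "\<bar>weak_grad w x $ k\<bar> * \<bar>?G x $ k\<bar> \<le> norm (weak_grad w x) * norm (?G x)"
        by (intro mult_mono component_le_norm_cart) auto
      also have "\<dots> \<le> (norm (weak_grad w x))\<^sup>2 + (norm (?G x))\<^sup>2" by (rule mult_le_add_squares)
      finally show "norm (weak_grad w x $ k * partial k (Gam \<delta>) x) \<le> norm ((norm (weak_grad w x))\<^sup>2 + (norm (?G x))\<^sup>2)"
        by (simp add: abs_mult)
    qed
  qed
  have int2: "integrable lborel (\<lambda>x. w x * partial k (partial k (Gam \<delta>)) x)" for k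
  proof (rule Bochner_Integration.integrable_bound[of _ "\<lambda>x. (10 * inverse (\<delta>\<^sup>2) ^ 3) * (\<bar>w x\<bar> * inverse (weight x) ^ 4)"])
    show "integrable lborel (\<lambda>x. (10 * inverse (\<delta>\<^sup>2) ^ 3) * (\<bar>w x\<bar> * inverse (weight x) ^ 4))"
      by (intro integrable_mult_right integrable_D12_weight w)
    show "AE x in lborel. norm (w x * partial k (partial k (Gam \<delta>)) x) \<le> norm ((10 * inverse (\<delta>\<^sup>2) ^ 3) * (\<bar>w x\<bar> * inverse (weight x) ^ 4))"
    proof (rule AE_I2)
      fix x
      have "\<bar>w x\<bar> * \<bar>partial k (partial k (Gam \<delta>)) x\<bar> \<le> \<bar>w x\<bar> * ((10 * inverse (\<delta>\<^sup>2) ^ 3) * inverse (weight x) ^ 4)"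
        by (intro mult_left_mono partial_partial_Gam_le) auto
      then show "norm (w x * partial k (partial k (Gam \<delta>)) x) \<le> norm ((10 * inverse (\<delta>\<^sup>2) ^ 3) * (\<bar>w x\<bar> * inverse (weight x) ^ 4))"
        using weight_pos[of x] by (simp add: abs_mult mult_ac)
    qed
  qed measurable
  have "dform w (Gam \<delta>) = (LBINT x. weak_grad w x \<bullet> ?G x)"
    unfolding dform_def using weak_grad_AE[OF weak_gradient_Gam] weak_grad_measurable[OF D12_Gam]
    by (intro integral_cong_AE) (auto elim!: eventually_mono)
  also have "\<dots> = (\<Sum>k\<in>UNIV. LBINT x. weak_grad w x $ k * partial k (Gam \<delta>) x)"
    using int1 by (simp add: inner_vec_def)
  also have "\<dots> = (\<Sum>k\<in>UNIV. - (LBINT x. w x * partial k (partial k (Gam \<delta>)) x))"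
    using weak_gradient_decaying[OF w smooth partial_Gam_le partial_partial_Gam_le] by simp
  also have "\<dots> = - (LBINT x. w x * (\<Sum>k\<in>UNIV. partial k (partial k (Gam \<delta>)) x))"
    using int2 by (simp add: sum_negf sum_distrib_left)
  also have "\<dots> = (LBINT x. w x * (8 * \<delta>\<^sup>2 * Gam \<delta> x ^ 3))"
    unfolding Laplacian_Gam by simp
  also have "\<dots> = \<bar>\<delta>\<bar> ^ DIM(R4) * (LBINT z. w (0 + \<delta> *\<^sub>R z) * (8 * \<delta>\<^sup>2 * Gam \<delta> (0 + \<delta> *\<^sub>R z) ^ 3))"
    using \<delta> by (intro integral_affine) auto
  also have "\<dots> = (LBINT z. \<delta> ^ 4 * (w (\<delta> *\<^sub>R z) * (8 * \<delta>\<^sup>2 * Gam \<delta> (\<delta> *\<^sub>R z) ^ 3)))"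
    using \<delta> by simp
  also have "\<dots> = (LBINT z. w (\<delta> *\<^sub>R z) * bump z)"
  proof (intro Bochner_Integration.integral_cong refl)
    fix z :: R4
    have "Gam \<delta> (\<delta> *\<^sub>R z) = inverse (\<delta>\<^sup>2 * (1 + (norm z)\<^sup>2))"
      by (simp add: Gam_def power_mult_distrib algebra_simps)
    also have "\<dots> = inverse (\<delta>\<^sup>2) * inverse (1 + (norm z)\<^sup>2)" by simp
    finally have "Gam \<delta> (\<delta> *\<^sub>R z) ^ 3 = inverse (\<delta>\<^sup>2) ^ 3 * inverse (1 + (norm z)\<^sup>2) ^ 3"
      by (simp only: power_mult_distrib)
    moreover have "\<delta> ^ 4 * \<delta>\<^sup>2 * inverse (\<delta>\<^sup>2) ^ 3 = 1" using \<delta> by (simp add: power_inverse flip: power_mult power_add)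
    moreover have "\<delta> ^ 4 * (W * (8 * \<delta>\<^sup>2 * (A * B))) = (\<delta> ^ 4 * \<delta>\<^sup>2 * A) * (W * (8 * B))" for W A B
      by simp
    ultimately show "\<delta> ^ 4 * (w (\<delta> *\<^sub>R z) * (8 * \<delta>\<^sup>2 * Gam \<delta> (\<delta> *\<^sub>R z) ^ 3)) = w (\<delta> *\<^sub>R z) * bump z"
      unfolding bump_def by (simp only: mult_1)
  qed
  finally show ?thesis .
qed

end

lemma Gam_antimono: "0 < \<delta> \<Longrightarrow> \<delta> \<le> \<delta>' \<Longrightarrow> Gam \<delta>' x \<le> Gam \<delta> x"
  unfolding Gam_def by (intro le_imp_inverse_le add_left_mono power_mono add_nonneg_pos) auto

lemma bump_pos: "0 < bump x"
  by (auto simp: bump_def intro!: mult_pos_pos zero_less_power positive_imp_inverse_positive add_pos_nonneg)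

lemma integrable_bump: "integrable lborel bump"
proof (rule integrable_weight_bound[where C=8 and n=6])
  show "bump \<in> borel_measurable borel" unfolding bump_def[abs_def] by measurable
  show "\<bar>bump x\<bar> \<le> 8 * inverse (weight x) ^ 6" for x
    using bump_pos[of x] power_mult[of "inverse (weight x)" 2 3] by (simp add: bump_def power_inverse)
qed simp

lemma dform_translate:
  assumes u: "u \<in> D12" and v: "v \<in> D12"
  shows "dform u (\<lambda>x. v (- h + x)) = dform (\<lambda>x. u (h + x)) v"
proof -
  note [measurable] = weak_grad_measurable[OF u] weak_grad_measurable[OF v]
   weak_grad_measurable[OF D12_translate[OF u, of h]] weak_grad_measurable[OF D12_translate[OF v, of "- h"]]
  have "dform u (\<lambda>x. v (- h + x)) = (LBINT x. weak_grad u x \<bullet> weak_grad v (- h + x))"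
    unfolding dform_def using weak_grad_AE[OF weak_gradient_translate[OF D12_measurable[OF v] weak_grad[OF v], of "- h"]]
    by (intro integral_cong_AE; measurable?) (elim eventually_mono, simp only:)
  also have "\<dots> = (LBINT x. weak_grad u (h + x) \<bullet> weak_grad v x)"
    using integral_translate(1)[of "\<lambda>x. weak_grad u x \<bullet> weak_grad v (- h + x)" h] by simp
  also have "\<dots> = dform (\<lambda>x. u (h + x)) v"
    unfolding dform_def using weak_grad_AE[OF weak_gradient_translate[OF D12_measurable[OF u] weak_grad[OF u], of h]]
    by (intro integral_cong_AE; measurable?) (elim eventually_mono, simp only:)
  finally show ?thesis .
qed

lemma mult_cube_le: "0 \<le> a \<Longrightarrow> 0 \<le> b \<Longrightarrow> a ^ 3 * b \<le> a ^ 4 + (b :: real) ^ 4"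
proof -
  assume a: "0 \<le> a" and b: "0 \<le> b"
  show ?thesis
  proof (cases "a \<le> b")
    case True
    then have "a ^ 3 * b \<le> b ^ 3 * b" using a b by (intro mult_right_mono power_mono)
    also have "\<dots> = b ^ 4" by (simp add: eval_nat_numeral)
    finally show ?thesis using a by (simp add: add_increasing)
  next
    case False
    then have "a ^ 3 * b \<le> a ^ 3 * a" using a by (intro mult_left_mono) auto
    also have "\<dots> = a ^ 4" by (simp add: eval_nat_numeral)
    finally show ?thesis using b by (simp add: add_increasing2)
  qed
qed

lemma integrable_cube_mult:
  assumes w: "w \<in> D12" "\<And>x. 0 \<le> w x" and \<phi>: "\<phi> \<in> D12" "\<And>x. 0 \<le> \<phi> x"
  shows "integrable lborel (\<lambda>x. w x ^ 3 * \<phi> x)"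
proof (rule Bochner_Integration.integrable_bound[of _ "\<lambda>x. w x ^ 4 + \<phi> x ^ 4"])
  note [measurable] = D12_measurable[OF w(1)] D12_measurable[OF \<phi>(1)]
  show "(\<lambda>x. w x ^ 3 * \<phi> x) \<in> borel_measurable lborel" by measurable
  show "AE x in lborel. norm (w x ^ 3 * \<phi> x) \<le> norm (w x ^ 4 + \<phi> x ^ 4)"
    using mult_cube_le[OF w(2) \<phi>(2)] w(2) \<phi>(2) by (intro AE_I2) simp
qed (use w \<phi> D12_integrable in auto)

text \<open>Testing with \<open>Gam \<delta>\<close> centred at \<open>y\<close> bounds averages of \<open>w\<close> around \<open>y\<close> at scale \<open>\<delta>\<close> from below by a
  positive function of \<open>y\<close> that does not depend on \<open>\<delta>\<close>. On the zero set of \<open>w\<close> these averages tend to 0.\<close>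

theorem strong_maximum_principle:
  assumes w: "w \<in> D12" "\<And>x. 0 \<le> w x" and b: "0 < b"
    and super: "\<And>\<phi>. \<phi> \<in> D12 \<Longrightarrow> (\<And>x. 0 \<le> \<phi> x) \<Longrightarrow> b * (LBINT x. w x ^ 3 * \<phi> x) \<le> dform w \<phi>"
    and nz: "\<not> (AE x in lborel. w x = 0)"
  shows "AE x in lborel. w x \<noteq> 0"
proof (rule ccontr)
  assume contra: "\<not> (AE x in lborel. w x \<noteq> 0)"
  note [measurable] = D12_measurable[OF w(1)]
  have "\<exists>n. \<not> (AE x in lborel. x \<in> cube (real n) \<longrightarrow> w x \<noteq> 0)"
  proof (rule ccontr)
    assume "\<nexists>n. \<not> (AE x in lborel. x \<in> cube (real n) \<longrightarrow> w x \<noteq> 0)"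
    then have "AE x in lborel. \<forall>n. x \<in> cube (real n) \<longrightarrow> w x \<noteq> 0" by (subst AE_all_countable) blast
    then have "AE x in lborel. w x \<noteq> 0"
    proof eventually_elim
      case (elim x)
      obtain n where "norm x \<le> real n" using real_arch_simple by blast
      then have "x \<in> cube (real n)" by (rule norm_le_cube)
      with elim show ?case by blast
    qed
    with contra show False by blast
  qed
  then obtain r :: real where r: "\<not> (AE x in lborel. x \<in> cube r \<longrightarrow> w x \<noteq> 0)" by blast
  \<comment> \<open>A bounded part of the zero set is used, so that integrals of translates of
    \<open>w\<close> over it are finite.\<close>
  define Z where "Z = {x \<in> cube r. w x = 0}"
  have Zm[measurable]: "Z \<in> sets borel" unfolding Z_def by measurable
  have nZ: "\<not> (AE x in lborel. x \<notin> Z)" using r unfolding Z_def by (auto elim!: eventually_mono)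
  define d where "d n = inverse (real (Suc n))" for n
  have d: "d \<longlonglongrightarrow> 0" "\<And>n. 0 < d n" "\<And>n. d n \<le> 1"
    unfolding d_def by (rule LIMSEQ_inverse_real_of_nat) (simp_all add: inverse_le_1_iff)
  \<comment> \<open>This is the lower bound at scale 1. Smaller scales give larger kernels, so
    \<open>p\<close> bounds the averages from below for all \<open>n\<close> simultaneously.\<close>
  define p where "p y = b * (LBINT x. w x ^ 3 * Gam 1 (- y + x))" for y
  let ?S = "\<lambda>n y. LBINT z. w (y + d n *\<^sub>R z) * bump z"
  have G1: "(\<lambda>x. Gam 1 (- y + x)) \<in> D12" for y by (intro D12_translate D12_Gam) auto
  have [measurable]: "Gam 1 \<in> borel_measurable borel" "bump \<in> borel_measurable borel"
    using Gam_measurable[of 1] borel_measurable_integrable[OF integrable_bump] by simp_all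
  have Gnn: "0 < Gam 1 x" for x by (rule Gam_pos) auto
  have pS: "p y \<le> ?S n y" for n y
  proof -
    have Gd: "(\<lambda>x. Gam (d n) (- y + x)) \<in> D12" by (intro D12_translate D12_Gam d)
    have Gdn: "0 \<le> Gam (d n) x" for x using Gam_pos[OF d(2,3)] less_imp_le by blast
    have "p y \<le> b * (LBINT x. w x ^ 3 * Gam (d n) (- y + x))"
      unfolding p_def using b Gnn Gdn w(2) less_imp_le[OF Gnn]
      by (intro mult_left_mono integral_mono integrable_cube_mult w G1 Gd Gam_antimono d) auto
    also have "\<dots> \<le> dform w (\<lambda>x. Gam (d n) (- y + x))" by (intro super Gd Gdn)
    also have "\<dots> = dform (\<lambda>x. w (y + x)) (Gam (d n))" by (intro dform_translate w D12_Gam d)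
    also have "\<dots> = ?S n y" by (intro dform_Gam D12_translate w d)
    finally show ?thesis .
  qed
  have int3: "integrable lborel (\<lambda>x. w x ^ 3 * Gam 1 (- y + x))" for y
    by (intro integrable_cube_mult w G1 less_imp_le Gnn)
  have p_pos: "0 < p y" for y
  proof -
    have "0 \<le> (LBINT x. w x ^ 3 * Gam 1 (- y + x))"
      using w(2) less_imp_le[OF Gnn] by (intro Bochner_Integration.integral_nonneg mult_nonneg_nonneg) auto
    moreover have "(LBINT x. w x ^ 3 * Gam 1 (- y + x)) \<noteq> 0"
    proof
      assume "(LBINT x. w x ^ 3 * Gam 1 (- y + x)) = 0"
      then have "AE x in lborel. w x ^ 3 * Gam 1 (- y + x) = 0"
        using w(2) less_imp_le[OF Gnn]
        by (subst (asm) integral_nonneg_eq_0_iff_AE[OF int3]) auto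
      then have "AE x in lborel. w x = 0"
        by eventually_elim (use Gnn in \<open>auto simp: less_imp_neq[symmetric]\<close>)
      with nz show False by blast
    qed
    ultimately show ?thesis unfolding p_def using b by simp
  qed
  have p_meas[measurable]: "p \<in> borel_measurable borel"
  proof -
    have "(\<lambda>y. LBINT x. w x ^ 3 * Gam 1 (- y + x)) \<in> borel_measurable borel"
      using lborel.borel_measurable_lebesgue_integral[of "\<lambda>y x. w x ^ 3 * Gam 1 (- y + x)" lborel] by simp
    then show ?thesis unfolding p_def[abs_def] by simp
  qed
  let ?F = "\<lambda>h. LBINT y. indicator Z y * w (h + y)"
  \<comment> \<open>Translation preserves the L4 norm, so \<open>K\<close> bounds
    \<open>?F h\<close> for every shift \<open>h\<close>; it provides the dominating function
    \<open>K * bump z\<close> for the limit in \<open>n\<close>.\<close>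
  define K where "K = (LBINT y. indicator (cube r) y + w y ^ 4)"
  have Kint: "integrable lborel (\<lambda>y. indicator (cube r) y + w (h + y) ^ 4)" for h
    by (intro Bochner_Integration.integrable_add integrable_indicator_cube D12_integrable D12_translate w)
  have ZF_le: "indicator Z y * w (h + y) \<le> indicator (cube r) y + w (h + y) ^ 4" for h y
    using fourth_le_one_add[of "w (h + y)"] w(2)[of "h + y"] by (auto simp: indicator_def Z_def)
  have Fint: "integrable lborel (\<lambda>y. indicator Z y * w (h + y))" for h
    by (rule Bochner_Integration.integrable_bound[OF Kint[of h]])
       (use ZF_le[of _ h] w(2) in \<open>auto intro!: AE_I2 order_trans[OF _ abs_ge_self]\<close>)
  have F_le: "?F h \<le> K" for h
  proof -
    have "?F h \<le> (LBINT y. indicator (cube r) y + w (h + y) ^ 4)"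
      by (intro integral_mono Fint Kint ZF_le)
    also have "\<dots> = K"
      using Kint[of h] Kint[of 0] integral_translate(1)[of "\<lambda>y. w y ^ 4" h] D12_integrable[OF D12_translate[OF w(1)], of h]
        D12_integrable[OF w(1)] integrable_indicator_cube[of r]
      by (simp add: K_def)
    finally show ?thesis .
  qed
  have F_nonneg: "0 \<le> ?F h" for h using w(2) by (intro Bochner_Integration.integral_nonneg) auto
  \<comment> \<open>On \<open>Z\<close> the function \<open>w\<close> vanishes, so there
    \<open>w (h + y)\<close> coincides with \<open>\<bar>w (h + y) - w y\<bar>\<close>, and the
    continuity of translations in L1 applies.\<close>
  have F_lim: "(\<lambda>n. ?F (d n *\<^sub>R z)) \<longlonglongrightarrow> 0" for z
  proof (rule tendsto_sandwich[OF always_eventually always_eventually tendsto_const])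
    have "(\<lambda>n. d n *\<^sub>R z) \<longlonglongrightarrow> 0 *\<^sub>R z" by (intro tendsto_intros d)
    then show "(\<lambda>n. LBINT y. indicator (cube r) y * \<bar>w (d n *\<^sub>R z + y) - w y\<bar>) \<longlonglongrightarrow> 0"
      by (intro loc_int_trans_cont D12_loc_int w) simp
    show "\<forall>n. ?F (d n *\<^sub>R z) \<le> (LBINT y. indicator (cube r) y * \<bar>w (d n *\<^sub>R z + y) - w y\<bar>)"
      by (intro allI integral_mono Fint loc_int_abs loc_int_minus loc_int_translate(1) D12_loc_int w)
         (auto simp: indicator_def Z_def)
  qed (use F_nonneg in auto)
  have pair: "integrable (lborel \<Otimes>\<^sub>M lborel) (\<lambda>(z, y). indicator Z y * (w (y + d n *\<^sub>R z) * bump z))" for n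
  proof (rule lborel_pair.Fubini_integrable)
    show "(\<lambda>(z, y). indicator Z y * (w (y + d n *\<^sub>R z) * bump z)) \<in> borel_measurable (lborel \<Otimes>\<^sub>M lborel)"
      by measurable
    have eq: "indicator Z y * (w (y + d n *\<^sub>R z) * bump z) = bump z * (indicator Z y * w (d n *\<^sub>R z + y))" for y z
      by (simp add: add.commute mult_ac)
    show "AE z in lborel. integrable lborel (\<lambda>y. case (z, y) of (z, y) \<Rightarrow> indicator Z y * (w (y + d n *\<^sub>R z) * bump z))"
      unfolding prod.case eq by (intro AE_I2 integrable_mult_right Fint)
    have neq: "(LBINT y. norm (case (z, y) of (z, y) \<Rightarrow> indicator Z y * (w (y + d n *\<^sub>R z) * bump z))) = bump z * ?F (d n *\<^sub>R z)" for z
      unfolding prod.case eq using bump_pos[of z] w(2) by (simp add: abs_mult)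
    show "integrable lborel (\<lambda>z. LBINT y. norm (case (z, y) of (z, y) \<Rightarrow> indicator Z y * (w (y + d n *\<^sub>R z) * bump z)))"
      unfolding neq
    proof (rule Bochner_Integration.integrable_bound[of _ "\<lambda>z. K * bump z"])
      show "integrable lborel (\<lambda>z. K * bump z)" by (intro integrable_mult_right integrable_bump)
      show "AE z in lborel. norm (bump z * ?F (d n *\<^sub>R z)) \<le> norm (K * bump z)"
        using F_le F_nonneg bump_pos order_trans[OF F_nonneg F_le]
        by (intro AE_I2) (auto simp: abs_mult mult.commute less_imp_le intro!: mult_right_mono)
    qed measurable
  qed
  have "(\<lambda>n. LBINT z. LBINT y. indicator Z y * (w (y + d n *\<^sub>R z) * bump z)) \<longlonglongrightarrow> (LINT z|(lborel :: R4 measure). 0 :: real)"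
  proof -
    have eq: "(LBINT y. indicator Z y * (w (y + d n *\<^sub>R z) * bump z)) = bump z * ?F (d n *\<^sub>R z)" for n z
      by (simp add: add.commute mult_ac flip: integral_mult_right_zero)
    show ?thesis unfolding eq
    proof (rule integral_dominated_convergence[where w="\<lambda>z. K * bump z"])
      show "integrable lborel (\<lambda>z. K * bump z)" by (intro integrable_mult_right integrable_bump)
      show "AE z in lborel. norm (bump z * ?F (d n *\<^sub>R z)) \<le> K * bump z" for n
        using F_le F_nonneg bump_pos
        by (intro AE_I2) (auto simp: abs_mult mult.commute less_imp_le intro!: mult_right_mono)
      show "AE z in lborel. (\<lambda>n. bump z * ?F (d n *\<^sub>R z)) \<longlonglongrightarrow> 0"
        by (intro AE_I2 tendsto_mult_right_zero F_lim)
    qed measurable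
  qed
  \<comment> \<open>The limit is taken with the shift \<open>z\<close> in the outer integral,
    whereas the lower bound \<open>p\<close> concerns the centre \<open>y\<close>; Fubini connects
    the two.\<close>
  moreover have "(LBINT z. LBINT y. indicator Z y * (w (y + d n *\<^sub>R z) * bump z)) = (LBINT y. indicator Z y * ?S n y)" for n
    using lborel_pair.Fubini_integral[OF pair[of n]] by simp
  ultimately have lim: "(\<lambda>n. LBINT y. indicator Z y * ?S n y) \<longlonglongrightarrow> 0" by simp
  have Sint: "integrable lborel (\<lambda>y. indicator Z y * ?S n y)" for n
    using lborel_pair.integrable_snd[OF pair[of n]] by simp
  have pint: "integrable lborel (\<lambda>y. indicator Z y * p y)"
    by (rule Bochner_Integration.integrable_bound[OF Sint[of 0]])
       (use pS[of _ 0] p_pos in \<open>auto intro!: AE_I2 simp: indicator_def less_imp_le intro: order_trans[OF _ abs_ge_self]\<close>)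
  have "(LBINT y. indicator Z y * p y) \<le> (LBINT y. indicator Z y * ?S n y)" for n
    by (intro integral_mono pint Sint mult_left_mono pS) simp
  then have "(LBINT y. indicator Z y * p y) \<le> 0" by (intro LIMSEQ_le_const[OF lim]) auto
  moreover have "0 \<le> (LBINT y. indicator Z y * p y)"
    using p_pos by (intro Bochner_Integration.integral_nonneg) (auto simp: less_imp_le)
  ultimately have "(LBINT y. indicator Z y * p y) = 0" by simp
  then have "AE y in lborel. indicator Z y * p y = 0"
    using p_pos by (subst (asm) integral_nonneg_eq_0_iff_AE[OF pint]) (auto simp: less_imp_le)
  then have "AE y in lborel. y \<notin> Z"
    by eventually_elim (use p_pos in \<open>auto simp: indicator_def less_imp_neq[symmetric] split: if_splits\<close>)
  with nZ show False by blast
qed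

section \<open>The energy functionals\<close>

definition quart :: "(R4 \<Rightarrow> real) \<Rightarrow> (R4 \<Rightarrow> real) \<Rightarrow> real" where
  "quart u v = (LBINT x. (u x)\<^sup>2 * (v x)\<^sup>2)"

lemma integrable_quart:
  assumes u: "u \<in> D12" and v: "v \<in> D12" shows "integrable lborel (\<lambda>x. (u x)\<^sup>2 * (v x)\<^sup>2)"
proof (rule Bochner_Integration.integrable_bound[of _ "\<lambda>x. u x ^ 4 + v x ^ 4"])
  note [measurable] = D12_measurable[OF u] D12_measurable[OF v]
  show "(\<lambda>x. (u x)\<^sup>2 * (v x)\<^sup>2) \<in> borel_measurable lborel" by measurable
  show "AE x in lborel. norm ((u x)\<^sup>2 * (v x)\<^sup>2) \<le> norm (u x ^ 4 + v x ^ 4)"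
    using mult_le_add_squares[of "(u _)\<^sup>2" "(v _)\<^sup>2"] by (intro AE_I2) (simp flip: power_mult)
qed (use u v D12_integrable in auto)

lemma quart_nonneg: "0 \<le> quart u v"
  unfolding quart_def by (rule Bochner_Integration.integral_nonneg) simp

lemma quart_commute: "quart u v = quart v u"
  by (simp add: quart_def mult.commute)

lemma quart_scale: "quart (\<lambda>x. c * u x) (\<lambda>x. e * v x) = c\<^sup>2 * e\<^sup>2 * quart u v"
  by (simp add: quart_def power_mult_distrib mult_ac flip: integral_mult_right_zero)

lemma quart_abs: "quart (\<lambda>x. \<bar>u x\<bar>) (\<lambda>x. \<bar>v x\<bar>) = quart u v"
  by (simp add: quart_def)

lemma quart_eq_0_imp:
  assumes "u \<in> D12" "v \<in> D12" "quart u v = 0" shows "AE x in lborel. u x = 0 \<or> v x = 0"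
proof -
  have "AE x in lborel. (u x)\<^sup>2 * (v x)\<^sup>2 = 0"
    using assms(3) integral_nonneg_eq_0_iff_AE[OF integrable_quart[OF assms(1,2)]] by (simp add: quart_def)
  then show ?thesis by (rule eventually_mono) simp
qed

section \<open>Quadratic and quartic parts of the energy\<close>

definition EA :: "nat set \<Rightarrow> fam \<Rightarrow> real" where
  "EA J u = (\<Sum>i\<in>J. dirichlet (u i))"

definition EB :: "(nat \<Rightarrow> nat \<Rightarrow> real) \<Rightarrow> nat set \<Rightarrow> nat set \<Rightarrow> fam \<Rightarrow> real" where
  "EB \<beta> J L u = (\<Sum>i\<in>J. \<Sum>j\<in>L. \<beta> i j * quart (u i) (u j))"

lemma EA_scale: "u \<in> D12_vec J \<Longrightarrow> EA J (\<lambda>i x. c * u i x) = c\<^sup>2 * EA J u"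
  by (simp add: EA_def D12_vec_def dirichlet_cmult sum_distrib_left)

lemma EB_scale: "EB \<beta> J L (\<lambda>i x. c * u i x) = c ^ 4 * EB \<beta> J L u"
  by (simp add: EB_def quart_scale sum_distrib_left mult_ac flip: power_add)

lemma EA_nonneg: "0 \<le> EA J u"
  by (simp add: EA_def sum_nonneg dirichlet_nonneg)

lemma D12_vec_scale: "u \<in> D12_vec J \<Longrightarrow> (\<lambda>i x. c * u i x) \<in> D12_vec J"
  by (simp add: D12_vec_def D12_cmult)

lemma nonzero_on_scale: "c \<noteq> 0 \<Longrightarrow> nonzero_on J (\<lambda>i x. c * u i x) \<longleftrightarrow> nonzero_on J u"
  by (simp add: nonzero_on_def)

text \<open>A vanishing gradient forces the zero function, because L4 of the whole space contains no
  other constant.\<close>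

lemma EA_pos:
  assumes "finite J" "u \<in> D12_vec J" "nonzero_on J u" shows "0 < EA J u"
proof -
  obtain i where i: "i \<in> J" "\<not> (AE x in lborel. u i x = 0)" using assms(3) by (auto simp: nonzero_on_def)
  then have "dirichlet (u i) \<noteq> 0" using assms(2) dirichlet_eq_0_imp by (auto simp: D12_vec_def)
  then have "0 < dirichlet (u i)" using dirichlet_nonneg[of "u i"] by simp
  then show ?thesis unfolding EA_def using assms(1) i by (intro sum_pos2[of _ i]) (auto simp: dirichlet_nonneg)
qed

lemma EB_pos:
  assumes J: "finite J" and \<beta>: "\<And>i j. i \<in> J \<Longrightarrow> j \<in> J \<Longrightarrow> 0 \<le> \<beta> i j" "\<And>i. i \<in> J \<Longrightarrow> 0 < \<beta> i i"
    and u: "u \<in> D12_vec J" "nonzero_on J u"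
  shows "0 < EB \<beta> J J u"
proof -
  obtain i where i: "i \<in> J" "\<not> (AE x in lborel. u i x = 0)" using u by (auto simp: nonzero_on_def)
  then have "quart (u i) (u i) \<noteq> 0" using u(1) quart_eq_0_imp[of "u i" "u i"] by (auto simp: D12_vec_def)
  then have "0 < \<beta> i i * quart (u i) (u i)" using quart_nonneg[of "u i" "u i"] \<beta>(2)[OF i(1)] by simp
  then have "0 < (\<Sum>j\<in>J. \<beta> i j * quart (u i) (u j))"
    using J i(1) by (intro sum_pos2[of _ i]) (auto intro!: mult_nonneg_nonneg quart_nonneg \<beta>)
  then show ?thesis unfolding EB_def
    by (rule sum_pos2[OF J i(1)]) (intro sum_nonneg mult_nonneg_nonneg quart_nonneg \<beta>)
qed

lemma finite_block: "finite (block a h)"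
  by (rule finite_subset[of _ "{..a h}"]) (auto simp: block_def)

lemma integral_pair_sum:
  assumes "\<And>i. i \<in> J \<Longrightarrow> u i \<in> D12" "\<And>i. i \<in> L \<Longrightarrow> u i \<in> D12"
  shows "(LBINT x. (\<Sum>(i, j)\<in>J \<times> L. \<beta> i j * (u j x)\<^sup>2 * (u i x)\<^sup>2)) = EB \<beta> J L u"
    and "integrable lborel (\<lambda>x. \<Sum>(i, j)\<in>J \<times> L. \<beta> i j * (u j x)\<^sup>2 * (u i x)\<^sup>2)"
proof -
  have int: "integrable lborel (\<lambda>x. \<beta> i j * (u j x)\<^sup>2 * (u i x)\<^sup>2)" if "i \<in> J" "j \<in> L" for i j
    using integrable_quart[of "u j" "u i"] assms that by (simp add: mult.assoc)
  then show "integrable lborel (\<lambda>x. \<Sum>(i, j)\<in>J \<times> L. \<beta> i j * (u j x)\<^sup>2 * (u i x)\<^sup>2)"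
    by (intro Bochner_Integration.integrable_sum) auto
  have "(LBINT x. (\<Sum>(i, j)\<in>J \<times> L. \<beta> i j * (u j x)\<^sup>2 * (u i x)\<^sup>2))
     = (\<Sum>p\<in>J \<times> L. LBINT x. (case p of (i, j) \<Rightarrow> \<beta> i j * (u j x)\<^sup>2 * (u i x)\<^sup>2))"
    using int by (intro Bochner_Integration.integral_sum) auto
  also have "\<dots> = (\<Sum>(i, j)\<in>J \<times> L. \<beta> i j * quart (u i) (u j))"
    by (intro sum.cong) (auto simp: quart_def mult_ac)
  finally show "(LBINT x. (\<Sum>(i, j)\<in>J \<times> L. \<beta> i j * (u j x)\<^sup>2 * (u i x)\<^sup>2)) = EB \<beta> J L u"
    by (simp add: EB_def sum.cartesian_product)
qed

lemma integral_grad_sum: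
  assumes "\<And>i. i \<in> J \<Longrightarrow> u i \<in> D12"
  shows "(LBINT x. (\<Sum>i\<in>J. (norm (weak_grad (u i) x))\<^sup>2)) = EA J u"
    and "integrable lborel (\<lambda>x. \<Sum>i\<in>J. (norm (weak_grad (u i) x))\<^sup>2)"
  using dirichlet_integrable assms
  by (auto simp: EA_def dirichlet_def intro!: Bochner_Integration.integral_sum)

lemma block_energy_eq:
  assumes "v \<in> D12_vec (block a h)"
  shows "block_energy a \<beta> h v = 1/2 * EA (block a h) v - 1/4 * EB \<beta> (block a h) (block a h) v"
  unfolding block_energy_def
  using integral_grad_sum[of "block a h" v] integral_pair_sum[of "block a h" v "block a h" \<beta>] assms
  by (simp add: D12_vec_def)

lemma dfun_block_energy:
  assumes v: "v \<in> D12_vec (block a h)"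
  shows "dfun (block_energy a \<beta> h) v v = EA (block a h) v - EB \<beta> (block a h) (block a h) v"
proof -
  let ?A = "EA (block a h) v" and ?B = "EB \<beta> (block a h) (block a h) v"
  have "block_energy a \<beta> h (\<lambda>i x. v i x + t * v i x) = 1/2 * ((1 + t)\<^sup>2 * ?A) - 1/4 * ((1 + t) ^ 4 * ?B)" for t
  proof -
    have eq: "(\<lambda>i x. v i x + t * v i x) = (\<lambda>i x. (1 + t) * v i x)" by (simp add: distrib_right)
    show ?thesis unfolding eq by (simp add: block_energy_eq D12_vec_scale v EA_scale EB_scale)
  qed
  moreover have "((\<lambda>t. 1/2 * ((1 + t)\<^sup>2 * ?A) - 1/4 * ((1 + t) ^ 4 * ?B)) has_real_derivative ?A - ?B) (at 0)"
    by (auto intro!: derivative_eq_intros)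
  ultimately show ?thesis unfolding dfun_def by (simp add: DERIV_imp_deriv)
qed

lemma block_Nehari_iff:
  "v \<in> block_Nehari a \<beta> h \<longleftrightarrow> v \<in> D12_vec (block a h) \<and> nonzero_on (block a h) v \<and>
     EA (block a h) v = EB \<beta> (block a h) (block a h) v"
  unfolding block_Nehari_def using dfun_block_energy[of v a h \<beta>] by auto

lemma block_energy_Nehari: "v \<in> block_Nehari a \<beta> h \<Longrightarrow> block_energy a \<beta> h v = 1/4 * EA (block a h) v"
  by (simp add: block_Nehari_iff block_energy_eq)

lemma block_energy_bdd_below: "bdd_below (block_energy a \<beta> h ` block_Nehari a \<beta> h)"
  by (rule bdd_belowI[of _ 0]) (auto simp: block_energy_Nehari EA_nonneg)

text \<open>The kernel doubles as the witness that the Nehari set of a block is nonempty.\<close>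

lemma D12_nontrivial: "Gam 1 \<in> D12" "\<not> (AE x in lborel. Gam 1 x = 0)"
proof -
  show "Gam 1 \<in> D12" by (rule D12_Gam) auto
  have "Gam 1 x \<noteq> 0" for x using Gam_pos[of 1 x] by simp
  then show "\<not> (AE x in lborel. Gam 1 x = 0)" 
    by (auto simp: eventually_ae_filter null_sets_def emeasure_lborel_UNIV dest!: top.extremum_uniqueI)
qed

section \<open>A single attractive block and its minimizers\<close>

locale attractive_block =
  fixes a :: "nat \<Rightarrow> nat" and \<beta> :: "nat \<Rightarrow> nat \<Rightarrow> real" and h :: nat
  assumes \<beta>_nonneg: "\<And>i j. i \<in> block a h \<Longrightarrow> j \<in> block a h \<Longrightarrow> 0 \<le> \<beta> i j"
    and \<beta>_pos: "\<And>i. i \<in> block a h \<Longrightarrow> 0 < \<beta> i i"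
    and J_nonempty: "block a h \<noteq> {}"
begin

abbreviation "J \<equiv> block a h"

lemma finite_J: "finite J"
  by (rule finite_block)

lemma EB_J_pos: "v \<in> D12_vec J \<Longrightarrow> nonzero_on J v \<Longrightarrow> 0 < EB \<beta> J J v"
  by (rule EB_pos[OF finite_J]) (auto intro: \<beta>_nonneg \<beta>_pos)

text \<open>On the ray through \<open>v\<close> the constraint reads t^2 EA = t^4 EB, so t^2 = EA /
  EB, and the energy t^2 EA / 4 becomes EA^2 / (4 EB). Both quantities are positive because the
  block is attractive.\<close>

lemma project_Nehari:
  assumes v: "v \<in> D12_vec J" "nonzero_on J v"
  obtains t where "(\<lambda>i x. t * v i x) \<in> block_Nehari a \<beta> h"
    "block_energy a \<beta> h (\<lambda>i x. t * v i x) = (EA J v)\<^sup>2 / (4 * EB \<beta> J J v)"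
proof -
  have A: "0 < EA J v" using EA_pos[OF finite_J v] .
  have B: "0 < EB \<beta> J J v" by (rule EB_J_pos[OF v])
  define t where "t = sqrt (EA J v / EB \<beta> J J v)"
  have t2: "t\<^sup>2 = EA J v / EB \<beta> J J v" unfolding t_def using A B by simp
  have t: "t \<noteq> 0" unfolding t_def using A B by simp
  have t4: "t ^ 4 = (EA J v / EB \<beta> J J v)\<^sup>2" using t2 by (simp flip: t2 add: power_mult[symmetric])
  have eq: "t\<^sup>2 * EA J v = t ^ 4 * EB \<beta> J J v" "1/4 * (t\<^sup>2 * EA J v) = (EA J v)\<^sup>2 / (4 * EB \<beta> J J v)"
    unfolding t2 t4 using B by (simp_all add: power2_eq_square)
  have N: "(\<lambda>i x. t * v i x) \<in> block_Nehari a \<beta> h"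
    unfolding block_Nehari_iff
    using v t by (simp add: D12_vec_scale nonzero_on_scale EA_scale EB_scale eq(1))
  have "block_energy a \<beta> h (\<lambda>i x. t * v i x) = (EA J v)\<^sup>2 / (4 * EB \<beta> J J v)"
    unfolding block_energy_Nehari[OF N] EA_scale[OF v(1)] by (rule eq(2))
  with N show ?thesis using that by blast
qed

lemma block_Nehari_nonempty: "block_Nehari a \<beta> h \<noteq> {}"
proof -
  have "(\<lambda>_. Gam 1) \<in> D12_vec J" "nonzero_on J (\<lambda>_. Gam 1)"
    using D12_nontrivial J_nonempty by (auto simp: D12_vec_def nonzero_on_def)
  from project_Nehari[OF this] show ?thesis by blast
qed

lemma block_level_le_quotient:
  assumes v: "v \<in> D12_vec J" "nonzero_on J v"
  shows "block_level a \<beta> h \<le> (EA J v)\<^sup>2 / (4 * EB \<beta> J J v)"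
proof -
  obtain t where t: "(\<lambda>i x. t * v i x) \<in> block_Nehari a \<beta> h"
    "block_energy a \<beta> h (\<lambda>i x. t * v i x) = (EA J v)\<^sup>2 / (4 * EB \<beta> J J v)"
    using project_Nehari[OF v] .
  show ?thesis unfolding block_level_def t(2)[symmetric]
    by (intro cInf_lower block_energy_bdd_below imageI t(1))
qed

text \<open>The scale-invariant form of the minimisation problem: both sides are homogeneous of
  degree four in \<open>v\<close>, so it can be used for functions off the constraint set.\<close>

lemma block_level_EB_le:
  assumes v: "v \<in> D12_vec J" "nonzero_on J v"
  shows "4 * block_level a \<beta> h * EB \<beta> J J v \<le> (EA J v)\<^sup>2"
  using block_level_le_quotient[OF v] EB_J_pos[OF v] by (simp add: field_simps)

lemma quart_mono:
  assumes "u \<in> D12" "v \<in> D12" "u' \<in> D12" "v' \<in> D12"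
    and "\<And>x. 0 \<le> u x \<and> u x \<le> u' x" "\<And>x. 0 \<le> v x \<and> v x \<le> v' x"
  shows "quart u v \<le> quart u' v'"
  unfolding quart_def using assms by (intro integral_mono integrable_quart mult_mono power_mono) auto

text \<open>Replacing \<open>u\<close> by \<open>\<bar>u\<bar>\<close> and varying only upwards keeps every term of the quartic form monotone,
  so the supersolution inequality follows without differentiating the quartic form.\<close>

lemma minimizer_nonvanishing:
  assumes u: "u \<in> D12_vec J" and EA: "EA J u = 4 * block_level a \<beta> h" and EB: "EB \<beta> J J u = EA J u"
    and i: "i \<in> J" and nz: "\<not> (AE x in lborel. u i x = 0)"
  shows "AE x in lborel. u i x \<noteq> 0"
proof -
  define w where "w j x = \<bar>u j x\<bar>" for j x
  have wD: "w j \<in> D12" if "j \<in> J" for j using D12_abs[of "u j"] u that by (simp add: w_def[abs_def] D12_vec_def)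
  have w0: "0 \<le> w j x" for j x by (simp add: w_def)
  have wJ: "w \<in> D12_vec J" using wD by (simp add: D12_vec_def)
  have wnz: "\<not> (AE x in lborel. w i x = 0)" using nz by (simp add: w_def)
  then have wn: "nonzero_on J w" using i by (auto simp: nonzero_on_def)
  define lam where "lam = EA J u"
  have un: "nonzero_on J u" using nz i by (auto simp: nonzero_on_def)
  have lam: "0 < lam" unfolding lam_def by (rule EA_pos[OF finite_J u un])
  have Bw: "EB \<beta> J J w = lam" using EB by (simp add: EB_def w_def[abs_def] quart_abs lam_def)
  \<comment> \<open>Absolute values leave the quartic part unchanged and cannot raise the Dirichlet
    part; the level inequality keeps the latter from dropping. Hence \<open>w\<close> has the same
    two values as \<open>u\<close>.\<close>
  have "EA J w \<le> lam" unfolding EA_def lam_def w_def[abs_def]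
    using u by (intro sum_mono dirichlet_abs_le) (simp add: D12_vec_def)
  moreover have "lam \<le> EA J w"
  proof -
    have "lam * lam \<le> (EA J w)\<^sup>2" using block_level_EB_le[OF wJ wn] EA by (simp add: Bw lam_def)
    then show ?thesis by (rule power2_le_imp_le[of lam, unfolded power2_eq_square[of lam], OF _ EA_nonneg])
  qed
  ultimately have Aw: "EA J w = lam" by simp
  have "\<beta> i i * (LBINT x. w i x ^ 3 * \<phi> x) \<le> dform (w i) \<phi>" if \<phi>: "\<phi> \<in> D12" "\<And>x. 0 \<le> \<phi> x" for \<phi>
  proof -
    let ?X = "LBINT x. w i x ^ 3 * \<phi> x" and ?D = "dform (w i) \<phi>" and ?P = "dirichlet \<phi>"
    \<comment> \<open>The level inequality is evaluated at \<open>w\<close> with its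
      \<open>i\<close>-th component raised by \<open>t * \<phi>\<close>. The terms of order zero
      agree, division by \<open>t\<close> leaves the first-order terms, and everything of higher
      order is collected behind a factor \<open>t\<close> that is sent to 0 from the right.\<close>
    have main: "4 * lam * (\<beta> i i * ?X) \<le> 4 * lam * ?D + t * (2 * lam * ?P + (2 * ?D + t * ?P)\<^sup>2)" if t: "0 < t" for t
    proof -
      define v where "v j x = w j x + (if j = i then t else 0) * \<phi> x" for j x
      have vD: "v j \<in> D12" if "j \<in> J" for j
        unfolding v_def[abs_def] by (intro D12_add D12_cmult \<phi> wD that)
      then have vJ: "v \<in> D12_vec J" by (simp add: D12_vec_def)
      have wv: "0 \<le> w j x \<and> w j x \<le> v j x" for j x using w0 \<phi> t by (simp add: v_def)
      have "\<not> (AE x in lborel. v i x = 0)"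
      proof
        assume "AE x in lborel. v i x = 0"
        then have "AE x in lborel. w i x = 0" by eventually_elim (use wv[of i] in \<open>metis order_antisym\<close>)
        with wnz show False by blast
      qed
      then have vn: "nonzero_on J v" using i by (auto simp: nonzero_on_def)
      have "EA J v = (\<Sum>j\<in>J. dirichlet (w j) + (if j = i then 2 * t * ?D + t\<^sup>2 * ?P else 0))"
        unfolding EA_def v_def[abs_def] by (intro sum.cong) (simp_all add: dirichlet_add_cmult wD \<phi>)
      then have Av: "EA J v = lam + t * (2 * ?D + t * ?P)"
        using i finite_J Aw by (simp add: sum.distrib EA_def power2_eq_square algebra_simps)
      \<comment> \<open>Of the binomial expansion only the constant and linear terms are kept; the
        rest is nonnegative since \<open>w\<close>, \<phi> and \<open>t\<close> are.\<close>
      have qii: "quart (w i) (w i) + 4 * t * ?X \<le> quart (v i) (v i)"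
      proof -
        have int: "integrable lborel (\<lambda>x. w i x ^ 3 * \<phi> x)" by (intro integrable_cube_mult wD i w0 \<phi>)
        have "quart (w i) (w i) + 4 * t * ?X = (LBINT x. (w i x)\<^sup>2 * (w i x)\<^sup>2 + 4 * t * (w i x ^ 3 * \<phi> x))"
          using int integrable_quart[OF wD[OF i] wD[OF i]] by (simp add: quart_def)
        also have "\<dots> \<le> quart (v i) (v i)"
          unfolding quart_def
        proof (intro integral_mono integrable_quart vD i Bochner_Integration.integrable_add integrable_mult_right int wD)
          fix x
          let ?a = "w i x" and ?b = "t * \<phi> x"
          have "0 \<le> ?a" "0 \<le> ?b" using w0 \<phi> t by auto
          then have "0 \<le> 6 * ?a\<^sup>2 * ?b\<^sup>2 + 4 * ?a * ?b ^ 3 + ?b ^ 4" by simp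
          moreover have "(?a + ?b)\<^sup>2 * (?a + ?b)\<^sup>2 = ?a\<^sup>2 * ?a\<^sup>2 + 4 * ?a ^ 3 * ?b + (6 * ?a\<^sup>2 * ?b\<^sup>2 + 4 * ?a * ?b ^ 3 + ?b ^ 4)"
            by (simp add: power2_eq_square power3_eq_cube power4_eq_xxxx algebra_simps)
          ultimately show "(w i x)\<^sup>2 * (w i x)\<^sup>2 + 4 * t * (w i x ^ 3 * \<phi> x) \<le> (v i x)\<^sup>2 * (v i x)\<^sup>2"
            by (simp add: v_def)
        qed
        finally show ?thesis .
      qed
      have "EB \<beta> J J w + 4 * t * (\<beta> i i * ?X) =
          (\<Sum>j\<in>J. \<Sum>k\<in>J. \<beta> j k * quart (w j) (w k) + (if j = i \<and> k = i then 4 * t * (\<beta> i i * ?X) else 0))"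
      proof -
        have "(\<Sum>j\<in>J. \<Sum>k\<in>J. (if j = i \<and> k = i then c else 0)) = c" for c :: real
        proof -
          have "(\<Sum>j\<in>J. \<Sum>k\<in>J. (if j = i \<and> k = i then c else 0)) = (\<Sum>j\<in>J. if j = i then c else 0)"
            using finite_J i by (intro sum.cong) auto
          then show ?thesis using finite_J i by simp
        qed
        then show ?thesis by (simp add: EB_def sum.distrib)
      qed
      also have "\<dots> \<le> EB \<beta> J J v" unfolding EB_def
      proof (intro sum_mono)
        fix j k assume jk: "j \<in> J" "k \<in> J"
        have "quart (w j) (w k) \<le> quart (v j) (v k)" by (intro quart_mono wD vD jk wv)
        then have "\<beta> j k * quart (w j) (w k) \<le> \<beta> j k * quart (v j) (v k)" by (intro mult_left_mono \<beta>_nonneg jk)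
        moreover have "\<beta> i i * (quart (w i) (w i) + 4 * t * ?X) \<le> \<beta> i i * quart (v i) (v i)"
          by (intro mult_left_mono qii \<beta>_nonneg i)
        ultimately show "\<beta> j k * quart (w j) (w k) + (if j = i \<and> k = i then 4 * t * (\<beta> i i * ?X) else 0) \<le> \<beta> j k * quart (v j) (v k)"
          by (auto simp: algebra_simps)
      qed
      finally have Bv: "lam + 4 * t * (\<beta> i i * ?X) \<le> EB \<beta> J J v" by (simp add: Bw)
      have "lam * (lam + 4 * t * (\<beta> i i * ?X)) \<le> lam * EB \<beta> J J v" using Bv lam by (intro mult_left_mono) auto
      also have "\<dots> \<le> (EA J v)\<^sup>2" using block_level_EB_le[OF vJ vn] EA by (simp add: lam_def)
      also have "\<dots> = lam * lam + t * (4 * lam * ?D + t * (2 * lam * ?P + (2 * ?D + t * ?P)\<^sup>2))"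
        unfolding Av by (simp add: power2_eq_square algebra_simps)
      finally have "t * (4 * lam * (\<beta> i i * ?X)) \<le> t * (4 * lam * ?D + t * (2 * lam * ?P + (2 * ?D + t * ?P)\<^sup>2))"
        by (simp add: algebra_simps)
      then show ?thesis using t by (simp only: mult_le_cancel_left_pos)
    qed
    have "((\<lambda>t. 4 * lam * ?D + t * (2 * lam * ?P + (2 * ?D + t * ?P)\<^sup>2)) \<longlongrightarrow>
        4 * lam * ?D + 0 * (2 * lam * ?P + (2 * ?D + 0 * ?P)\<^sup>2)) (at_right 0)"
      by (intro tendsto_intros)
    moreover have "\<forall>\<^sub>F t in at_right 0. 4 * lam * (\<beta> i i * ?X) \<le> 4 * lam * ?D + t * (2 * lam * ?P + (2 * ?D + t * ?P)\<^sup>2)"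
      unfolding eventually_at_filter using main by (intro always_eventually) auto
    ultimately have "4 * lam * (\<beta> i i * ?X) \<le> 4 * lam * ?D + 0 * (2 * lam * ?P + (2 * ?D + 0 * ?P)\<^sup>2)"
      by (intro tendsto_lowerbound) auto
    then have "4 * lam * (\<beta> i i * ?X) \<le> 4 * lam * ?D" by simp
    then show ?thesis using lam by (simp only: mult_le_cancel_left_pos[of "4 * lam"] zero_less_mult_iff zero_less_numeral simp_thms)
  qed
  from strong_maximum_principle[OF wD[OF i] w0 \<beta>_pos[OF i] this wnz]
  show ?thesis by (simp add: w_def)
qed

end

section \<open>Blocks and the Nehari set\<close>

locale block_system =
  fixes d m :: nat and a :: "nat \<Rightarrow> nat" and \<beta> :: "nat \<Rightarrow> nat \<Rightarrow> real"
  assumes dec: "decomposition m d a"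
    and sym: "\<And>i j. i \<in> {1..d} \<Longrightarrow> j \<in> {1..d} \<Longrightarrow> \<beta> i j = \<beta> j i"
begin

lemma a_Suc: "h < m \<Longrightarrow> a h < a (Suc h)"
  using dec by (simp add: decomposition_def)

lemma a_mono: "h \<le> k \<Longrightarrow> k \<le> m \<Longrightarrow> a h \<le> a k"
proof (induction k rule: dec_induct)
  case (step n)
  then show ?case using a_Suc[of n] by simp
qed simp

lemma block_subset: "h \<in> {1..m} \<Longrightarrow> block a h \<subseteq> {1..d}"
  using a_mono[of h m] dec by (auto simp: block_def decomposition_def)

lemma block_nonempty: "h \<in> {1..m} \<Longrightarrow> block a h \<noteq> {}"
proof -
  assume "h \<in> {1..m}"
  then have "a (h - 1) < a (Suc (h - 1))" by (intro a_Suc) auto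
  then have "a h \<in> block a h" using \<open>h \<in> {1..m}\<close> by (simp add: block_def)
  then show ?thesis by blast
qed

lemma block_disjoint: "h \<in> {1..m} \<Longrightarrow> k \<in> {1..m} \<Longrightarrow> h \<noteq> k \<Longrightarrow> block a h \<inter> block a k = {}"
proof (induction h k rule: linorder_wlog)
  case (le h k)
  then have "a h \<le> a (k - 1)" by (intro a_mono) auto
  then show ?case by (auto simp: block_def)
next
  case (sym h k)
  then show ?case by blast
qed

lemma block_Union: "(\<Union>h\<in>{1..m}. block a h) = {1..d}"
proof (intro equalityI subsetI)
  fix i assume i: "i \<in> {1..d}"
  define h where "h = (LEAST h. i \<le> a h)"
  have ex: "i \<le> a m" using i dec by (simp add: decomposition_def)
  then have ih: "i \<le> a h" unfolding h_def by (rule LeastI)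
  have "h \<le> m" unfolding h_def by (rule Least_le) (rule ex)
  moreover have "h \<noteq> 0" using ih i dec by (auto simp: decomposition_def intro: ccontr)
  moreover have "a (h - 1) < i"
  proof -
    have "h - 1 < h" using \<open>h \<noteq> 0\<close> by simp
    then have "\<not> i \<le> a (h - 1)" unfolding h_def by (rule not_less_Least)
    then show ?thesis by simp
  qed
  ultimately show "i \<in> (\<Union>h\<in>{1..m}. block a h)" using ih by (auto simp: block_def intro!: bexI[of _ h])
qed (use block_subset in blast)

lemma sum_blocks: "(\<Sum>h=1..m. \<Sum>i\<in>block a h. f i) = (\<Sum>i=1..d. f i)"
  for f :: "nat \<Rightarrow> real"
  unfolding block_Union[symmetric]
  using block_disjoint finite_block by (intro sum.UNION_disjoint[symmetric]) auto

lemma EA_blocks: "(\<Sum>h=1..m. EA (block a h) u) = EA {1..d} u"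
  unfolding EA_def by (rule sum_blocks)

lemma EB_blocks: "(\<Sum>k=1..m. EB \<beta> J (block a k) u) = EB \<beta> J {1..d} u"
  unfolding EB_def by (subst sum.swap) (simp only: sum_blocks)

lemma EB_blocks_left: "(\<Sum>h=1..m. EB \<beta> (block a h) J u) = EB \<beta> {1..d} J u"
  unfolding EB_def by (rule sum_blocks)

lemma energy_eq:
  assumes u: "u \<in> D12_vec {1..d}"
  shows "energy m a \<beta> u = 1/2 * EA {1..d} u - 1/4 * EB \<beta> {1..d} {1..d} u"
proof -
  have uD: "u i \<in> D12" if "h \<in> {1..m}" "i \<in> block a h" for h i
    using u block_subset[OF that(1)] that(2) by (auto simp: D12_vec_def)
  have "(\<Sum>h=1..m. LBINT x. (\<Sum>i\<in>block a h. (norm (weak_grad (u i) x))\<^sup>2)) = (\<Sum>h=1..m. EA (block a h) u)"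
    by (intro sum.cong integral_grad_sum uD) auto
  moreover have "(\<Sum>h=1..m. \<Sum>k=1..m. LBINT x.
        (\<Sum>(i, j)\<in>block a h \<times> block a k. \<beta> i j * (u j x)\<^sup>2 * (u i x)\<^sup>2)) = (\<Sum>h=1..m. \<Sum>k=1..m. EB \<beta> (block a h) (block a k) u)"
    by (intro sum.cong integral_pair_sum uD) auto
  ultimately show ?thesis unfolding energy_def by (simp only: EA_blocks EB_blocks EB_blocks_left)
qed

text \<open>Varying \<open>u i\<close> in its own direction multiplies that component by
  \<open>1 + t\<close>, so the energy is a polynomial in \<open>t\<close>. Row \<open>i\<close> and
  column \<open>i\<close> of the quartic form contribute equally by symmetry of \<beta>, giving a
  factor 4 that absorbs the 1/4.\<close>

lemma dfun_comp_energy: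
  assumes u: "u \<in> D12_vec {1..d}" and i: "i \<in> {1..d}"
  shows "dfun_comp (energy m a \<beta>) i u (u i) = dirichlet (u i) - (\<Sum>k=1..d. \<beta> i k * quart (u i) (u k))"
proof -
  define c :: "real \<Rightarrow> nat \<Rightarrow> real" where "c t j = (if j = i then 1 + t else 1)" for t j
  let ?E = "\<lambda>t. 1/2 * (\<Sum>j=1..d. (c t j)\<^sup>2 * dirichlet (u j)) - 1/4 * (\<Sum>j=1..d. \<Sum>k=1..d. (\<beta> j k * quart (u j) (u k)) * ((c t j)\<^sup>2 * (c t k)\<^sup>2))"
  have uj: "u j \<in> D12" if "j \<in> {1..d}" for j using u that by (simp add: D12_vec_def)
  have E: "energy m a \<beta> (\<lambda>j x. u j x + t * (if j = i then u i else (\<lambda>x. 0)) x) = ?E t" for t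
  proof -
    have eq: "(\<lambda>j x. u j x + t * (if j = i then u i else (\<lambda>x. 0)) x) = (\<lambda>j x. c t j * u j x)"
      by (auto simp: c_def fun_eq_iff algebra_simps)
    have "(\<lambda>j x. c t j * u j x) \<in> D12_vec {1..d}" using uj by (auto simp: D12_vec_def intro: D12_cmult)
    then have "energy m a \<beta> (\<lambda>j x. c t j * u j x) = 1/2 * EA {1..d} (\<lambda>j x. c t j * u j x) - 1/4 * EB \<beta> {1..d} {1..d} (\<lambda>j x. c t j * u j x)"
      by (rule energy_eq)
    also have "EA {1..d} (\<lambda>j x. c t j * u j x) = (\<Sum>j=1..d. (c t j)\<^sup>2 * dirichlet (u j))"
      unfolding EA_def by (intro sum.cong refl dirichlet_cmult uj)
    also have "EB \<beta> {1..d} {1..d} (\<lambda>j x. c t j * u j x) = (\<Sum>j=1..d. \<Sum>k=1..d. (\<beta> j k * quart (u j) (u k)) * ((c t j)\<^sup>2 * (c t k)\<^sup>2))"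
      unfolding EB_def quart_scale by (simp add: mult_ac)
    finally show ?thesis unfolding eq .
  qed
  define e :: "nat \<Rightarrow> real" where "e j = (if j = i then 1 else 0)" for j
  have c0: "c 0 j = 1" for j by (simp add: c_def)
  have dc: "((\<lambda>t. c t j) has_real_derivative e j) (at 0)" for j
    unfolding c_def e_def by (cases "j = i") (auto intro!: derivative_eq_intros)
  have dc2: "((\<lambda>t. (c t j)\<^sup>2) has_real_derivative 2 * e j) (at 0)" for j
    by (rule DERIV_cong[OF DERIV_power[OF dc]]) (simp add: c0)
  have dcc: "((\<lambda>t. (c t j)\<^sup>2 * (c t k)\<^sup>2) has_real_derivative 2 * e j + 2 * e k) (at 0)" for j k
    by (rule DERIV_cong[OF DERIV_mult[OF dc2 dc2]]) (simp add: c0)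
  let ?q = "\<lambda>j k. \<beta> j k * quart (u j) (u k)"
  have "(?E has_real_derivative 1/2 * (\<Sum>j=1..d. 2 * e j * dirichlet (u j)) - 1/4 * (\<Sum>j=1..d. \<Sum>k=1..d. ?q j k * (2 * e j + 2 * e k))) (at 0)"
    by (intro DERIV_diff DERIV_cmult DERIV_sum DERIV_cmult_right dc2 dcc)
  then have "dfun_comp (energy m a \<beta>) i u (u i) = 1/2 * (\<Sum>j=1..d. 2 * e j * dirichlet (u j)) - 1/4 * (\<Sum>j=1..d. \<Sum>k=1..d. ?q j k * (2 * e j + 2 * e k))"
    unfolding dfun_comp_def dfun_def E by (rule DERIV_imp_deriv)
  moreover have "(\<Sum>j=1..d. 2 * e j * dirichlet (u j)) = 2 * dirichlet (u i)"
  proof -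
    have "(\<Sum>j=1..d. 2 * e j * dirichlet (u j)) = (\<Sum>j=1..d. if j = i then 2 * dirichlet (u j) else 0)"
      by (intro sum.cong) (auto simp: e_def)
    then show ?thesis using i by simp
  qed
  moreover have "(\<Sum>j=1..d. \<Sum>k=1..d. ?q j k * (2 * e j + 2 * e k)) = 4 * (\<Sum>k=1..d. ?q i k)"
  proof -
    have "(\<Sum>j=1..d. \<Sum>k=1..d. ?q j k * (2 * e j + 2 * e k)) = (\<Sum>j=1..d. \<Sum>k=1..d. ?q j k * (2 * e j)) + (\<Sum>j=1..d. \<Sum>k=1..d. ?q j k * (2 * e k))"
      by (simp add: distrib_left sum.distrib)
    also have "(\<Sum>j=1..d. \<Sum>k=1..d. ?q j k * (2 * e j)) = (\<Sum>j=1..d. if j = i then 2 * (\<Sum>k=1..d. ?q j k) else 0)"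
      by (intro sum.cong) (auto simp: e_def sum_distrib_left mult.commute)
    also have "\<dots> = 2 * (\<Sum>k=1..d. ?q i k)" using i by simp
    also have "(\<Sum>j=1..d. \<Sum>k=1..d. ?q j k * (2 * e k)) = (\<Sum>j=1..d. 2 * ?q j i)"
    proof (intro sum.cong refl)
      fix j
      have "(\<Sum>k=1..d. ?q j k * (2 * e k)) = (\<Sum>k=1..d. if k = i then 2 * ?q j k else 0)"
        by (intro sum.cong) (auto simp: e_def)
      then show "(\<Sum>k=1..d. ?q j k * (2 * e k)) = 2 * ?q j i" using i by simp
    qed
    also have "\<dots> = 2 * (\<Sum>k=1..d. ?q i k)"
      unfolding sum_distrib_left using sym[OF i] quart_commute by (intro sum.cong) (auto simp: quart_commute)
    finally show ?thesis by simp
  qed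
  ultimately show ?thesis by simp
qed

lemma sum_dfun_comp:
  assumes u: "u \<in> D12_vec {1..d}" and h: "h \<in> {1..m}"
  shows "(\<Sum>i\<in>block a h. dfun_comp (energy m a \<beta>) i u (u i)) = EA (block a h) u - EB \<beta> (block a h) {1..d} u"
proof -
  have "(\<Sum>i\<in>block a h. dfun_comp (energy m a \<beta>) i u (u i)) = (\<Sum>i\<in>block a h. dirichlet (u i) - (\<Sum>k=1..d. \<beta> i k * quart (u i) (u k)))"
    using block_subset[OF h] by (intro sum.cong dfun_comp_energy u) auto
  then show ?thesis by (simp add: EA_def EB_def sum_subtractf)
qed

lemma Nehari_iff:
  "u \<in> Nehari d m a \<beta> \<longleftrightarrow> u \<in> D12_vec {1..d} \<and>
     (\<forall>h\<in>{1..m}. nonzero_on (block a h) u \<and> EA (block a h) u = EB \<beta> (block a h) {1..d} u)"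
  unfolding Nehari_def using sum_dfun_comp[of u] by auto

lemma energy_Nehari:
  assumes "u \<in> Nehari d m a \<beta>" shows "energy m a \<beta> u = 1/4 * (\<Sum>h=1..m. EA (block a h) u)"
proof -
  have "EB \<beta> {1..d} {1..d} u = (\<Sum>h=1..m. EB \<beta> (block a h) {1..d} u)" by (rule EB_blocks_left[symmetric])
  also have "\<dots> = (\<Sum>h=1..m. EA (block a h) u)" using assms by (intro sum.cong) (auto simp: Nehari_iff)
  finally have "EB \<beta> {1..d} {1..d} u = EA {1..d} u" unfolding EA_blocks .
  then show ?thesis using assms energy_eq[of u] unfolding Nehari_iff EA_blocks by simp
qed

lemma energy_bdd_below: "bdd_below (energy m a \<beta> ` Nehari d m a \<beta>)"
  by (rule bdd_belowI[of _ 0]) (auto simp: energy_Nehari intro!: sum_nonneg EA_nonneg)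

end

section \<open>Vanishing interaction of distant functions\<close>

text \<open>Outside a large cube \<open>P\<close> has little mass, and inside it the far translate
  of \<open>Q\<close> has little mass. The minimum can be bounded by whichever of the two is
  convenient at each point.\<close>

lemma min_translate_tendsto_0:
  fixes P Q :: "R4 \<Rightarrow> real"
  assumes P: "integrable lborel P" "\<And>x. 0 \<le> P x" and Q: "integrable lborel Q" "\<And>x. 0 \<le> Q x" and e: "e \<noteq> 0"
  shows "(\<lambda>n. LBINT x. min (P x) (Q (real n *\<^sub>R e + x))) \<longlonglongrightarrow> 0"
proof (rule LIMSEQ_I)
  fix \<epsilon> :: real assume \<epsilon>: "0 < \<epsilon>"
  note [measurable] = borel_measurable_integrable[OF P(1)] borel_measurable_integrable[OF Q(1)]
  have Qt: "integrable lborel (\<lambda>x. Q (h + x))" for h by (rule integrable_translate[OF Q(1)])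
  have "(\<lambda>r. LBINT x. indicator (- cube (real r)) x * P x) \<longlonglongrightarrow> (LINT x|(lborel::R4 measure). 0)"
  proof (rule integral_dominated_convergence[where w=P])
    show "AE x in lborel. (\<lambda>r. indicator (- cube (real r)) x * P x) \<longlonglongrightarrow> 0"
    proof (intro AE_I2 tendsto_eventually)
      fix x :: R4
      obtain N where N: "norm x \<le> real N" using real_arch_simple by blast
      have "x \<in> cube (real r)" if "N \<le> r" for r using N that by (intro norm_le_cube) simp
      then show "\<forall>\<^sub>F r in sequentially. indicator (- cube (real r)) x * P x = 0"
        by (intro eventually_sequentiallyI[of N]) simp
    qed
  qed (use P in \<open>auto simp: indicator_def\<close>)
  then have "(\<lambda>r. LBINT x. indicator (- cube (real r)) x * P x) \<longlonglongrightarrow> 0" by simp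
  from order_tendstoD(2)[OF this, of "\<epsilon> / 2"] \<epsilon> obtain r :: nat
    where r: "(LBINT x. indicator (- cube (real r)) x * P x) < \<epsilon> / 2"
    by (auto simp: eventually_sequentially)
  \<comment> \<open>Instead of moving \<open>Q\<close> over a fixed cube, the cube moves off to
    infinity over a fixed \<open>Q\<close>, which then serves as the dominating function.\<close>
  let ?J = "\<lambda>n x. indicator (cube (real r)) (- (real n *\<^sub>R e) + x) * Q x"
  have "(\<lambda>n. LBINT x. ?J n x) \<longlonglongrightarrow> (LINT x|(lborel::R4 measure). 0)"
  proof (rule integral_dominated_convergence[where w=Q])
    obtain k where k: "e $ k \<noteq> 0" using e by (auto simp: vec_eq_iff)
    show "AE x in lborel. (\<lambda>n. ?J n x) \<longlonglongrightarrow> 0"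
    proof (intro AE_I2 tendsto_eventually)
      fix x :: R4
      obtain N where N: "(real r + \<bar>x $ k\<bar>) / \<bar>e $ k\<bar> < real N" using reals_Archimedean2 by blast
      have "- (real n *\<^sub>R e) + x \<notin> cube (real r)" if n: "N \<le> n" for n
      proof
        assume "- (real n *\<^sub>R e) + x \<in> cube (real r)"
        then have "\<bar>x $ k - real n * e $ k\<bar> \<le> real r" by (auto simp: mem_cube dest!: spec[of _ k])
        then have "real n * \<bar>e $ k\<bar> \<le> real r + \<bar>x $ k\<bar>"
          using abs_triangle_ineq2_sym[of "x $ k" "real n * e $ k"] by (simp add: abs_mult)
        moreover have "real r + \<bar>x $ k\<bar> < real N * \<bar>e $ k\<bar>" using N k by (simp add: field_simps)
        moreover have "real N * \<bar>e $ k\<bar> \<le> real n * \<bar>e $ k\<bar>" using n by (intro mult_right_mono) auto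
        ultimately show False by linarith
      qed
      then show "\<forall>\<^sub>F n in sequentially. ?J n x = 0"
        by (intro eventually_sequentiallyI[of N]) simp
    qed
  qed (use Q in \<open>auto simp: indicator_def\<close>)
  then have "(\<lambda>n. LBINT x. ?J n x) \<longlonglongrightarrow> 0" by simp
  from order_tendstoD(2)[OF this, of "\<epsilon> / 2"] \<epsilon> obtain N
    where N: "\<And>n. n \<ge> N \<Longrightarrow> (LBINT x. ?J n x) < \<epsilon> / 2"
    by (auto simp: eventually_sequentially)
  have "norm ((LBINT x. min (P x) (Q (real n *\<^sub>R e + x))) - 0) < \<epsilon>" if "n \<ge> N" for n
  proof -
    have i1: "integrable lborel (\<lambda>x. indicator (- cube (real r)) x * P x)"
      by (rule Bochner_Integration.integrable_bound[OF P(1)]) (auto simp: indicator_def)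
    have i2: "integrable lborel (\<lambda>x. indicator (cube (real r)) x * Q (real n *\<^sub>R e + x))"
      by (rule Bochner_Integration.integrable_bound[OF Qt[of "real n *\<^sub>R e"]]) (auto simp: indicator_def)
    have "(LBINT x. min (P x) (Q (real n *\<^sub>R e + x))) \<le>
      (LBINT x. indicator (- cube (real r)) x * P x + indicator (cube (real r)) x * Q (real n *\<^sub>R e + x))"
      using P(2) Q(2) by (intro integral_mono_AE' Bochner_Integration.integrable_add i1 i2 AE_I2) (auto simp: indicator_def)
    also have "\<dots> = (LBINT x. indicator (- cube (real r)) x * P x) + (LBINT x. indicator (cube (real r)) x * Q (real n *\<^sub>R e + x))"
      using i1 i2 by simp
    also have "(LBINT x. indicator (cube (real r)) x * Q (real n *\<^sub>R e + x)) = (LBINT x. ?J n x)"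
      using integral_translate(1)[of "?J n" "real n *\<^sub>R e"] by simp
    finally have "(LBINT x. min (P x) (Q (real n *\<^sub>R e + x))) < \<epsilon>" using r N[OF that] by linarith
    moreover have "0 \<le> (LBINT x. min (P x) (Q (real n *\<^sub>R e + x)))"
      using P(2) Q(2) by (intro Bochner_Integration.integral_nonneg) auto
    ultimately show ?thesis by simp
  qed
  then show "\<exists>N. \<forall>n\<ge>N. norm ((LBINT x. min (P x) (Q (real n *\<^sub>R e + x))) - 0) < \<epsilon>" by blast
qed

text \<open>Young's inequality with weight \<open>k\<close>, giving the factor \<open>1 / k\<close>
  to the smaller square. For small \<open>k\<close> the first term is small because the fourth
  powers have bounded integrals; the second is handled by
  \<open>min_translate_tendsto_0\<close>.\<close>

lemma mult_le_min:
  fixes p q k :: real assumes "0 \<le> p" "0 \<le> q" "0 < k"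
  shows "p * q \<le> k * (p\<^sup>2 + q\<^sup>2) + min (p\<^sup>2) (q\<^sup>2) / k"
proof -
  have *: "x * y \<le> k * y\<^sup>2 + x\<^sup>2 / k" if "0 \<le> x" "0 \<le> y" for x y
  proof -
    have "(k * y) * x \<le> (k * y)\<^sup>2 + x\<^sup>2" by (rule mult_le_add_squares)
    moreover have "(k * y\<^sup>2 + x\<^sup>2 / k) * k = (k * y)\<^sup>2 + x\<^sup>2" using assms(3) by (simp add: distrib_right power2_eq_square)
    ultimately have "x * y * k \<le> (k * y\<^sup>2 + x\<^sup>2 / k) * k" by (simp only: mult_ac)
    then show ?thesis using assms(3) by (simp only: mult_le_cancel_right_pos)
  qed
  have k: "0 \<le> k * p\<^sup>2" "0 \<le> k * q\<^sup>2" using assms by auto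
  have d: "k * (p\<^sup>2 + q\<^sup>2) = k * p\<^sup>2 + k * q\<^sup>2" by (rule distrib_left)
  show ?thesis
  proof (cases "p\<^sup>2 \<le> q\<^sup>2")
    case True
    then show ?thesis using *[OF assms(1,2)] k d by (simp add: min_def)
  next
    case False
    then show ?thesis using *[OF assms(2,1)] k d by (simp add: min_def mult.commute)
  qed
qed

lemma quart_translate_tendsto_0:
  assumes u: "u \<in> D12" and v: "v \<in> D12" and e: "e \<noteq> 0"
  shows "(\<lambda>n. quart u (\<lambda>x. v (real n *\<^sub>R e + x))) \<longlonglongrightarrow> 0"
proof (rule LIMSEQ_I)
  fix \<epsilon> :: real assume \<epsilon>: "0 < \<epsilon>"
  note [measurable] = D12_measurable[OF u] D12_measurable[OF v]
  let ?U = "LBINT x. u x ^ 4" and ?V = "LBINT x. v x ^ 4"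
  have UV: "0 \<le> ?U" "0 \<le> ?V" by (rule Bochner_Integration.integral_nonneg, simp)+
  \<comment> \<open>The summand 1 keeps the denominator of \<open>k\<close> positive even if both
    functions vanish.\<close>
  define S where "S = ?U + ?V + 1"
  have S: "0 < S" unfolding S_def using UV by linarith
  define k where "k = \<epsilon> / (2 * S)"
  have k: "0 < k" unfolding k_def using \<epsilon> S by simp
  have kUV: "k * (?U + ?V) \<le> \<epsilon> / 2"
  proof -
    have "k * (?U + ?V) \<le> k * S" unfolding S_def using k by (intro mult_left_mono) auto
    also have "\<dots> = \<epsilon> / 2" unfolding k_def using S by simp
    finally show ?thesis .
  qed
  let ?m = "\<lambda>n. LBINT x. min (u x ^ 4) (v (real n *\<^sub>R e + x) ^ 4)"
  have "?m \<longlonglongrightarrow> 0"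
    using min_translate_tendsto_0[OF D12_integrable[OF u] _ D12_integrable[OF v] _ e] by simp
  from order_tendstoD(2)[OF this, of "k * (\<epsilon> / 2)"] \<epsilon> k obtain N where N: "\<And>n. n \<ge> N \<Longrightarrow> ?m n < k * (\<epsilon> / 2)"
    by (auto simp: eventually_sequentially)
  have "norm (quart u (\<lambda>x. v (real n *\<^sub>R e + x)) - 0) < \<epsilon>" if "n \<ge> N" for n
  proof -
    let ?v = "\<lambda>x. v (real n *\<^sub>R e + x)"
    have vD: "?v \<in> D12" by (rule D12_translate[OF v])
    note int = D12_integrable[OF u] D12_integrable[OF vD]
    have mi: "integrable lborel (\<lambda>x. min (u x ^ 4) (?v x ^ 4))"
      by (rule Bochner_Integration.integrable_bound[OF int(1)]) auto
    have "quart u ?v \<le> (LBINT x. k * (u x ^ 4 + ?v x ^ 4) + min (u x ^ 4) (?v x ^ 4) / k)"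
      unfolding quart_def
    proof (intro integral_mono integrable_quart u vD)
      show "integrable lborel (\<lambda>x. k * (u x ^ 4 + ?v x ^ 4) + min (u x ^ 4) (?v x ^ 4) / k)"
        using int mi by simp
      show "(u x)\<^sup>2 * (?v x)\<^sup>2 \<le> k * (u x ^ 4 + ?v x ^ 4) + min (u x ^ 4) (?v x ^ 4) / k" for x
        using mult_le_min[of "(u x)\<^sup>2" "(?v x)\<^sup>2" k] k by (simp flip: power_mult)
    qed
    also have "\<dots> = k * (?U + (LBINT x. ?v x ^ 4)) + ?m n / k" using int mi by simp
    also have "(LBINT x. ?v x ^ 4) = ?V" by (rule integral_translate(1)[of "\<lambda>x. v x ^ 4"]) measurable
    finally have "quart u ?v \<le> \<epsilon> / 2 + ?m n / k" using kUV by linarith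
    also have "?m n / k < \<epsilon> / 2" using N[OF that] k by (simp add: field_simps)
    finally show ?thesis using quart_nonneg[of u ?v] by simp
  qed
  then show "\<exists>N. \<forall>n\<ge>N. norm (quart u (\<lambda>x. v (real n *\<^sub>R e + x)) - 0) < \<epsilon>" by blast
qed

lemma quart_translate:
  assumes "u \<in> D12" "v \<in> D12"
  shows "quart (\<lambda>x. u (h + x)) (\<lambda>x. v (k + x)) = quart u (\<lambda>x. v ((k - h) + x))"
proof -
  note [measurable] = D12_measurable[OF assms(1)] D12_measurable[OF assms(2)]
  show ?thesis unfolding quart_def
    using integral_translate(1)[of "\<lambda>x. (u x)\<^sup>2 * (v ((k - h) + x))\<^sup>2" h] by (simp add: algebra_simps)
qed

text \<open>Monotone iteration from the constant 1. Since the entries are nonnegative, the iterates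
  increase and stay above 1, and row sums at most \<delta> bound them by the geometric series. The
  limit solves the system.\<close>

lemma neumann_fixed_point:
  fixes e :: "'a \<Rightarrow> 'a \<Rightarrow> real"
  assumes fin: "finite H" and e: "\<And>h k. h \<in> H \<Longrightarrow> k \<in> H \<Longrightarrow> 0 \<le> e h k"
    and row: "\<And>h. h \<in> H \<Longrightarrow> (\<Sum>k\<in>H. e h k) \<le> \<delta>" and \<delta>: "0 \<le> \<delta>" "\<delta> < 1"
  shows "\<exists>\<sigma>. \<forall>h\<in>H. \<sigma> h = 1 + (\<Sum>k\<in>H. e h k * \<sigma> k) \<and> 1 \<le> \<sigma> h \<and> \<sigma> h \<le> 1 / (1 - \<delta>)"
proof -
  define s where "s = rec_nat (\<lambda>_. 1) (\<lambda>_ f h. 1 + (\<Sum>k\<in>H. e h k * f k))"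
  have s0: "s 0 h = 1" and sS: "s (Suc n) h = 1 + (\<Sum>k\<in>H. e h k * s n k)" for n h
    by (simp_all add: s_def)
  have one: "1 \<le> 1 / (1 - \<delta>)" using \<delta> by (simp add: field_simps)
  have bounds: "1 \<le> s n h \<and> s n h \<le> 1 / (1 - \<delta>)" if "h \<in> H" for n h
    using that
  proof (induction n arbitrary: h)
    case (Suc n)
    have "0 \<le> (\<Sum>k\<in>H. e h k * s n k)" using Suc e by (intro sum_nonneg mult_nonneg_nonneg) force+
    moreover have "(\<Sum>k\<in>H. e h k * s n k) \<le> (\<Sum>k\<in>H. e h k * (1 / (1 - \<delta>)))"
      using Suc e by (intro sum_mono mult_left_mono) auto
    moreover have "\<dots> = (\<Sum>k\<in>H. e h k) * (1 / (1 - \<delta>))" by (rule sum_distrib_right[symmetric])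
    moreover have "\<dots> \<le> \<delta> * (1 / (1 - \<delta>))" using row[OF Suc(2)] \<delta> by (intro mult_right_mono) auto
    moreover have "1 + \<delta> * (1 / (1 - \<delta>)) = 1 / (1 - \<delta>)" using \<delta> by (simp add: field_simps)
    ultimately show ?case unfolding sS by linarith
  qed (simp add: s0 one)
  have step: "s n h \<le> s (Suc n) h" if "h \<in> H" for n h
    using that
  proof (induction n arbitrary: h)
    case 0
    then show ?case using bounds[of h "Suc 0"] by (simp only: s0)
  next
    case (Suc n)
    then show ?case unfolding sS[of "Suc n" h] sS[of n h] using e by (intro add_left_mono sum_mono mult_left_mono) auto
  qed
  have conv: "convergent (\<lambda>n. s n h)" if "h \<in> H" for h
  proof -
    have "incseq (\<lambda>n. s n h)" using step[OF that] by (intro incseq_SucI)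
    moreover have "\<forall>n. s n h \<le> 1 / (1 - \<delta>)" using bounds[OF that] by blast
    ultimately obtain L where "(\<lambda>n. s n h) \<longlonglongrightarrow> L"
      using incseq_convergent[of "\<lambda>n. s n h" "1 / (1 - \<delta>)"] by blast
    then show ?thesis by (rule convergentI)
  qed
  define \<sigma> where "\<sigma> h = lim (\<lambda>n. s n h)" for h
  have lim: "(\<lambda>n. s n h) \<longlonglongrightarrow> \<sigma> h" if "h \<in> H" for h
    using conv[OF that] by (simp add: \<sigma>_def convergent_LIMSEQ_iff)
  show ?thesis
  proof (intro exI ballI conjI)
    fix h assume h: "h \<in> H"
    have "(\<lambda>n. s (Suc n) h) \<longlonglongrightarrow> 1 + (\<Sum>k\<in>H. e h k * \<sigma> k)"
      unfolding sS by (intro tendsto_intros lim)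
    with LIMSEQ_Suc[OF lim[OF h]] show "\<sigma> h = 1 + (\<Sum>k\<in>H. e h k * \<sigma> k)" by (rule LIMSEQ_unique)
    show "1 \<le> \<sigma> h" by (rule LIMSEQ_le_const[OF lim[OF h]]) (use bounds[OF h] in auto)
    show "\<sigma> h \<le> 1 / (1 - \<delta>)" by (rule LIMSEQ_le_const2[OF lim[OF h]]) (use bounds[OF h] in auto)
  qed
qed

section \<open>The least energy level\<close>

locale competitive_system = block_system +
  assumes diag: "\<And>i. i \<in> {1..d} \<Longrightarrow> 0 < \<beta> i i"
    and K1_nonneg: "\<And>i j. (i, j) \<in> K1 m a \<Longrightarrow> 0 \<le> \<beta> i j"
    and K2_nonpos: "\<And>i j. (i, j) \<in> K2 m a \<Longrightarrow> \<beta> i j \<le> 0"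
begin

lemma attractive: "h \<in> {1..m} \<Longrightarrow> attractive_block a \<beta> h"
proof
  fix i j assume h: "h \<in> {1..m}" and i: "i \<in> block a h" and j: "j \<in> block a h"
  show "0 \<le> \<beta> i j"
  proof (cases "i = j")
    case True
    then show ?thesis using diag[of i] block_subset[OF h] i by force
  next
    case False
    then show ?thesis using h i j by (intro K1_nonneg) (auto simp: K1_def)
  qed
next
  fix i assume "h \<in> {1..m}" "i \<in> block a h"
  then show "0 < \<beta> i i" using diag block_subset by blast
qed (rule block_nonempty)

lemma EB_cross_terms_nonpos:
  assumes "h \<in> {1..m}" "k \<in> {1..m}" "h \<noteq> k" "i \<in> block a h" "j \<in> block a k"
  shows "\<beta> i j * quart (u i) (u j) \<le> 0"
proof -
  have "(i, j) \<in> K2 m a" using assms unfolding K2_def by blast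
  then show ?thesis by (intro mult_nonpos_nonneg quart_nonneg K2_nonpos)
qed

lemma EB_cross_nonpos:
  assumes "h \<in> {1..m}" "k \<in> {1..m}" "h \<noteq> k" shows "EB \<beta> (block a h) (block a k) u \<le> 0"
  unfolding EB_def using assms by (intro sum_nonpos EB_cross_terms_nonpos[of h k])

lemma EB_split:
  assumes "h \<in> {1..m}"
  shows "EB \<beta> (block a h) {1..d} u = EB \<beta> (block a h) (block a h) u + (\<Sum>k\<in>{1..m} - {h}. EB \<beta> (block a h) (block a k) u)"
  unfolding EB_blocks[symmetric] using assms by (intro sum.remove) auto

lemma D12_vec_block: "u \<in> D12_vec {1..d} \<Longrightarrow> h \<in> {1..m} \<Longrightarrow> u \<in> D12_vec (block a h)"
  using block_subset by (force simp: D12_vec_def)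

text \<open>The interactions in the constraint of a block are nonpositive, so dropping them gives EA
  \<le> EB for the block alone. Multiplied by four times the level and combined with the level
  inequality, this leaves 4 times the level times EA below EA^2, and EA > 0 cancels.\<close>

lemma Nehari_block:
  assumes u: "u \<in> Nehari d m a \<beta>" and h: "h \<in> {1..m}"
  shows "u \<in> D12_vec (block a h)" "nonzero_on (block a h) u"
    "EA (block a h) u \<le> EB \<beta> (block a h) (block a h) u"
    "4 * block_level a \<beta> h \<le> EA (block a h) u"
proof -
  interpret attractive_block a \<beta> h by (rule attractive[OF h])
  show D: "u \<in> D12_vec (block a h)" and n: "nonzero_on (block a h) u"
    using u h D12_vec_block by (auto simp: Nehari_iff)
  have "(\<Sum>k\<in>{1..m} - {h}. EB \<beta> (block a h) (block a k) u) \<le> 0"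
    using h by (intro sum_nonpos EB_cross_nonpos) auto
  then show le: "EA (block a h) u \<le> EB \<beta> (block a h) (block a h) u"
    using u h EB_split[OF h, of u] by (auto simp: Nehari_iff)
  have pos: "0 < EA J u" "0 < EB \<beta> J J u" using EA_pos[OF finite_J D n] EB_J_pos[OF D n] by auto
  show "4 * block_level a \<beta> h \<le> EA (block a h) u"
  \<comment> \<open>The multiplication keeps the direction of the inequality only for a nonnegative
    level; for a negative one the claim follows from EA > 0.\<close>
  proof (cases "0 \<le> block_level a \<beta> h")
    case True
    then have "4 * block_level a \<beta> h * EA J u \<le> 4 * block_level a \<beta> h * EB \<beta> J J u" using le by (intro mult_left_mono) auto
    also have "\<dots> \<le> EA J u * EA J u" using block_level_EB_le[OF D n] by (simp add: power2_eq_square)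
    finally show ?thesis using pos by (simp only: mult_le_cancel_right_pos)
  next
    case False
    then show ?thesis using pos by linarith
  qed
qed

lemma sum_block_level_le:
  assumes u: "u \<in> Nehari d m a \<beta>"
  shows "(\<Sum>h=1..m. block_level a \<beta> h) \<le> energy m a \<beta> u"
proof -
  have "(\<Sum>h=1..m. block_level a \<beta> h) \<le> (\<Sum>h=1..m. 1/4 * EA (block a h) u)"
  proof (rule sum_mono)
    fix h assume "h \<in> {1..m}"
    from Nehari_block(4)[OF u this] show "block_level a \<beta> h \<le> 1/4 * EA (block a h) u" by simp
  qed
  then show ?thesis unfolding energy_Nehari[OF u] sum_distrib_left .
qed

text \<open>The gaps between the blocks' energies and their levels are nonnegative and sum to zero,
  so each vanishes. With EA equal to four times the level, the level inequality becomes EB \<le> EA,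
  the converse of the bound forced by competition.\<close>

lemma minimal_Nehari_block:
  assumes u: "u \<in> Nehari d m a \<beta>" and min: "energy m a \<beta> u = (\<Sum>h=1..m. block_level a \<beta> h)" and h: "h \<in> {1..m}"
  shows "EA (block a h) u = 4 * block_level a \<beta> h" "EB \<beta> (block a h) (block a h) u = EA (block a h) u"
proof -
  interpret attractive_block a \<beta> h by (rule attractive[OF h])
  have "(\<Sum>h=1..m. EA (block a h) u - 4 * block_level a \<beta> h) = 0"
    using min unfolding energy_Nehari[OF u] by (simp add: sum_subtractf flip: sum_distrib_left)
  moreover have "0 \<le> EA (block a k) u - 4 * block_level a \<beta> k" if "k \<in> {1..m}" for k
    using Nehari_block(4)[OF u that] by simp
  ultimately have "\<forall>h\<in>{1..m}. EA (block a h) u - 4 * block_level a \<beta> h = 0"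
    by (subst (asm) sum_nonneg_eq_0_iff) auto
  then show eq: "EA (block a h) u = 4 * block_level a \<beta> h" using h by simp
  note N = Nehari_block[OF u h]
  have "EA J u * EB \<beta> J J u \<le> EA J u * EA J u" using block_level_EB_le[OF N(1,2)] by (simp add: eq power2_eq_square)
  then have "EB \<beta> J J u \<le> EA J u" using EA_pos[OF finite_J N(1,2)] by (simp only: mult_le_cancel_left_pos)
  with N(3) show "EB \<beta> (block a h) (block a h) u = EA (block a h) u" by simp
qed

text \<open>Each block has a component that is not zero almost everywhere. Positivity is used for
  one of the two only: if \<open>u i\<close> vanishes almost nowhere, then a vanishing product with
  \<open>u j\<close> makes \<open>u j\<close> zero almost everywhere.\<close>

lemma minimal_not_achieved:
  assumes u: "u \<in> Nehari d m a \<beta>" and hk: "h \<in> {1..m}" "k \<in> {1..m}" "h \<noteq> k"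
    and neg: "\<And>i j. i \<in> block a h \<Longrightarrow> j \<in> block a k \<Longrightarrow> \<beta> i j < 0"
  shows "energy m a \<beta> u \<noteq> (\<Sum>h=1..m. block_level a \<beta> h)"
proof
  assume min: "energy m a \<beta> u = (\<Sum>h=1..m. block_level a \<beta> h)"
  interpret attractive_block a \<beta> h by (rule attractive[OF hk(1)])
  note N = Nehari_block[OF u hk(1)]
  note E = minimal_Nehari_block[OF u min hk(1)]
  have "EB \<beta> J {1..d} u = EA J u" using u hk(1) by (simp add: Nehari_iff)
  then have "(\<Sum>l\<in>{1..m} - {h}. - EB \<beta> J (block a l) u) = 0"
    using EB_split[OF hk(1), of u] E(2) by (simp add: sum_negf)
  then have "\<forall>l\<in>{1..m} - {h}. - EB \<beta> J (block a l) u = 0"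
    using hk(1) EB_cross_nonpos by (subst (asm) sum_nonneg_eq_0_iff) auto
  then have zero: "EB \<beta> J (block a k) u = 0" using hk by auto
  obtain i j where i: "i \<in> J" "\<not> (AE x in lborel. u i x = 0)" and j: "j \<in> block a k" "\<not> (AE x in lborel. u j x = 0)"
    using N(2) Nehari_block(2)[OF u hk(2)] by (auto simp: nonzero_on_def)
  have "(\<Sum>j\<in>block a k. \<beta> i j * quart (u i) (u j)) = 0"
  proof -
    have "(\<Sum>i\<in>J. - (\<Sum>j\<in>block a k. \<beta> i j * quart (u i) (u j))) = 0" using zero by (simp add: EB_def sum_negf)
    moreover have "(\<Sum>j\<in>block a k. \<beta> i j * quart (u i) (u j)) \<le> 0" if "i \<in> J" for i
      using that hk by (intro sum_nonpos EB_cross_terms_nonpos[of h k])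
    ultimately have "\<forall>i\<in>J. - (\<Sum>j\<in>block a k. \<beta> i j * quart (u i) (u j)) = 0"
      by (subst (asm) sum_nonneg_eq_0_iff) (auto simp: finite_J)
    then show ?thesis using i by simp
  qed
  then have "(\<Sum>j\<in>block a k. - (\<beta> i j * quart (u i) (u j))) = 0" by (simp add: sum_negf)
  then have "\<forall>j\<in>block a k. - (\<beta> i j * quart (u i) (u j)) = 0"
    using EB_cross_terms_nonpos[OF hk i(1)] by (subst (asm) sum_nonneg_eq_0_iff) (auto simp: finite_block)
  then have "\<beta> i j * quart (u i) (u j) = 0" using j by simp
  then have "quart (u i) (u j) = 0" using neg[OF i(1) j(1)] by simp
  moreover have "u i \<in> D12" "u j \<in> D12" using N(1) Nehari_block(1)[OF u hk(2)] i j by (auto simp: D12_vec_def)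
  ultimately have "AE x in lborel. u i x = 0 \<or> u j x = 0" by (intro quart_eq_0_imp)
  moreover have "AE x in lborel. u i x \<noteq> 0" by (rule minimizer_nonvanishing[OF N(1) E i])
  ultimately have "AE x in lborel. u j x = 0" by eventually_elim simp
  with j(2) show False by blast
qed

section \<open>Upper bound by separated profiles\<close>

definition blk :: "nat \<Rightarrow> nat" where
  "blk i = (THE h. h \<in> {1..m} \<and> i \<in> block a h)"

lemma blk_eq: "h \<in> {1..m} \<Longrightarrow> i \<in> block a h \<Longrightarrow> blk i = h"
  unfolding blk_def using block_disjoint by (intro the_equality) blast+

lemma EA_block_scale:
  assumes "h \<in> {1..m}" "u \<in> D12_vec (block a h)"
  shows "EA (block a h) (\<lambda>i x. c (blk i) * u i x) = (c h)\<^sup>2 * EA (block a h) u"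
  unfolding EA_def sum_distrib_left using assms
  by (intro sum.cong) (auto simp: blk_eq dirichlet_cmult D12_vec_def)

lemma EB_block_scale:
  assumes "h \<in> {1..m}" "k \<in> {1..m}"
  shows "EB \<beta> (block a h) (block a k) (\<lambda>i x. c (blk i) * u i x) = (c h)\<^sup>2 * (c k)\<^sup>2 * EB \<beta> (block a h) (block a k) u"
  unfolding EB_def sum_distrib_left using assms
  by (intro sum.cong) (auto simp: blk_eq quart_scale mult_ac)

text \<open>Nearly optimal profiles of the blocks are moved far apart, so that the Nehari system for the
  scaling factors becomes a small perturbation of the identity.\<close>

lemma approximate_minimizer:
  assumes \<eta>: "0 < \<eta>" "\<eta> < 1"
  shows "\<exists>u\<in>Nehari d m a \<beta>. energy m a \<beta> u \<le> 1 / (1 - \<eta>) * (\<Sum>h=1..m. block_level a \<beta> h + \<eta>)"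
proof -
  have "\<exists>v. v \<in> block_Nehari a \<beta> h \<and> block_energy a \<beta> h v < block_level a \<beta> h + \<eta>" if h: "h \<in> {1..m}" for h
  proof -
    interpret attractive_block a \<beta> h by (rule attractive[OF h])
    have "\<exists>y\<in>block_energy a \<beta> h ` block_Nehari a \<beta> h. y < block_level a \<beta> h + \<eta>"
      using block_Nehari_nonempty \<eta> by (intro cInf_lessD) (auto simp: block_level_def)
    then show ?thesis by blast
  qed
  then obtain v where v: "\<And>h. h \<in> {1..m} \<Longrightarrow> v h \<in> block_Nehari a \<beta> h \<and> block_energy a \<beta> h (v h) < block_level a \<beta> h + \<eta>"
    by metis
  define A where "A h = EA (block a h) (v h)" for h
  have vh: "v h \<in> D12_vec (block a h)" "nonzero_on (block a h) (v h)" "EB \<beta> (block a h) (block a h) (v h) = A h"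
    "1/4 * A h \<le> block_level a \<beta> h + \<eta>" if "h \<in> {1..m}" for h
    using v[OF that] block_energy_Nehari[of "v h" a \<beta> h] by (auto simp: block_Nehari_iff A_def)
  have A: "0 < A h" if "h \<in> {1..m}" for h unfolding A_def using vh[OF that] by (intro EA_pos finite_block)
  have vD: "v h i \<in> D12" if "h \<in> {1..m}" "i \<in> block a h" for h i using vh(1)[OF that(1)] that(2) by (simp add: D12_vec_def)
  let ?e = "axis 0 1 :: R4"
  \<comment> \<open>Block \<open>h\<close> is shifted by \<open>n * h\<close> along one axis.
    Components of the same block move together, which preserves the block's own quantities, while
    the relative shift of two blocks is \<open>n\<close> times the nonzero difference of their
    indices.\<close>
  define w :: "nat \<Rightarrow> fam" where "w n i x = v (blk i) i ((real n * real (blk i)) *\<^sub>R ?e + x)" for n i x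
  have w_eq: "w n i = (\<lambda>x. v h i ((real n * real h) *\<^sub>R ?e + x))" if "h \<in> {1..m}" "i \<in> block a h" for n h i
    using that by (simp add: w_def[abs_def] blk_eq)
  have wD: "w n i \<in> D12" if "h \<in> {1..m}" "i \<in> block a h" for n h i
    unfolding w_eq[OF that] by (intro D12_translate vD that)
  have wJ: "w n \<in> D12_vec (block a h)" if "h \<in> {1..m}" for n h using wD[OF that] by (simp add: D12_vec_def)
  have wA: "EA (block a h) (w n) = A h" if "h \<in> {1..m}" for n h
    unfolding EA_def A_def using that by (intro sum.cong refl) (simp add: w_eq dirichlet_translate vD)
  have wB: "EB \<beta> (block a h) (block a h) (w n) = A h" if "h \<in> {1..m}" for n h
    unfolding vh(3)[OF that, symmetric] EB_def using that
    by (intro sum.cong refl) (simp add: w_eq quart_translate vD)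
  have wn: "nonzero_on (block a h) (w n)" if h: "h \<in> {1..m}" for n h
  proof -
    obtain i where i: "i \<in> block a h" "\<not> (AE x in lborel. v h i x = 0)" using vh(2)[OF h] by (auto simp: nonzero_on_def)
    have "\<not> (AE x in lborel. w n i x = 0)"
    proof
      assume "AE x in lborel. w n i x = 0"
      from AE_lborel_translate[OF this, of "- ((real n * real h) *\<^sub>R ?e)"] i(2) show False
        unfolding w_eq[OF h i(1)] by simp
    qed
    with i(1) show ?thesis by (auto simp: nonzero_on_def)
  qed
  have cross: "(\<lambda>n. EB \<beta> (block a h) (block a k) (w n)) \<longlonglongrightarrow> 0" if hk: "h \<in> {1..m}" "k \<in> {1..m}" "h \<noteq> k" for h k
  proof -
    have "(\<lambda>n. quart (w n i) (w n j)) \<longlonglongrightarrow> 0" if ij: "i \<in> block a h" "j \<in> block a k" for i j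
    proof -
      have "quart (w n i) (w n j) = quart (v h i) (\<lambda>x. v k j (real n *\<^sub>R ((real k - real h) *\<^sub>R ?e) + x))" for n
        unfolding w_eq[OF hk(1) ij(1)] w_eq[OF hk(2) ij(2)]
        by (subst quart_translate) (use hk ij vD in \<open>auto simp: algebra_simps simp flip: scaleR_left_diff_distrib\<close>)
      moreover have "(real k - real h) *\<^sub>R ?e \<noteq> 0" using hk(3) by (simp add: axis_eq_0_iff)
      ultimately show ?thesis using quart_translate_tendsto_0[OF vD[OF hk(1) ij(1)] vD[OF hk(2) ij(2)]] by (simp only:)
    qed
    then have "(\<lambda>n. EB \<beta> (block a h) (block a k) (w n)) \<longlonglongrightarrow> (\<Sum>i\<in>block a h. \<Sum>j\<in>block a k. \<beta> i j * 0)"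
      unfolding EB_def by (intro tendsto_sum tendsto_mult tendsto_const)
    then show ?thesis by simp
  qed
  \<comment> \<open>If \<sigma> denotes the squared amplitudes, dividing the constraint of block
    \<open>h\<close> by \<open>\<sigma> h * A h\<close> yields
    \<open>\<sigma> h = 1 + (\<Sum>k=1..m. e n h k * \<sigma> k)\<close>. The diagonal entry is 0
    because the block's own term is the left-hand side, and competition makes the other entries
    nonnegative.\<close>
  define e where "e n h k = (if k = h then 0 else - EB \<beta> (block a h) (block a k) (w n) / A h)" for n h k
  have e_nonneg: "0 \<le> e n h k" if "h \<in> {1..m}" "k \<in> {1..m}" for n h k
    using EB_cross_nonpos[OF that] A[OF that(1)] by (auto simp: e_def intro!: divide_nonpos_pos)
  have "\<forall>\<^sub>F n in sequentially. \<forall>h\<in>{1..m}. (\<Sum>k=1..m. e n h k) \<le> \<eta>"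
  proof (rule eventually_ball_finite)
    show "\<forall>h\<in>{1..m}. \<forall>\<^sub>F n in sequentially. (\<Sum>k=1..m. e n h k) \<le> \<eta>"
    proof
      fix h assume h: "h \<in> {1..m}"
      have "(\<lambda>n. e n h k) \<longlonglongrightarrow> 0" if "k \<in> {1..m}" for k
      proof (cases "k = h")
        case False
        then have "(\<lambda>n. - EB \<beta> (block a h) (block a k) (w n) / A h) \<longlonglongrightarrow> - 0 / A h"
          using A[OF h] cross[OF h that] by (intro tendsto_intros) auto
        then show ?thesis using False by (simp add: e_def)
      qed (simp add: e_def)
      then have "(\<lambda>n. \<Sum>k=1..m. e n h k) \<longlonglongrightarrow> (\<Sum>k=1..m. 0)" by (intro tendsto_sum)
      from order_tendstoD(2)[OF this, of \<eta>] \<eta> show "\<forall>\<^sub>F n in sequentially. (\<Sum>k=1..m. e n h k) \<le> \<eta>"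
        by (auto elim: eventually_mono)
    qed
  qed simp
  then obtain n where row: "\<And>h. h \<in> {1..m} \<Longrightarrow> (\<Sum>k=1..m. e n h k) \<le> \<eta>"
    unfolding eventually_sequentially by blast
  obtain \<sigma> where \<sigma>: "\<And>h. h \<in> {1..m} \<Longrightarrow> \<sigma> h = 1 + (\<Sum>k=1..m. e n h k * \<sigma> k)"
    "\<And>h. h \<in> {1..m} \<Longrightarrow> 1 \<le> \<sigma> h" "\<And>h. h \<in> {1..m} \<Longrightarrow> \<sigma> h \<le> 1 / (1 - \<eta>)"
    using neumann_fixed_point[of "{1..m}" "e n" \<eta>, OF finite_atLeastAtMost e_nonneg row less_imp_le[OF \<eta>(1)] \<eta>(2)] by blast
  define c where "c h = sqrt (\<sigma> h)" for h
  have c2: "(c h)\<^sup>2 = \<sigma> h" if "h \<in> {1..m}" for h using \<sigma>(2)[OF that] by (simp add: c_def)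
  have c0: "c h \<noteq> 0" if "h \<in> {1..m}" for h using \<sigma>(2)[OF that] by (simp add: c_def)
  define u :: fam where "u = (\<lambda>i x. c (blk i) * w n i x)"
  have uA: "EA (block a h) u = \<sigma> h * A h" if "h \<in> {1..m}" for h
    unfolding u_def by (simp only: EA_block_scale[OF that wJ[OF that]] c2[OF that] wA[OF that])
  have uB: "EB \<beta> (block a h) (block a k) u = \<sigma> h * \<sigma> k * EB \<beta> (block a h) (block a k) (w n)" if "h \<in> {1..m}" "k \<in> {1..m}" for h k
    unfolding u_def by (simp only: EB_block_scale[OF that] c2[OF that(1)] c2[OF that(2)])
  have uN: "u \<in> Nehari d m a \<beta>"
    unfolding Nehari_iff
  proof (intro conjI ballI)
    show "u \<in> D12_vec {1..d}"
      unfolding D12_vec_def u_def block_Union[symmetric] by (auto intro!: D12_cmult wD)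
    fix h assume h: "h \<in> {1..m}"
    show "nonzero_on (block a h) u"
    proof -
      obtain i where i: "i \<in> block a h" "\<not> (AE x in lborel. w n i x = 0)" using wn[OF h, of n] by (auto simp: nonzero_on_def)
      then have "\<not> (AE x in lborel. u i x = 0)" using c0[OF h] by (simp add: u_def blk_eq[OF h])
      with i(1) show ?thesis by (auto simp: nonzero_on_def)
    qed
    have "EB \<beta> (block a h) {1..d} u = \<sigma> h * \<sigma> h * A h + (\<Sum>k\<in>{1..m} - {h}. \<sigma> h * \<sigma> k * EB \<beta> (block a h) (block a k) (w n))"
      unfolding EB_split[OF h] using h by (simp add: uB wB)
    also have "(\<Sum>k\<in>{1..m} - {h}. \<sigma> h * \<sigma> k * EB \<beta> (block a h) (block a k) (w n)) = (\<Sum>k\<in>{1..m} - {h}. - (\<sigma> h * A h * (e n h k * \<sigma> k)))"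
      using A[OF h] by (intro sum.cong) (auto simp: e_def)
    also have "\<dots> = - (\<sigma> h * A h * (\<Sum>k\<in>{1..m} - {h}. e n h k * \<sigma> k))"
      by (simp add: sum_negf sum_distrib_left)
    also have "(\<Sum>k\<in>{1..m} - {h}. e n h k * \<sigma> k) = (\<Sum>k=1..m. e n h k * \<sigma> k)"
      using h by (subst (2) sum.remove[of _ h]) (auto simp: e_def)
    also have "\<dots> = \<sigma> h - 1" using \<sigma>(1)[OF h] by simp
    finally show "EA (block a h) u = EB \<beta> (block a h) {1..d} u" unfolding uA[OF h] by (simp add: algebra_simps)
  qed
  have "energy m a \<beta> u = (\<Sum>h=1..m. \<sigma> h * (1/4 * A h))"
    unfolding energy_Nehari[OF uN] sum_distrib_left by (intro sum.cong) (auto simp: uA)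
  also have "\<dots> \<le> (\<Sum>h=1..m. 1 / (1 - \<eta>) * (block_level a \<beta> h + \<eta>))"
  proof (rule sum_mono)
    fix h assume h: "h \<in> {1..m}"
    show "\<sigma> h * (1/4 * A h) \<le> 1 / (1 - \<eta>) * (block_level a \<beta> h + \<eta>)"
      using A[OF h] \<eta> by (intro mult_mono \<sigma>(3)[OF h] vh(4)[OF h]) auto
  qed
  also have "\<dots> = 1 / (1 - \<eta>) * (\<Sum>h=1..m. block_level a \<beta> h + \<eta>)" by (rule sum_distrib_left[symmetric])
  finally show ?thesis using uN by blast
qed

lemma level_eq: "level d m a \<beta> = (\<Sum>h=1..m. block_level a \<beta> h)"
proof (rule antisym)
  let ?L = "\<Sum>h=1..m. block_level a \<beta> h"
  have "level d m a \<beta> \<le> 1 / (1 - \<eta>) * (?L + real m * \<eta>)" if \<eta>: "0 < \<eta>" "\<eta> < 1" for \<eta>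
  proof -
    obtain u where u: "u \<in> Nehari d m a \<beta>" "energy m a \<beta> u \<le> 1 / (1 - \<eta>) * (\<Sum>h=1..m. block_level a \<beta> h + \<eta>)"
      using approximate_minimizer[OF \<eta>] by blast
    have "level d m a \<beta> \<le> energy m a \<beta> u"
      unfolding level_def by (intro cInf_lower imageI u energy_bdd_below)
    then show ?thesis using u(2) by (simp add: sum.distrib)
  qed
  then have "\<forall>\<^sub>F \<eta> in at_right 0. level d m a \<beta> \<le> 1 / (1 - \<eta>) * (?L + real m * \<eta>)"
    unfolding eventually_at_right_field by (intro exI[of _ 1]) auto
  moreover have "((\<lambda>\<eta>. 1 / (1 - \<eta>) * (?L + real m * \<eta>)) \<longlongrightarrow> 1 / (1 - 0) * (?L + real m * 0)) (at_right 0)"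
    by (intro tendsto_intros) auto
  ultimately have "level d m a \<beta> \<le> 1 / (1 - 0) * (?L + real m * 0)"
    by (intro tendsto_lowerbound) auto
  then show "level d m a \<beta> \<le> ?L" by simp
  \<comment> \<open>A lower bound passes to \<open>Inf\<close> only for nonempty sets of reals; any
    admissible value such as 1/2 supplies an element.\<close>
  have "Nehari d m a \<beta> \<noteq> {}" using approximate_minimizer[of "1/2"] by auto
  then show "?L \<le> level d m a \<beta>"
    unfolding level_def using sum_block_level_le by (intro cInf_greatest) blast+
qed

end

theorem theorem1p12:
  fixes d m :: nat and a :: "nat \<Rightarrow> nat" and \<beta> :: "nat \<Rightarrow> nat \<Rightarrow> real"
  assumes "d \<ge> 2"
    and "\<forall>i\<in>{1..d}. \<beta> i i > 0"
    and "\<forall>i\<in>{1..d}. \<forall>j\<in>{1..d}. i \<noteq> j \<longrightarrow> \<beta> i j = \<beta> j i"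
    and "2 \<le> m" and "m \<le> d"
    and "decomposition m d a"
    and "\<forall>(i, j)\<in>K1 m a. \<beta> i j \<ge> 0"
    and "\<forall>(i, j)\<in>K2 m a. \<beta> i j \<le> 0"
    and "\<exists>h1\<in>{1..m}. \<exists>h2\<in>{1..m}. h1 \<noteq> h2 \<and> (\<forall>(i, j)\<in>block a h1 \<times> block a h2. \<beta> i j < 0)"
  shows "\<not> (\<exists>u\<in>Nehari d m a \<beta>. energy m a \<beta> u = level d m a \<beta>) \<and>
         level d m a \<beta> = (\<Sum>h=1..m. block_level a \<beta> h)"
proof -
  interpret competitive_system d m a \<beta>
  proof
    show "decomposition m d a" by fact
    show "\<beta> i j = \<beta> j i" if "i \<in> {1..d}" "j \<in> {1..d}" for i j
      using assms(3) that by (cases "i = j") auto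
    show "0 < \<beta> i i" if "i \<in> {1..d}" for i using assms(2) that by blast
    show "0 \<le> \<beta> i j" if "(i, j) \<in> K1 m a" for i j using assms(7) that by blast
    show "\<beta> i j \<le> 0" if "(i, j) \<in> K2 m a" for i j using assms(8) that by blast
  qed
  obtain h k where hk: "h \<in> {1..m}" "k \<in> {1..m}" "h \<noteq> k"
    and neg: "\<And>i j. i \<in> block a h \<Longrightarrow> j \<in> block a k \<Longrightarrow> \<beta> i j < 0"
    using assms(9) by blast
  have "energy m a \<beta> u \<noteq> level d m a \<beta>" if "u \<in> Nehari d m a \<beta>" for u
    unfolding level_eq using minimal_not_achieved[OF that hk neg] .
  then show ?thesis using level_eq by blast
qed

end
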